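(* For each $a\in\{0,1\}$ there is a partial function $F^a=(F^a_0,F^a_1,F^a_2):\omega^\omega\to(\omega^\omega)^3$, recursive on its domain, such that: (a) For each $1\le\xi\le2$ and each $\gamma\in BC_\xi$, setting $B:=2^\omega\setminus\rho^{2^\omega}(\gamma)\in\mathbf{\Pi}^0_\xi$, $F^0(\gamma)$ is defined and (1) $F^0_0(\gamma)\in BC_1$; set $C:=\omega^\omega\setminus\rho^{\omega^\omega}(F^0_0(\gamma))\in\mathbf{\Pi}^0_1$; (2) $f:=\{F^0_1(\gamma)\}^{\omega^\omega,2^\omega}$ restricted to $C$ defines a continuous bijection from $C$ onto $B$; (3) $F^0_2(\gamma)\in BC_1$, and the open set $\rho^{2^\omega\times\omega}(F^0_2(\gamma))$ computes on $B$ a partial function $g:2^\omega\to\omega^\omega$, defined and continuous on $B$, which coincides with $f^{-1}$ (on $B$). (b) For each $1\le\xi<\omega_1$ and each $\gamma\in BC_\xi$, setting $B:=2^\omega\setminus\rho^{2^\omega}(\gamma)\in\mathbf{\Pi}^0_\xi$, $F^1(\gamma)$ is defined and (1) $F^1_0(\gamma)\in BC_1$; set $C:=\omega^\omega\setminus\rho^{\omega^\omega}(F^1_0(\gamma))\in\mathbf{\Pi}^0_1$; (2) $f:=\{F^1_1(\gamma)\}^{\omega^\omega,2^\omega}$ restricted to $C$ defines a continuous bijection from $C$ onto $B$; (3) $F^1_2(\gamma)\in BC_{\xi^-}$, and the $\mathbf{\Sigma}^0_{\xi^-}$ set $\rho^{2^\omega\times\omega}(F^1_2(\gamma))$ computes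 on $B$ a partial function $g:2^\omega\to\omega^\omega$, defined and $\mathbf{\Sigma}^0_{\xi^-}$-measurable on $B$, which coincides with $f^{-1}$ (on $B$).
   Context: For a countable ordinal $\xi$, $\xi-1$ is the predecessor of $\xi$ if it exists and $\xi$ otherwise; $\xi^-:=\xi-1$ if $\xi\ge3$, and $\xi^-:=\xi$ otherwise. Boldface classes are the usual Borel classes. Effective notions (recursively presented Polish spaces, recursive functions) are those of Moschovakis' book "Descriptive Set Theory". Each recursively presented Polish space $X$ has its standard effective enumeration $(N(X,k))_{k\in\omega}$ of a neighbourhood basis (possibly with empty sets; $N(X,0)=\emptyset$). $X$ is of type at most $1$ if it is a finite product of spaces equal to $\omega$, $\omega^\omega$ or $2^\omega$. $B\in\Sigma^0_1(X)$ iff $B=\bigcup_{i}N(X,\varepsilon(i))$ for some recursive $\varepsilon:\omega\to\omega$. Fix a good parametrization: sets $G^X\in\Sigma^0_1(\omega^\omega\times X)$, one for each recursively presented Polish $X$, such that $P\subseteq X$ is open iff $P=G^X_\gamma$ for some $\gamma\in\omega^\omega$, $P$ is $\Sigma^0_1$ iff $P=G^X_\gamma$ for some recursive $\gamma$, and for $X$ of type at most 1 and any $Y$ there is a recursive $S^{X,Y}:\omega^\omega\times X\to\omega^\omega$ with $(\gamma,x,y)\in G^{X\times Y}\Leftrightarrow(S^{X,Y}(\gamma,x),y)\in G^Y$. For $\gamma\in\omega^\omega$, $\{\gamma\}^{X,Y}$ is the partial function from $X$ to $Y$ with $\{\gamma\}^{X,Y}(x)$ defined and equal to $y$ iff $y$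 is the (unique) point with $\forall k\,[y\in N(Y,k)\Leftrightarrow(\gamma,x,k)\in G^{X\times\omega}]$; write $\{\gamma\}$ when $Y=\omega^\omega$. Borel codes: let $\gamma^*(i):=\gamma(i+1)$. $BC_1:=\{\gamma\in\omega^\omega\mid\gamma(0)=0\}$ and for $2\le\xi<\omega_1$, $BC_\xi:=\{\gamma\in\omega^\omega\mid\gamma(0)=1$ and $\forall i\in\omega$, $\{\gamma^*\}(i)$ is defined and in $\bigcup_{1\le\eta<\xi}BC_\eta\}$; $BC:=\bigcup_{1\le\xi<\omega_1}BC_\xi$. For $\gamma\in BC$, $\rho^X(\gamma):=\bigcup_iN(X,\gamma^*(i))$ if $\gamma\in BC_1$, and $\rho^X(\gamma):=\bigcup_iX\setminus\rho^X(\{\gamma^*\}(i))$ otherwise. For a partial function $f:X\to Y$ and $D\subseteq\mathrm{Domain}(f)$, a set $P\subseteq X\times\omega$ computes $f$ on $D$ if for all $x\in D$ and $k\in\omega$, $f(x)\in N(Y,k)\Leftrightarrow(x,k)\in P$; $f$ is recursive on $D$ if some $P\in\Sigma^0_1(X\times\omega)$ computes $f$ on $D$. *)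

theory Defs
  imports "HOL-Analysis.Analysis" "HOL-Library.Nat_Bijection"
begin

section \<open>Countable ordinals\<close>

text \<open>
  A type of order type \<open>\<omega>\<^sub>1\<close>, obtained from the successor cardinal of \<^term>\<open>natLeq\<close>. Its elements
  represent the countable ordinals, each exactly once, the least element being the ordinal 0.
\<close>

lemma cardSuc_natLeq: "Card_order (cardSuc natLeq)" "Well_order (cardSuc natLeq)"
  "\<not> finite (Field (cardSuc natLeq))"
proof -
  show 1: "Card_order (cardSuc natLeq)"
    by (simp add: cardSuc_Card_order natLeq_Card_order)
  then show "Well_order (cardSuc natLeq)"
    by (simp add: card_order_on_well_order_on)
  show "\<not> finite (Field (cardSuc natLeq))"
    using cardSuc_finite[OF natLeq_Card_order] by (simp add: Field_natLeq)
qed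

typedef omega1 = "Field (cardSuc natLeq)"
  using cardSuc_natLeq(3) by (metis ex_in_conv finite.emptyI)

instantiation omega1 :: wellorder
begin

definition less_eq_omega1 :: "omega1 \<Rightarrow> omega1 \<Rightarrow> bool" where
  "less_eq_omega1 \<xi> \<eta> \<longleftrightarrow> (Rep_omega1 \<xi>, Rep_omega1 \<eta>) \<in> cardSuc natLeq"

definition less_omega1 :: "omega1 \<Rightarrow> omega1 \<Rightarrow> bool" where
  "less_omega1 \<xi> \<eta> \<longleftrightarrow> \<xi> \<le> \<eta> \<and> \<not> \<eta> \<le> \<xi>"

instance
proof
  let ?r = "cardSuc natLeq"
  have wo: "refl_on (Field ?r) ?r" "trans ?r" "antisym ?r" "total_on (Field ?r) ?r" "wf (?r - Id)"
    using cardSuc_natLeq(2)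
    by (auto simp: well_order_on_def linear_order_on_def partial_order_on_def preorder_on_def)
  fix x y z :: omega1
  show "(x < y) = (x \<le> y \<and> \<not> y \<le> x)"
    by (simp add: less_omega1_def)
  show "x \<le> x"
    using wo(1) Rep_omega1 by (auto simp: less_eq_omega1_def refl_on_def)
  show "x \<le> y \<Longrightarrow> y \<le> z \<Longrightarrow> x \<le> z"
    using wo(2) unfolding less_eq_omega1_def trans_def by blast
  show antis: "x \<le> y \<Longrightarrow> y \<le> x \<Longrightarrow> x = y" for x y :: omega1
    using wo(3) unfolding less_eq_omega1_def antisym_def by (metis Rep_omega1_inject)
  show "x \<le> y \<or> y \<le> x"
    using wo(1,4) Rep_omega1[of x] Rep_omega1[of y]
    unfolding less_eq_omega1_def total_on_def refl_on_def by metis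
  fix P :: "omega1 \<Rightarrow> bool" and a
  assume step: "\<And>x. (\<And>y. y < x \<Longrightarrow> P y) \<Longrightarrow> P x"
  have "wf (inv_image (?r - Id) Rep_omega1)"
    using wo(5) by (rule wf_inv_image)
  then show "P a"
  proof (induction a rule: wf_induct_rule)
    case (less x)
    show ?case
    proof (rule step)
      fix y assume "y < x"
      then have "(Rep_omega1 y, Rep_omega1 x) \<in> ?r - Id"
        unfolding less_omega1_def less_eq_omega1_def using Rep_omega1_inject by auto
      then show "P y"
        using less by simp
    qed
  qed
qed

end

definition osuc :: "omega1 \<Rightarrow> omega1" where
  "osuc \<xi> = (LEAST \<eta>. \<xi> < \<eta>)"

lemma osuc_greater: "\<xi> < osuc \<xi>"
proof -
  obtain b where b: "b \<in> Field (cardSuc natLeq)" "Rep_omega1 \<xi> \<noteq> b" "(Rep_omega1 \<xi>, b) \<in> cardSuc natLeq"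
    using infinite_Card_order_limit[OF cardSuc_natLeq(1,3) Rep_omega1] by blast
  then have "\<xi> < Abs_omega1 b"
    unfolding order.strict_iff_order less_eq_omega1_def
    by (metis Abs_omega1_inverse)
  then show ?thesis
    unfolding osuc_def by (rule LeastI)
qed

primrec fin_ord :: "nat \<Rightarrow> omega1" where
  "fin_ord 0 = (LEAST \<xi>. True)"
| "fin_ord (Suc n) = osuc (fin_ord n)"

definition opred :: "omega1 \<Rightarrow> omega1" where
  "opred \<xi> = (if \<exists>\<eta>. \<xi> = osuc \<eta> then THE \<eta>. \<xi> = osuc \<eta> else \<xi>)"

definition ominus :: "omega1 \<Rightarrow> omega1" where
  "ominus \<xi> = (if fin_ord 3 \<le> \<xi> then opred \<xi> else \<xi>)"


section \<open>Borel classes\<close>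

inductive Sigma0 :: "'a topology \<Rightarrow> omega1 \<Rightarrow> 'a set \<Rightarrow> bool" for T where
  Sigma0_open: "openin T U \<Longrightarrow> Sigma0 T (fin_ord 1) U"
| Sigma0_Union: "\<lbrakk>fin_ord 2 \<le> \<xi>; \<forall>n::nat. \<exists>\<eta>. fin_ord 1 \<le> \<eta> \<and> \<eta> < \<xi> \<and> Sigma0 T \<eta> (A n)\<rbrakk>
    \<Longrightarrow> Sigma0 T \<xi> (\<Union>n. topspace T - A n)"

definition Pi0 :: "'a topology \<Rightarrow> omega1 \<Rightarrow> 'a set \<Rightarrow> bool" where
  "Pi0 T \<xi> B \<longleftrightarrow> B \<subseteq> topspace T \<and> Sigma0 T \<xi> (topspace T - B)"

definition Sigma0_measurable_on ::
  "'a topology \<Rightarrow> 'b topology \<Rightarrow> omega1 \<Rightarrow> 'a set \<Rightarrow> ('a \<Rightarrow> 'b) \<Rightarrow> bool" where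
  "Sigma0_measurable_on T T' \<xi> B g \<longleftrightarrow> g ` B \<subseteq> topspace T' \<and>
     (\<forall>U. openin T' U \<longrightarrow> Sigma0 (subtopology T B) \<xi> {x \<in> B. g x \<in> U})"


section \<open>Recursive functions on the natural numbers\<close>

text \<open>
  \<open>recfn n f\<close>: the \<open>n\<close>-ary function \<open>f\<close> is (total) recursive; only the values of \<open>f\<close> on lists
  of length \<open>n\<close> matter. Minimalization is only applied to \<open>g\<close> when a zero always exists.
\<close>

inductive recfn :: "nat \<Rightarrow> (nat list \<Rightarrow> nat) \<Rightarrow> bool" where
  recfn_const: "recfn n (\<lambda>_. c)"
| recfn_Suc: "recfn 1 (\<lambda>xs. Suc (xs ! 0))"
| recfn_proj: "i < n \<Longrightarrow> recfn n (\<lambda>xs. xs ! i)"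
| recfn_comp: "\<lbrakk>recfn m g; length fs = m; \<forall>f\<in>set fs. recfn n f\<rbrakk>
    \<Longrightarrow> recfn n (\<lambda>xs. g (map (\<lambda>f. f xs) fs))"
| recfn_primrec: "\<lbrakk>recfn n g; recfn (n + 2) h\<rbrakk>
    \<Longrightarrow> recfn (Suc n) (\<lambda>xs. rec_nat (g (tl xs)) (\<lambda>m v. h (v # m # tl xs)) (hd xs))"
| recfn_minim: "\<lbrakk>recfn (Suc n) g; \<forall>xs. length xs = n \<longrightarrow> (\<exists>m. g (m # xs) = 0)\<rbrakk>
    \<Longrightarrow> recfn n (\<lambda>xs. LEAST m. g (m # xs) = 0)"
| recfn_cong: "\<lbrakk>recfn n f; \<forall>xs. length xs = n \<longrightarrow> f xs = g xs\<rbrakk> \<Longrightarrow> recfn n g"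

definition recursive_seq :: "(nat \<Rightarrow> nat) \<Rightarrow> bool" where
  "recursive_seq \<epsilon> \<longleftrightarrow> recfn 1 (\<lambda>xs. \<epsilon> (xs ! 0))"

definition recursive_rel :: "nat \<Rightarrow> (nat list \<Rightarrow> bool) \<Rightarrow> bool" where
  "recursive_rel n R \<longleftrightarrow> recfn n (\<lambda>xs. of_bool (R xs))"


section \<open>Recursively presented Polish spaces\<close>

text \<open>
  All spaces live in one universe of points, closed under pairs. It has the cardinality of the
  continuum, so that every Polish space is isometric to one with points in this universe.
\<close>

datatype point = Nat nat | Seq (the_seq: "nat \<Rightarrow> nat") | Pr point point

record pspace =
  pts :: "point set"
  dst :: "point \<Rightarrow> point \<Rightarrow> real"
  dns :: "nat \<Rightarrow> point"

definition top_of :: "pspace \<Rightarrow> point topology" where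
  "top_of X = Metric_space.mtopology (pts X) (dst X)"

definition rec_presented :: "pspace \<Rightarrow> bool" where
  "rec_presented X \<longleftrightarrow>
     Metric_space (pts X) (dst X) \<and> Metric_space.mcomplete (pts X) (dst X) \<and>
     range (dns X) \<subseteq> pts X \<and> top_of X closure_of range (dns X) = pts X \<and>
     recursive_rel 4 (\<lambda>xs. dst X (dns X (xs ! 0)) (dns X (xs ! 1)) \<le> real (xs ! 2) / (real (xs ! 3) + 1)) \<and>
     recursive_rel 4 (\<lambda>xs. dst X (dns X (xs ! 0)) (dns X (xs ! 1)) < real (xs ! 2) / (real (xs ! 3) + 1))"

text \<open>
  The number \<open>\<langle>i, m, k\<rangle>\<close> codes the ball with centre \<open>dns X i\<close> and radius \<open>m / (k + 1)\<close>. Triples are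
  coded by the pairing function of the library, for which 0 codes a triple with \<open>m = 0\<close>; another
  recursive coding, such as the one by prime powers, leads to the same effective notions.
\<close>

definition nbhd :: "pspace \<Rightarrow> nat \<Rightarrow> point set" where
  "nbhd X s = (case prod_decode s of (i, t) \<Rightarrow> case prod_decode t of (m, k) \<Rightarrow>
     {x \<in> pts X. dst X (dns X i) x < real m / (real k + 1)})"

lemma nbhd_0: "Metric_space (pts X) (dst X) \<Longrightarrow> nbhd X 0 = {}"
proof -
  assume "Metric_space (pts X) (dst X)"
  then have "\<not> dst X x y < 0" for x y
    by (simp add: Metric_space.nonneg linorder_not_less)
  moreover have "prod_decode 0 = (0, 0)"
    using prod_encode_inverse[of "(0, 0)"] by (simp add: prod_encode_def)
  ultimately show ?thesis
    by (simp add: nbhd_def)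
qed

definition Omega :: pspace where
  "Omega = \<lparr>pts = range Nat, dst = (\<lambda>x y. of_bool (x \<noteq> y)), dns = Nat\<rparr>"

fun seq_dist :: "point \<Rightarrow> point \<Rightarrow> real" where
  "seq_dist (Seq \<alpha>) (Seq \<beta>) =
     (if \<alpha> = \<beta> then 0 else 1 / (real (LEAST n. \<alpha> n \<noteq> \<beta> n) + 1))"
| "seq_dist _ _ = 0"

definition Baire :: pspace where
  "Baire = \<lparr>pts = range Seq, dst = seq_dist,
     dns = (\<lambda>i. Seq (\<lambda>n. let l = list_decode i in if n < length l then l ! n else 0))\<rparr>"

definition Cantor :: pspace where
  "Cantor = \<lparr>pts = Seq ` {\<alpha>. \<forall>n. \<alpha> n \<in> {0, 1}}, dst = seq_dist,
     dns = (\<lambda>i. Seq (\<lambda>n. i div 2 ^ n mod 2))\<rparr>"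

fun max_dist :: "(point \<Rightarrow> point \<Rightarrow> real) \<Rightarrow> (point \<Rightarrow> point \<Rightarrow> real) \<Rightarrow> point \<Rightarrow> point \<Rightarrow> real" where
  "max_dist d e (Pr x y) (Pr x' y') = max (d x x') (e y y')"
| "max_dist d e _ _ = 0"

definition prod_space :: "pspace \<Rightarrow> pspace \<Rightarrow> pspace"  (infixr "\<otimes>" 70) where
  "X \<otimes> Y = \<lparr>pts = {Pr x y |x y. x \<in> pts X \<and> y \<in> pts Y}, dst = max_dist (dst X) (dst Y),
     dns = (\<lambda>i. Pr (dns X (fst (prod_decode i))) (dns Y (snd (prod_decode i))))\<rparr>"

inductive type_le_1 :: "pspace \<Rightarrow> bool" where
  "type_le_1 Omega"
| "type_le_1 Baire"
| "type_le_1 Cantor"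
| "\<lbrakk>type_le_1 X; type_le_1 Y\<rbrakk> \<Longrightarrow> type_le_1 (X \<otimes> Y)"


section \<open>Effective open sets and recursive partial functions\<close>

definition Sigma01 :: "pspace \<Rightarrow> point set \<Rightarrow> bool" where
  "Sigma01 X B \<longleftrightarrow> (\<exists>\<epsilon>. recursive_seq \<epsilon> \<and> B = (\<Union>i. nbhd X (\<epsilon> i)))"

definition partial_fun :: "pspace \<Rightarrow> pspace \<Rightarrow> (point \<Rightarrow> point option) \<Rightarrow> bool" where
  "partial_fun X Y f \<longleftrightarrow> dom f \<subseteq> pts X \<and> ran f \<subseteq> pts Y"

definition computes ::
  "pspace \<Rightarrow> pspace \<Rightarrow> point set \<Rightarrow> (point \<Rightarrow> point option) \<Rightarrow> point set \<Rightarrow> bool" where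
  "computes X Y P f D \<longleftrightarrow> P \<subseteq> pts (X \<otimes> Omega) \<and> D \<subseteq> dom f \<and>
     (\<forall>x\<in>D. \<forall>k. the (f x) \<in> nbhd Y k \<longleftrightarrow> Pr x (Nat k) \<in> P)"

definition recursive_on ::
  "pspace \<Rightarrow> pspace \<Rightarrow> (point \<Rightarrow> point option) \<Rightarrow> point set \<Rightarrow> bool" where
  "recursive_on X Y f D \<longleftrightarrow> (\<exists>P. Sigma01 (X \<otimes> Omega) P \<and> computes X Y P f D)"


section \<open>Good parametrizations\<close>

definition section_of :: "(pspace \<Rightarrow> point set) \<Rightarrow> pspace \<Rightarrow> (nat \<Rightarrow> nat) \<Rightarrow> point set" where
  "section_of G X \<gamma> = {x \<in> pts X. Pr (Seq \<gamma>) x \<in> G X}"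

definition good_parametrization :: "(pspace \<Rightarrow> point set) \<Rightarrow> bool" where
  "good_parametrization G \<longleftrightarrow>
     (\<forall>X. rec_presented X \<longrightarrow>
        Sigma01 (Baire \<otimes> X) (G X) \<and>
        (\<forall>P. P \<subseteq> pts X \<longrightarrow> (openin (top_of X) P \<longleftrightarrow> (\<exists>\<gamma>. P = section_of G X \<gamma>))) \<and>
        (\<forall>P. P \<subseteq> pts X \<longrightarrow> (Sigma01 X P \<longleftrightarrow> (\<exists>\<gamma>. recursive_seq \<gamma> \<and> P = section_of G X \<gamma>)))) \<and>
     (\<forall>X Y. type_le_1 X \<and> rec_presented Y \<longrightarrow>
        (\<exists>S. partial_fun (Baire \<otimes> X) Baire S \<and> dom S = pts (Baire \<otimes> X) \<and>
             recursive_on (Baire \<otimes> X) Baire S (dom S) \<and>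
             (\<forall>\<gamma>. \<forall>x\<in>pts X. \<forall>y\<in>pts Y.
                Pr (Seq \<gamma>) (Pr x y) \<in> G (X \<otimes> Y) \<longleftrightarrow> Pr (the (S (Pr (Seq \<gamma>) x))) y \<in> G Y)))"

text \<open>The partial function \<open>{\<gamma>}\<close> from \<open>X\<close> to \<open>Y\<close>.\<close>

definition pfun_of ::
  "(pspace \<Rightarrow> point set) \<Rightarrow> pspace \<Rightarrow> pspace \<Rightarrow> (nat \<Rightarrow> nat) \<Rightarrow> point \<Rightarrow> point option" where
  "pfun_of G X Y \<gamma> x =
     (let Q = (\<lambda>y. y \<in> pts Y \<and> (\<forall>k. y \<in> nbhd Y k \<longleftrightarrow> Pr (Seq \<gamma>) (Pr x (Nat k)) \<in> G (X \<otimes> Omega)))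
      in if x \<in> pts X \<and> (\<exists>!y. Q y) then Some (THE y. Q y) else None)"


section \<open>Borel codes\<close>

definition shift :: "(nat \<Rightarrow> nat) \<Rightarrow> nat \<Rightarrow> nat" where
  "shift \<gamma> i = \<gamma> (i + 1)"

abbreviation subcode :: "(pspace \<Rightarrow> point set) \<Rightarrow> (nat \<Rightarrow> nat) \<Rightarrow> nat \<Rightarrow> point option" where
  "subcode G \<gamma> i \<equiv> pfun_of G Omega Baire (shift \<gamma>) (Nat i)"

text \<open>\<open>BC G \<xi> \<gamma>\<close> means that \<open>\<gamma>\<close> belongs to \<open>BC\<^sub>\<xi>\<close>.\<close>

inductive BC :: "(pspace \<Rightarrow> point set) \<Rightarrow> omega1 \<Rightarrow> (nat \<Rightarrow> nat) \<Rightarrow> bool" for G where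
  BC_1: "\<gamma> 0 = 0 \<Longrightarrow> BC G (fin_ord 1) \<gamma>"
| BC_step: "\<lbrakk>fin_ord 2 \<le> \<xi>; \<gamma> 0 = 1;
     \<forall>i. \<exists>\<delta> \<eta>. subcode G \<gamma> i = Some (Seq \<delta>) \<and> fin_ord 1 \<le> \<eta> \<and> \<eta> < \<xi> \<and> BC G \<eta> \<delta>\<rbrakk>
    \<Longrightarrow> BC G \<xi> \<gamma>"

lemma fin_ord_1_not_ge_2: "\<not> fin_ord 2 \<le> fin_ord 1"
  using osuc_greater[of "fin_ord 1"] by (simp add: numeral_2_eq_2 not_le)

lemma BC_1_iff: "BC G (fin_ord 1) \<gamma> \<longleftrightarrow> \<gamma> 0 = 0"
  by (subst BC.simps) (use fin_ord_1_not_ge_2 in blast)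

lemma BC_step_iff:
  assumes "fin_ord 2 \<le> \<xi>"
  shows "BC G \<xi> \<gamma> \<longleftrightarrow> \<gamma> 0 = 1 \<and>
    (\<forall>i. \<exists>\<delta> \<eta>. subcode G \<gamma> i = Some (Seq \<delta>) \<and> fin_ord 1 \<le> \<eta> \<and> \<eta> < \<xi> \<and> BC G \<eta> \<delta>)"
  by (subst BC.simps) (use assms fin_ord_1_not_ge_2 in blast)

definition subcode_rel :: "(pspace \<Rightarrow> point set) \<Rightarrow> ((nat \<Rightarrow> nat) \<times> (nat \<Rightarrow> nat)) set" where
  "subcode_rel G = {(\<delta>, \<gamma>). \<gamma> 0 \<noteq> 0 \<and> (\<exists>\<xi>. BC G \<xi> \<gamma>) \<and> (\<exists>i. subcode G \<gamma> i = Some (Seq \<delta>))}"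

lemma wf_subcode_rel: "wf (subcode_rel G)"
proof -
  have BC_acc: "\<gamma> \<in> Wellfounded.acc (subcode_rel G)" if "BC G \<xi> \<gamma>" for \<xi> \<gamma>
    using that
  proof induction
    case (BC_1 \<gamma>)
    then show ?case
      by - (rule accI, simp add: subcode_rel_def)
  next
    case (BC_step \<xi> \<gamma>)
    show ?case
    proof (rule accI)
      fix \<delta> assume "(\<delta>, \<gamma>) \<in> subcode_rel G"
      then obtain i where "subcode G \<gamma> i = Some (Seq \<delta>)"
        by (auto simp: subcode_rel_def)
      moreover obtain \<delta>' where "subcode G \<gamma> i = Some (Seq \<delta>')" "\<delta>' \<in> Wellfounded.acc (subcode_rel G)"
        using BC_step(3) by blast
      ultimately show "\<delta> \<in> Wellfounded.acc (subcode_rel G)"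
        by simp
    qed
  qed
  have "\<gamma> \<in> Wellfounded.acc (subcode_rel G)" for \<gamma>
  proof (cases "\<exists>\<xi>. BC G \<xi> \<gamma>")
    case True
    then show ?thesis
      using BC_acc by blast
  next
    case False
    then show ?thesis
      by - (rule accI, simp add: subcode_rel_def)
  qed
  then show ?thesis
    by (intro acc_wfI) simp
qed

text \<open>The set coded by \<open>\<gamma>\<close>, with the dummy value \<open>{}\<close> if \<open>\<gamma>\<close> is not a Borel code.\<close>

function rho :: "(pspace \<Rightarrow> point set) \<Rightarrow> pspace \<Rightarrow> (nat \<Rightarrow> nat) \<Rightarrow> point set" where
  "rho G X \<gamma> =
     (if \<gamma> 0 = 0 then (\<Union>i. nbhd X (shift \<gamma> i))
      else if \<exists>\<xi>. BC G \<xi> \<gamma> then (\<Union>i. pts X - rho G X (the_seq (the (subcode G \<gamma> i))))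
      else {})"
  by pat_completeness auto

termination
proof (relation "inv_image (same_fst (\<lambda>_. True) subcode_rel) (\<lambda>(G, X, \<gamma>). (G, \<gamma>))")
  show "wf (inv_image (same_fst (\<lambda>_. True) subcode_rel) (\<lambda>(G, X :: pspace, \<gamma>). (G, \<gamma>)))"
    by (intro wf_inv_image wf_same_fst wf_subcode_rel)
next
  fix G X \<gamma> i
  assume 0: "\<gamma> 0 \<noteq> (0::nat)" and ex: "\<exists>\<xi>. BC G \<xi> \<gamma>"
  then obtain \<xi> where "BC G \<xi> \<gamma>"
    by blast
  then obtain \<delta> where \<delta>: "subcode G \<gamma> i = Some (Seq \<delta>)"
  proof cases
    case BC_1
    then show ?thesis
      using 0 by blast
  next
    case BC_step
    then show ?thesis
      using that by blast
  qed
  have "\<exists>j. subcode G \<gamma> j = Some (Seq \<delta>)"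
    using \<delta> by (rule exI)
  then have "(the_seq (the (subcode G \<gamma> i)), \<gamma>) \<in> subcode_rel G"
    unfolding subcode_rel_def \<delta> using 0 ex by simp
  then show "((G, X, the_seq (the (subcode G \<gamma> i))), (G, X, \<gamma>))
      \<in> inv_image (same_fst (\<lambda>_. True) subcode_rel) (\<lambda>(G, X :: pspace, \<gamma>). (G, \<gamma>))"
    by (simp add: same_fst_def)
qed

declare rho.simps [simp del]

end

theory Submission
  imports Defs
begin

text \<open>
  Let \<open>wit \<gamma> x s\<close>, for a Borel code \<open>\<gamma>\<close>, a point \<open>x\<close> of Cantor space and a node \<open>s\<close> of the tree of
  iterated subcodes of \<open>\<gamma>\<close>, be 0 if \<open>x\<close> is not in the set coded at \<open>s\<close>, and \<open>j + 1\<close> if the \<open>j\<close>-th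
  piece of this set is the first one that contains \<open>x\<close>. The constraints relating the value at a node
  to the values at its children are closed, and since the tree is well-founded they determine
  \<open>wit \<gamma> x\<close>. Hence the pairs \<open>(x, wit \<gamma> x)\<close> with \<open>x\<close> outside the coded set form a closed subset of
  Baire space, which is recursive in \<open>\<gamma>\<close>, and the projection to \<open>x\<close> is the required bijection.

  If \<open>x\<close> is outside the coded set, then the value at a child of the root is positive and witnessed
  at grandchildren of the root. So the inverse map is determined by nonmembership of \<open>x\<close> in sets
  coded at nodes at distance at least 2 from the root, and the ranks of these nodes are smaller than
  \<open>\<xi>\<^sup>-\<close>. The preimages of basic open sets are unions of finite intersections of complements of such
  sets. Codes for the finite unions of such sets come from Kleene's recursion theorem.

  All effective notions are reduced to one kind of relation: spaces of type at most 1 embed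
  isometrically into Baire space, and their effectively open sets are the traces of the relations
  that are semirecursive in an oracle.
\<close>

section \<open>Recursive functions of one variable\<close>

text \<open>Taking the first piece rather than any piece makes the witness a function of the point,
  so injectivity of the projection costs nothing. The price is that the failure of earlier pieces
  has to be expressed as well. Both \<open>piece\<close> and \<open>nopiece\<close> are
  semirecursive, so the violation of a constraint is an open condition, and both are monotone in the
  set of nodes they consult. Continuity then replaces an infinite set of nodes by a finite one. This
  matters at a limit rank, where finitely many smaller ranks still have a common bound below the
  limit. The rank of a code cannot be read off from it: \<open>\<gamma> 0\<close> separates the
  codes of open sets from the others, but whether the rank is at most 2 depends on all subcodes.
  This is why there are two functions. A code of an open set for the inverse is correct up to rank 2
  only. The general construction branches on \<open>\<gamma> 0\<close> alone and gives a code of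
  rank at least 2 whenever \<open>\<gamma> 0 = 1\<close>, which is permitted because
  \<open>\<xi>\<^sup>-\<close> is 2 for \<open>\<xi> = 2\<close>.\<close>

lemma recfn_comp1: "recfn 1 g \<Longrightarrow> recfn n f \<Longrightarrow> recfn n (\<lambda>xs. g [f xs])"
  using recfn_comp[of 1 g "[f]" n] by simp

lemma recfn_comp2: "recfn 2 g \<Longrightarrow> recfn n f\<^sub>1 \<Longrightarrow> recfn n f\<^sub>2 \<Longrightarrow> recfn n (\<lambda>xs. g [f\<^sub>1 xs, f\<^sub>2 xs])"
  using recfn_comp[of 2 g "[f\<^sub>1, f\<^sub>2]" n] by simp

lemma recfn_Suc': "recfn n f \<Longrightarrow> recfn n (\<lambda>xs. Suc (f xs))"
  using recfn_comp1[OF recfn_Suc] by simp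

lemma recfn_rec1:
  assumes "recfn 1 g" "recfn 3 h"
  shows "recfn 2 (\<lambda>xs. rec_nat (g [xs ! 1]) (\<lambda>m v. h [v, m, xs ! 1]) (xs ! 0))"
proof -
  have "recfn 2 (\<lambda>xs. rec_nat (g (tl xs)) (\<lambda>m v. h (v # m # tl xs)) (hd xs))"
    using recfn_primrec[of 1 g h] assms by (simp add: numeral_2_eq_2 numeral_3_eq_3)
  then show ?thesis
    by (rule recfn_cong) (auto simp: numeral_2_eq_2 length_Suc_conv)
qed

lemma recfn_rec0:
  assumes "recfn 2 h"
  shows "recfn 1 (\<lambda>xs. rec_nat a (\<lambda>m v. h [v, m]) (xs ! 0))"
proof -
  have "recfn 1 (\<lambda>xs. rec_nat a (\<lambda>m v. h (v # m # tl xs)) (hd xs))"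
    using recfn_primrec[of 0 "\<lambda>_. a" h] assms recfn_const by (simp add: numeral_2_eq_2)
  then show ?thesis
    by (rule recfn_cong) (auto simp: length_Suc_conv)
qed

lemma recfn_add:
  assumes "recfn n f" "recfn n g" shows "recfn n (\<lambda>xs. f xs + g xs)"
proof -
  have "rec_nat x (\<lambda>m. Suc) y = y + x" for x y
    by (induction y) auto
  then have "recfn 2 (\<lambda>xs. xs ! 0 + xs ! 1)"
    using recfn_rec1[of "\<lambda>xs. xs ! 0" "\<lambda>xs. Suc (xs ! 0)"] by (simp add: recfn_proj recfn_Suc')
  from recfn_comp2[OF this assms] show ?thesis by simp
qed

lemma recfn_diff:
  assumes "recfn n f" "recfn n g" shows "recfn n (\<lambda>xs. f xs - g xs)"
proof -
  have "rec_nat 0 (\<lambda>m v. m) y = y - 1" for y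
    by (cases y) auto
  then have 1: "recfn 1 (\<lambda>xs. xs ! 0 - 1)"
    using recfn_rec0[of "\<lambda>xs. xs ! 1" 0] by (simp add: recfn_proj)
  have "recfn 3 (\<lambda>xs. xs ! 0 - 1)"
    using recfn_comp1[OF 1, of 3 "\<lambda>xs. xs ! 0"] by (simp add: recfn_proj)
  moreover have "rec_nat x (\<lambda>m v. v - 1) y = x - y" for x y :: nat
    by (induction y) auto
  ultimately have "recfn 2 (\<lambda>xs. xs ! 1 - xs ! 0)"
    using recfn_rec1[of "\<lambda>xs. xs ! 0" "\<lambda>xs. xs ! 0 - 1"] by (simp add: recfn_proj)
  from recfn_comp2[OF this assms(2,1)] show ?thesis by simp
qed

text \<open>This is the pairing inside \<open>nbhd\<close> and \<open>prod_space\<close>, in curried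
  form, so that codes of balls and indices of dense points are unpacked by the same rules. As
  \<open>npair 0 0 = 0\<close>, the number 0 codes a ball of radius 0.\<close>

definition npair :: "nat \<Rightarrow> nat \<Rightarrow> nat" where "npair a b = prod_encode (a, b)"
definition nfst :: "nat \<Rightarrow> nat" where "nfst z = fst (prod_decode z)"
definition nsnd :: "nat \<Rightarrow> nat" where "nsnd z = snd (prod_decode z)"

lemma npair_simps [simp]:
  "nfst (npair a b) = a" "nsnd (npair a b) = b" "npair (nfst z) (nsnd z) = z"
  "npair a b = npair a' b' \<longleftrightarrow> a = a' \<and> b = b'"
  by (auto simp: npair_def nfst_def nsnd_def)

lemma npair_0 [simp]: "npair 0 0 = 0" "nfst 0 = 0" "nsnd 0 = 0"
proof -
  show "npair 0 0 = 0" by (simp add: npair_def prod_encode_def)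
  then show "nfst 0 = 0" "nsnd 0 = 0" by (metis npair_simps(1), metis npair_simps(2) \<open>npair 0 0 = 0\<close>)
qed

lemma npair_ge: "a \<le> npair a b" "b \<le> npair a b" "nfst z \<le> z" "nsnd z \<le> z"
  using le_prod_encode_1 le_prod_encode_2 unfolding npair_def nfst_def nsnd_def
  by (auto, (metis prod.collapse prod_decode_inverse)+)

lemma recfn_triangle: 
  assumes "recfn n f" shows "recfn n (\<lambda>xs. triangle (f xs))"
proof -
  have "rec_nat 0 (\<lambda>m v. v + Suc m) y = triangle y" for y
    by (induction y) (auto)
  then have "recfn 1 (\<lambda>xs. triangle (xs ! 0))"
    using recfn_rec0[of "\<lambda>xs. xs ! 0 + Suc (xs ! 1)" 0]
    by (simp add: recfn_proj recfn_add recfn_Suc' del: add_Suc_right)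
  from recfn_comp1[OF this assms] show ?thesis by simp
qed

lemma recfn_npair:
  assumes "recfn n f" "recfn n g" shows "recfn n (\<lambda>xs. npair (f xs) (g xs))"
  unfolding npair_def prod_encode_def using assms by (simp add: recfn_add recfn_triangle)

lemma recfn_nfst_nsnd:
  assumes "recfn n f" shows "recfn n (\<lambda>xs. nfst (f xs))" "recfn n (\<lambda>xs. nsnd (f xs))"
proof -
  \<comment> \<open>The diagonal \<open>a + b\<close> of \<open>z = npair a b\<close>: since
    \<open>npair a b\<close> is \<open>triangle (a + b) + a\<close>, it is the least
    \<open>m\<close> with \<open>z < triangle (Suc m)\<close>.\<close>
  define r where "r z = (LEAST m. Suc z - triangle (Suc m) = 0)" for z
  have "\<exists>m. Suc z - triangle (Suc m) = 0" for z
    by (rule exI[of _ z]) simp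
  then have r: "recfn 1 (\<lambda>xs. r (xs ! 0))"
    unfolding r_def using recfn_minim[of 1 "\<lambda>xs. Suc (xs ! 1) - triangle (Suc (xs ! 0))"]
    by (simp add: recfn_proj recfn_Suc' recfn_diff recfn_triangle numeral_2_eq_2 del: triangle_Suc)
  have rz: "r (npair a b) = a + b" for a b
    unfolding r_def
  proof (rule Least_equality)
    show "Suc (npair a b) - triangle (Suc (a + b)) = 0"
      by (simp add: npair_def prod_encode_def)
    fix m assume "Suc (npair a b) - triangle (Suc m) = 0"
    then have *: "triangle (a + b) < triangle (Suc m)" by (simp add: npair_def prod_encode_def)
    have "mono triangle" by (rule monoI) (auto simp only: triangle_def intro!: div_le_mono mult_le_mono)
    with * have "a + b < Suc m" by (meson leD leI monoD)
    then show "a + b \<le> m" by simp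
  qed
  have fst: "nfst z = z - triangle (r z)" for z
  proof -
    have "npair (nfst z) (nsnd z) = triangle (r (npair (nfst z) (nsnd z))) + nfst z"
      unfolding rz by (simp add: npair_def prod_encode_def)
    then show ?thesis by simp
  qed
  have snd: "nsnd z = r z - nfst z" for z
    using rz[of "nfst z" "nsnd z"] by simp
  have 1: "recfn 1 (\<lambda>xs. nfst (xs ! 0))"
    unfolding fst by (intro recfn_diff recfn_triangle r recfn_proj) simp
  have 2: "recfn 1 (\<lambda>xs. nsnd (xs ! 0))"
    unfolding snd by (intro recfn_diff 1 r)
  show "recfn n (\<lambda>xs. nfst (f xs))" using recfn_comp1[OF 1 assms] by simp
  show "recfn n (\<lambda>xs. nsnd (f xs))" using recfn_comp1[OF 2 assms] by simp
qed

section \<open>Closure properties of unary recursive functions and predicates\<close>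

named_theorems rec_intros

lemma recursive_seq_comp: "recursive_seq f \<Longrightarrow> recursive_seq g \<Longrightarrow> recursive_seq (\<lambda>z. f (g z))"
  unfolding recursive_seq_def using recfn_comp1 by fastforce

lemma recursive_seq_basic [rec_intros]:
  "recursive_seq (\<lambda>z. z)"
  "recursive_seq (\<lambda>z. c)"
  "recursive_seq f \<Longrightarrow> recursive_seq (\<lambda>z. Suc (f z))"
  "recursive_seq f \<Longrightarrow> recursive_seq g \<Longrightarrow> recursive_seq (\<lambda>z. f z + g z)"
  "recursive_seq f \<Longrightarrow> recursive_seq g \<Longrightarrow> recursive_seq (\<lambda>z. f z - g z)"
  "recursive_seq f \<Longrightarrow> recursive_seq g \<Longrightarrow> recursive_seq (\<lambda>z. npair (f z) (g z))"
  "recursive_seq f \<Longrightarrow> recursive_seq (\<lambda>z. nfst (f z))"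
  "recursive_seq f \<Longrightarrow> recursive_seq (\<lambda>z. nsnd (f z))"
  unfolding recursive_seq_def
  by (auto intro!: recfn_proj recfn_const recfn_Suc' recfn_add recfn_diff recfn_npair recfn_nfst_nsnd)

text \<open>Several arguments are packed into one nested pair, and premises are stated with
  \<open>nfst\<close> and \<open>nsnd\<close> in place of bound variables. The closure rules below
  follow this pattern, which lets them be applied under binders.\<close>

lemma recursive_seq_rec_nat:
  assumes "recursive_seq a" "recursive_seq (\<lambda>w. h (nfst w) (nfst (nsnd w)) (nsnd (nsnd w)))" "recursive_seq k"
  shows "recursive_seq (\<lambda>z. rec_nat (a z) (h z) (k z))"
proof -
  let ?h = "\<lambda>w. h (nfst w) (nfst (nsnd w)) (nsnd (nsnd w))"
  have "recfn 3 (\<lambda>xs. ?h (npair (xs ! 2) (npair (xs ! 1) (xs ! 0))))"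
    using recfn_comp1[OF assms(2)[unfolded recursive_seq_def], of 3 "\<lambda>xs. npair (xs ! 2) (npair (xs ! 1) (xs ! 0))"]
    by (simp add: recfn_npair recfn_proj)
  from recfn_rec1[OF assms(1)[unfolded recursive_seq_def] this]
  have "recfn 2 (\<lambda>xs. rec_nat (a (xs ! 1)) (h (xs ! 1)) (xs ! 0))"
    by simp
  from recfn_comp2[OF this assms(3)[unfolded recursive_seq_def] recfn_proj[of 0 1]]
  show ?thesis unfolding recursive_seq_def by simp
qed

lemma recursive_seq_Least:
  assumes "recursive_seq (\<lambda>w. g (nfst w) (nsnd w))" "\<And>z. \<exists>m. g z m = 0"
  shows "recursive_seq (\<lambda>z. LEAST m. g z m = 0)"
proof -
  have "recfn 2 (\<lambda>xs. g (xs ! 1) (xs ! 0))"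
    using recfn_comp1[OF assms(1)[unfolded recursive_seq_def], of 2 "\<lambda>xs. npair (xs ! 1) (xs ! 0)"]
    by (simp add: recfn_npair recfn_proj)
  then show ?thesis
    unfolding recursive_seq_def
    using recfn_minim[of 1 "\<lambda>xs. g (xs ! 1) (xs ! 0)"] assms(2) by (simp add: numeral_2_eq_2)
qed

lemma recursive_seq_mult [rec_intros]:
  assumes "recursive_seq f" "recursive_seq g" shows "recursive_seq (\<lambda>z. f z * g z)"
proof -
  have "rec_nat 0 (\<lambda>m v. v + x) y = x * y" for x y :: nat
    by (induction y) auto
  then have "recursive_seq (\<lambda>z. nfst z * nsnd z)"
    using recursive_seq_rec_nat[of "\<lambda>z. 0" "\<lambda>z m v. v + nfst z" nsnd] by (simp add: rec_intros)
  from recursive_seq_comp[OF this, of "\<lambda>z. npair (f z) (g z)"] show ?thesis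
    using assms by (simp add: rec_intros)
qed

definition recursive_pred :: "(nat \<Rightarrow> bool) \<Rightarrow> bool" where
  "recursive_pred P \<longleftrightarrow> recursive_seq (\<lambda>z. of_bool (P z))"

lemma recursive_pred_comp: "recursive_pred P \<Longrightarrow> recursive_seq f \<Longrightarrow> recursive_pred (\<lambda>z. P (f z))"
  unfolding recursive_pred_def by (rule recursive_seq_comp)

lemma recursive_pred_eq_0: "recursive_seq f \<Longrightarrow> recursive_pred (\<lambda>z. f z = 0)"
  unfolding recursive_pred_def
proof -
  have "of_bool (f z = 0) = 1 - f z" for z by auto
  then show "recursive_seq f \<Longrightarrow> recursive_seq (\<lambda>z. of_bool (f z = 0))"
    by (simp only:) (intro rec_intros)
qed

lemma recursive_pred_not [rec_intros]: "recursive_pred P \<Longrightarrow> recursive_pred (\<lambda>z. \<not> P z)"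
  using recursive_pred_eq_0[of "\<lambda>z. of_bool (P z)"] unfolding recursive_pred_def by simp

lemma recursive_pred_conj [rec_intros]:
  "recursive_pred P \<Longrightarrow> recursive_pred Q \<Longrightarrow> recursive_pred (\<lambda>z. P z \<and> Q z)"
  unfolding recursive_pred_def of_bool_conj by (intro rec_intros)

lemma recursive_pred_disj [rec_intros]:
  assumes "recursive_pred P" "recursive_pred Q" shows "recursive_pred (\<lambda>z. P z \<or> Q z)"
proof -
  have "recursive_pred (\<lambda>z. \<not> (\<not> P z \<and> \<not> Q z))" using assms by (intro rec_intros)
  then show ?thesis by simp
qed

lemma recursive_pred_imp [rec_intros]:
  assumes "recursive_pred P" "recursive_pred Q" shows "recursive_pred (\<lambda>z. P z \<longrightarrow> Q z)"
proof -
  have "recursive_pred (\<lambda>z. \<not> P z \<or> Q z)" using assms by (intro rec_intros)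
  then show ?thesis unfolding imp_conv_disj .
qed

lemma recursive_pred_le [rec_intros]:
  assumes "recursive_seq f" "recursive_seq g" shows "recursive_pred (\<lambda>z. f z \<le> g z)"
  using recursive_pred_eq_0[of "\<lambda>z. f z - g z"] assms by (simp add: rec_intros)

lemma recursive_pred_less [rec_intros]:
  assumes "recursive_seq f" "recursive_seq g" shows "recursive_pred (\<lambda>z. f z < g z)"
  using recursive_pred_le[of "\<lambda>z. Suc (f z)" g] assms by (simp add: rec_intros Suc_le_eq)

lemma recursive_pred_eq [rec_intros]:
  assumes "recursive_seq f" "recursive_seq g" shows "recursive_pred (\<lambda>z. f z = g z)"
  using recursive_pred_conj[OF recursive_pred_le recursive_pred_le, of f g g f] assms
  by (simp add: order_eq_iff)

lemma recursive_seq_if [rec_intros]: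
  assumes "recursive_pred P" "recursive_seq f" "recursive_seq g"
  shows "recursive_seq (\<lambda>z. if P z then f z else g z)"
proof -
  have "recursive_seq (\<lambda>z. of_bool (P z) * f z + (1 - of_bool (P z)) * g z)"
    using assms unfolding recursive_pred_def by (intro rec_intros)
  moreover have "of_bool (P z) * f z + (1 - of_bool (P z)) * g z = (if P z then f z else g z)" for z
    by simp
  ultimately show ?thesis by simp
qed

lemma recursive_pred_ball [rec_intros]:
  assumes "recursive_pred (\<lambda>w. P (nfst w) (nsnd w))" "recursive_seq b"
  shows "recursive_pred (\<lambda>z. \<forall>n<b z. P z n)"
proof -
  have "rec_nat (1::nat) (\<lambda>m v. v * of_bool (P z m)) k = of_bool (\<forall>n<k. P z n)" for z k
    by (induction k) (auto simp: less_Suc_eq)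
  moreover have "recursive_seq (\<lambda>z. rec_nat (1::nat) (\<lambda>m v. v * of_bool (P z m)) (b z))"
  proof (intro recursive_seq_rec_nat rec_intros assms(2))
    show "recursive_seq (\<lambda>w. of_bool (P (nfst w) (nfst (nsnd w))))"
      using recursive_pred_comp[OF assms(1), of "\<lambda>w. npair (nfst w) (nfst (nsnd w))"]
      by (simp add: recursive_pred_def rec_intros)
  qed
  ultimately show ?thesis unfolding recursive_pred_def by simp
qed

lemma recursive_pred_ball_le [rec_intros]:
  assumes "recursive_pred (\<lambda>w. P (nfst w) (nsnd w))" "recursive_seq b"
  shows "recursive_pred (\<lambda>z. \<forall>n\<le>b z. P z n)"
  using recursive_pred_ball[of P "\<lambda>z. Suc (b z)"] assms by (simp add: rec_intros less_Suc_eq_le)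

lemma recursive_seq_div2:
  assumes "recursive_seq f" shows "recursive_seq (\<lambda>z. f z div 2)"
proof -
  \<comment> \<open>Vanishing of the truncated difference means \<open>f z < 2 * m + 2\<close>, and
    the least such \<open>m\<close> is the quotient.\<close>
  have "recursive_seq (\<lambda>z. LEAST m. Suc (f z) - 2 * Suc m = 0)"
  proof (rule recursive_seq_Least)
    show "recursive_seq (\<lambda>w. Suc (f (nfst w)) - 2 * Suc (nsnd w))"
      by (intro rec_intros recursive_seq_comp[OF assms])
    show "\<exists>m. Suc (f z) - 2 * Suc m = 0" for z
      by (rule exI[of _ "f z"]) simp
  qed
  moreover have "(LEAST m. Suc (f z) - 2 * Suc m = 0) = f z div 2" for z
    by (rule Least_equality) auto
  ultimately show ?thesis by simp
qed

lemma recursive_seq_digit [rec_intros]: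
  assumes "recursive_seq f" "recursive_seq g" shows "recursive_seq (\<lambda>z. f z div 2 ^ g z mod 2)"
proof -
  have "rec_nat x (\<lambda>m v. v div 2) y = x div 2 ^ y" for x y :: nat
    by (induction y) (auto, metis div_mult2_eq mult.commute)
  moreover have "recursive_seq (\<lambda>z. rec_nat (f z) (\<lambda>m v. v div 2) (g z))"
    by (intro recursive_seq_rec_nat recursive_seq_div2 rec_intros assms)
  ultimately have 1: "recursive_seq (\<lambda>z. f z div 2 ^ g z)" by simp
  have "x mod 2 = x - 2 * (x div 2)" for x :: nat by presburger
  then show ?thesis
    by (simp only:) (intro rec_intros recursive_seq_div2 1)
qed

subsection \<open>Coded lists\<close>

text \<open>The value 0 beyond the end makes \<open>lnth c\<close> the \<open>c\<close>-th member of
  the dense sequence of \<open>Baire\<close>.\<close>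

definition lnth :: "nat \<Rightarrow> nat \<Rightarrow> nat" where
  "lnth c n = (if n < length (list_decode c) then list_decode c ! n else 0)"

definition llen :: "nat \<Rightarrow> nat" where "llen c = length (list_decode c)"

definition lcode :: "(nat \<Rightarrow> nat) \<Rightarrow> nat \<Rightarrow> nat" where "lcode f k = list_encode (map f [0..<k])"

lemma llen_lcode [simp]: "llen (lcode f k) = k"
  by (simp add: llen_def lcode_def)

lemma lnth_lcode: "lnth (lcode f k) n = (if n < k then f n else 0)"
  by (simp add: lnth_def lcode_def)

lemma lnth_lcode_less [simp]: "n < k \<Longrightarrow> lnth (lcode f k) n = f n"
  by (simp add: lnth_lcode)

lemma lnth_ge: "llen c \<le> n \<Longrightarrow> lnth c n = 0"
  by (simp add: lnth_def llen_def)

lemma llen_le: "llen c \<le> c"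
proof (induction c rule: less_induct)
  case (less c)
  show ?case
  proof (cases c)
    case (Suc n)
    have "nsnd n < c" using npair_ge(4)[of n] Suc by simp
    from less[OF this] this Suc show ?thesis
      by (auto simp: llen_def nsnd_def split: prod.split)
  qed (simp add: llen_def)
qed

text \<open>A nonempty list is coded by the successor of the pair of its head and the code of its
  tail, so \<open>nsnd (v - 1)\<close> codes the tail. The code 0 of the empty list is a fixed point
  of this operation.\<close>

lemma ltl_iterate: "list_decode (rec_nat c (\<lambda>m v. nsnd (v - 1)) k) = drop k (list_decode c)"
proof (induction k)
  case (Suc k)
  have "list_decode (nsnd (v - 1)) = tl (list_decode v)" for v
    using npair_0(3) by (cases v) (auto simp: nsnd_def split: prod.split)
  with Suc show ?case by (simp add: drop_Suc tl_drop)
qed simp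

lemma recursive_seq_lnth [rec_intros]:
  assumes "recursive_seq f" "recursive_seq g" shows "recursive_seq (\<lambda>z. lnth (f z) (g z))"
proof -
  have "lnth c k = nfst (rec_nat c (\<lambda>m v. nsnd (v - 1)) k - 1)" for c k
  proof (cases "rec_nat c (\<lambda>m v. nsnd (v - 1)) k")
    case 0
    with ltl_iterate[of c k] show ?thesis by (simp add: lnth_def)
  next
    case (Suc n)
    with ltl_iterate[of c k] have "nfst n # list_decode (nsnd n) = drop k (list_decode c)"
      by (simp add: nfst_def nsnd_def split: prod.splits)
    moreover from this have "k < length (list_decode c)" by (metis drop_all leI list.discI)
    ultimately show ?thesis using Suc unfolding lnth_def
      by (metis Cons_nth_drop_Suc diff_Suc_1 list.inject)
  qed
  then show ?thesis
    by (simp only:) (intro rec_intros recursive_seq_rec_nat assms)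
qed

lemma recursive_seq_llen [rec_intros]:
  assumes "recursive_seq f" shows "recursive_seq (\<lambda>z. llen (f z))"
proof -
  have "(rec_nat c (\<lambda>m v. nsnd (v - 1)) k = 0) = (llen c \<le> k)" for c k
    using ltl_iterate[of c k] unfolding llen_def
    by (metis drop_eq_Nil list_decode.simps(1) list_decode_inverse list_encode.simps(1))
  then have "(LEAST k. rec_nat c (\<lambda>m v. nsnd (v - 1)) k = 0) = llen c" 
     "\<exists>k. rec_nat c (\<lambda>m v. nsnd (v - 1)) k = 0" for c
    by (auto intro: Least_equality)
  then have "recursive_seq llen"
    using recursive_seq_Least[of "\<lambda>c. rec_nat c (\<lambda>m v. nsnd (v - 1))"]
    by (simp add: rec_intros recursive_seq_rec_nat)
  from recursive_seq_comp[OF this assms] show ?thesis .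
qed

lemma finite_choice_lcode: "\<forall>i<b. \<exists>v. P i v \<Longrightarrow> \<exists>l. \<forall>i<b. P i (lnth l i)"
proof -
  assume "\<forall>i<b. \<exists>v. P i v"
  then obtain f where "\<forall>i<b. P i (f i)" by metis
  then have "\<forall>i<b. P i (lnth (lcode f b) i)" by simp
  then show ?thesis by blast
qed

section \<open>Spaces of type at most 1 inside Baire space\<close>

text \<open>Chosen to be an isometry: distinct constant sequences differ at 0 and so have distance
  1, as distinct numbers do in \<open>Omega\<close>, and coordinatewise pairing turns the maximum
  metric into the distance of the paired sequences.\<close>

primrec enc :: "point \<Rightarrow> nat \<Rightarrow> nat" where
  "enc (Nat n) = (\<lambda>_. n)"
| "enc (Seq \<alpha>) = \<alpha>"
| "enc (Pr x y) = (\<lambda>i. npair (enc x i) (enc y i))"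

definition sdist :: "(nat \<Rightarrow> nat) \<Rightarrow> (nat \<Rightarrow> nat) \<Rightarrow> real" where
  "sdist \<alpha> \<beta> = (if \<alpha> = \<beta> then 0 else 1 / (real (LEAST n. \<alpha> n \<noteq> \<beta> n) + 1))"

lemma Least_differ:
  fixes \<alpha> \<beta> :: "nat \<Rightarrow> nat"
  assumes "\<alpha> \<noteq> \<beta>"
  obtains L where "(LEAST n. \<alpha> n \<noteq> \<beta> n) = L" "\<alpha> L \<noteq> \<beta> L" "\<forall>n<L. \<alpha> n = \<beta> n"
proof -
  have "\<exists>n. \<alpha> n \<noteq> \<beta> n" using assms by auto
  from LeastI_ex[OF this] show ?thesis using that not_less_Least by blast
qed

text \<open>If \<open>L\<close> is the first difference, the inequality amounts to
  \<open>k + 1 < m * (L + 1)\<close>, that is, every \<open>n\<close> with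
  \<open>(n + 1) * m \<le> k + 1\<close> lies below \<open>L\<close>. A comparison of reals thus
  becomes a condition on coordinates, finitely many of them since \<open>m\<close> is
  positive.\<close>

lemma sdist_less:
  "sdist \<alpha> \<beta> < real m / (real k + 1) \<longleftrightarrow> 0 < m \<and> (\<forall>n. (n + 1) * m \<le> k + 1 \<longrightarrow> \<alpha> n = \<beta> n)"
proof (cases "\<alpha> = \<beta>")
  case True
  then show ?thesis by (simp add: sdist_def zero_less_divide_iff)
next
  case False
  then obtain L where L: "(LEAST n. \<alpha> n \<noteq> \<beta> n) = L" "\<alpha> L \<noteq> \<beta> L" "\<forall>n<L. \<alpha> n = \<beta> n"
    by (rule Least_differ)
  have "sdist \<alpha> \<beta> < real m / (real k + 1) \<longleftrightarrow> real (k + 1) < real (m * (L + 1))"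
    using False L(1) by (simp add: sdist_def field_simps)
  also have "\<dots> \<longleftrightarrow> k + 1 < m * (L + 1)" by (simp only: of_nat_less_iff)
  also have "\<dots> \<longleftrightarrow> 0 < m \<and> (\<forall>n. (n + 1) * m \<le> k + 1 \<longrightarrow> \<alpha> n = \<beta> n)"
  proof
    assume *: "k + 1 < m * (L + 1)"
    have "\<alpha> n = \<beta> n" if "(n + 1) * m \<le> k + 1" for n
    proof -
      from that * have "(n + 1) * m < (L + 1) * m" by (metis le_less_trans mult.commute)
      then have "n < L" by simp
      with L show ?thesis by simp
    qed
    with * show "0 < m \<and> (\<forall>n. (n + 1) * m \<le> k + 1 \<longrightarrow> \<alpha> n = \<beta> n)" by (cases m) auto
  next
    assume "0 < m \<and> (\<forall>n. (n + 1) * m \<le> k + 1 \<longrightarrow> \<alpha> n = \<beta> n)"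
    with L(2) show "k + 1 < m * (L + 1)" by (metis linorder_not_le mult.commute)
  qed
  finally show ?thesis .
qed

lemma sdist_le:
  "sdist \<alpha> \<beta> \<le> real m / (real k + 1) \<longleftrightarrow> (\<forall>n. (n + 1) * m < k + 1 \<longrightarrow> \<alpha> n = \<beta> n)"
proof (cases "\<alpha> = \<beta>")
  case True
  then show ?thesis by (simp add: sdist_def)
next
  case False
  then obtain L where L: "(LEAST n. \<alpha> n \<noteq> \<beta> n) = L" "\<alpha> L \<noteq> \<beta> L" "\<forall>n<L. \<alpha> n = \<beta> n"
    by (rule Least_differ)
  have "sdist \<alpha> \<beta> \<le> real m / (real k + 1) \<longleftrightarrow> real (k + 1) \<le> real (m * (L + 1))"
    using False L(1) by (simp add: sdist_def field_simps)
  also have "\<dots> \<longleftrightarrow> k + 1 \<le> m * (L + 1)" by (simp only: of_nat_le_iff)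
  also have "\<dots> \<longleftrightarrow> (\<forall>n. (n + 1) * m < k + 1 \<longrightarrow> \<alpha> n = \<beta> n)"
  proof
    assume *: "k + 1 \<le> m * (L + 1)"
    show "\<forall>n. (n + 1) * m < k + 1 \<longrightarrow> \<alpha> n = \<beta> n"
    proof (intro allI impI)
      fix n assume "(n + 1) * m < k + 1"
      with * have "(n + 1) * m < (L + 1) * m" by (metis less_le_trans mult.commute)
      then have "n < L" by simp
      with L show "\<alpha> n = \<beta> n" by simp
    qed
  next
    assume "\<forall>n. (n + 1) * m < k + 1 \<longrightarrow> \<alpha> n = \<beta> n"
    with L(2) show "k + 1 \<le> m * (L + 1)" by (metis linorder_not_le mult.commute)
  qed
  finally show ?thesis .
qed

lemma sdist_less_1: "sdist \<alpha> \<beta> < 1 / (real k + 1) \<longleftrightarrow> (\<forall>n\<le>k. \<alpha> n = \<beta> n)"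
  using sdist_less[of \<alpha> \<beta> 1 k] by (auto)

lemma sdist_nonneg: "0 \<le> sdist \<alpha> \<beta>"
  by (simp add: sdist_def)

lemma sdist_eq_0: "sdist \<alpha> \<beta> = 0 \<longleftrightarrow> \<alpha> = \<beta>"
  by (simp add: sdist_def)

lemma sdist_commute: "sdist \<alpha> \<beta> = sdist \<beta> \<alpha>"
  by (simp add: sdist_def eq_commute[of \<alpha> \<beta>] eq_commute[of "\<alpha> _" "\<beta> _"])

lemma sdist_ultra: "sdist \<alpha> \<gamma> \<le> max (sdist \<alpha> \<beta>) (sdist \<beta> \<gamma>)"
proof (cases "\<alpha> = \<beta> \<or> \<beta> = \<gamma> \<or> \<alpha> = \<gamma>")
  case True
  then show ?thesis using sdist_nonneg by (auto simp: sdist_eq_0 le_max_iff_disj sdist_def)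
next
  case False
  obtain L where L: "(LEAST n. \<alpha> n \<noteq> \<gamma> n) = L" "\<alpha> L \<noteq> \<gamma> L" using False Least_differ by blast
  obtain M where M: "(LEAST n. \<alpha> n \<noteq> \<beta> n) = M" "\<forall>n<M. \<alpha> n = \<beta> n" using False Least_differ by blast
  obtain N where N: "(LEAST n. \<beta> n \<noteq> \<gamma> n) = N" "\<forall>n<N. \<beta> n = \<gamma> n" using False Least_differ by blast
  have "M \<le> L \<or> N \<le> L" using L M N by (metis not_less)
  then show ?thesis using False L(1) M(1) N(1) by (auto simp: sdist_def le_max_iff_disj frac_le)
qed

text \<open>The paired sequences first differ at the minimum of the two first differences, and
  taking reciprocals turns the minimum into a maximum.\<close>

lemma sdist_npair:
  "sdist (\<lambda>i. npair (\<alpha> i) (\<beta> i)) (\<lambda>i. npair (\<alpha>' i) (\<beta>' i)) = max (sdist \<alpha> \<alpha>') (sdist \<beta> \<beta>')"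
proof -
  consider "\<alpha> = \<alpha>'" | "\<beta> = \<beta>'" | "\<alpha> \<noteq> \<alpha>'" "\<beta> \<noteq> \<beta>'" by blast
  then show ?thesis
  proof cases
    case 1
    then have "sdist (\<lambda>i. npair (\<alpha> i) (\<beta> i)) (\<lambda>i. npair (\<alpha>' i) (\<beta>' i)) = sdist \<beta> \<beta>'"
      by (simp add: sdist_def fun_eq_iff)
    with 1 show ?thesis using sdist_nonneg[of \<beta> \<beta>'] by (simp add: sdist_eq_0[THEN iffD2] max_def)
  next
    case 2
    then have "sdist (\<lambda>i. npair (\<alpha> i) (\<beta> i)) (\<lambda>i. npair (\<alpha>' i) (\<beta>' i)) = sdist \<alpha> \<alpha>'"
      by (simp add: sdist_def fun_eq_iff)
    with 2 show ?thesis using sdist_nonneg[of \<alpha> \<alpha>'] by (simp add: sdist_eq_0[THEN iffD2] max_def)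
  next
    case 3
    obtain M where M: "(LEAST n. \<alpha> n \<noteq> \<alpha>' n) = M" "\<alpha> M \<noteq> \<alpha>' M" "\<forall>n<M. \<alpha> n = \<alpha>' n"
      using 3 Least_differ by blast
    obtain N where N: "(LEAST n. \<beta> n \<noteq> \<beta>' n) = N" "\<beta> N \<noteq> \<beta>' N" "\<forall>n<N. \<beta> n = \<beta>' n"
      using 3 Least_differ by blast
    have L: "(LEAST n. \<not> (\<alpha> n = \<alpha>' n \<and> \<beta> n = \<beta>' n)) = min M N"
    proof (rule Least_equality)
      show "\<not> (\<alpha> (min M N) = \<alpha>' (min M N) \<and> \<beta> (min M N) = \<beta>' (min M N))"
        using M(2) N(2) by (simp add: min_def)
      show "min M N \<le> n" if "\<not> (\<alpha> n = \<alpha>' n \<and> \<beta> n = \<beta>' n)" for n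
        using that M(3) N(3) by (meson min_le_iff_disj not_le)
    qed
    have "(\<lambda>i. npair (\<alpha> i) (\<beta> i)) \<noteq> (\<lambda>i. npair (\<alpha>' i) (\<beta>' i))"
      using 3 by (auto simp: fun_eq_iff)
    then show ?thesis using 3 M(1) N(1) L
      by (auto simp: sdist_def max_def min_def frac_le divide_simps)
  qed
qed

lemma enc_dst: "type_le_1 X \<Longrightarrow> x \<in> pts X \<Longrightarrow> y \<in> pts X \<Longrightarrow> dst X x y = sdist (enc x) (enc y)"
proof (induction X arbitrary: x y rule: type_le_1.induct)
  case 1
  then show ?case by (auto simp: Omega_def sdist_def fun_eq_iff)
next
  case 2
  then show ?case by (auto simp: Baire_def sdist_def)
next
  case 3
  then show ?case by (auto simp: Cantor_def sdist_def)
next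
  case (4 X Y)
  then show ?case by (auto simp: prod_space_def sdist_npair)
qed

lemma enc_inj: "type_le_1 X \<Longrightarrow> x \<in> pts X \<Longrightarrow> y \<in> pts X \<Longrightarrow> enc x = enc y \<Longrightarrow> x = y"
proof (induction X arbitrary: x y rule: type_le_1.induct)
  case 1
  then show ?case by (auto simp: Omega_def fun_eq_iff)
next
  case (4 X Y)
  from 4(5-7) obtain a b a' b' where [simp]: "x = Pr a b" "y = Pr a' b'" and
    *: "a \<in> pts X" "b \<in> pts Y" "a' \<in> pts X" "b' \<in> pts Y"
    by (auto simp: prod_space_def)
  from 4(7) have "enc a = enc a'" "enc b = enc b'" by (auto simp: fun_eq_iff)
  with 4 * show ?case by auto
qed (auto simp: Baire_def Cantor_def)

lemma enc_dns_Omega [simp]: "enc (dns Omega i) n = i"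
  by (simp add: Omega_def)

lemma enc_dns_Baire [simp]: "enc (dns Baire i) n = lnth i n"
  by (simp add: Baire_def lnth_def Let_def)

lemma enc_dns_Cantor [simp]: "enc (dns Cantor i) n = i div 2 ^ n mod 2"
  by (simp add: Cantor_def)

lemma enc_dns_prod [simp]:
  "enc (dns (X \<otimes> Y) i) n = npair (enc (dns X (nfst i)) n) (enc (dns Y (nsnd i)) n)"
  by (simp add: prod_space_def nfst_def nsnd_def)

lemma pts_prod: "pts (X \<otimes> Y) = {Pr x y |x y. x \<in> pts X \<and> y \<in> pts Y}"
  by (simp add: prod_space_def)

lemma pts_prod_iff [simp]: "Pr x y \<in> pts (X \<otimes> Y) \<longleftrightarrow> x \<in> pts X \<and> y \<in> pts Y"
  by (simp add: prod_space_def)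

lemma pts_simps [simp]: "Nat n \<in> pts Omega" "Seq \<alpha> \<in> pts Baire" "Seq \<alpha> \<in> pts Cantor \<longleftrightarrow> (\<forall>n. \<alpha> n \<le> 1)"
  by (auto simp: Omega_def Baire_def Cantor_def le_Suc_eq)

lemma pts_Omega: "pts Omega = range Nat" and pts_Baire: "pts Baire = range Seq"
  and pts_Cantor: "pts Cantor = {Seq \<alpha> |\<alpha>. \<forall>n. \<alpha> n \<le> 1}"
  by (auto simp: Omega_def Baire_def Cantor_def le_Suc_eq)

lemma dns_in_pts: "type_le_1 X \<Longrightarrow> dns X i \<in> pts X"
  by (induction X arbitrary: i rule: type_le_1.induct) (auto simp: Omega_def Baire_def Cantor_def prod_space_def)

lemma binary_code: "\<forall>n. \<alpha> n \<le> (1::nat) \<Longrightarrow> \<exists>i. \<forall>n<t. i div 2 ^ n mod 2 = \<alpha> n"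
proof (induction t arbitrary: \<alpha>)
  case (Suc t)
  from Suc(1)[of "\<lambda>n. \<alpha> (Suc n)"] Suc(2) obtain i where i: "\<forall>n<t. i div 2 ^ n mod 2 = \<alpha> (Suc n)" by auto
  have 0: "\<alpha> 0 = 0 \<or> \<alpha> 0 = 1" using Suc(2) by (auto simp: le_Suc_eq)
  have "(2 * i + \<alpha> 0) div 2 ^ n mod 2 = \<alpha> n" if "n < Suc t" for n
  proof (cases n)
    case 0
    with \<open>\<alpha> 0 = 0 \<or> \<alpha> 0 = 1\<close> show ?thesis by auto
  next
    case (Suc m)
    have "(2 * i + \<alpha> 0) div 2 ^ n = (2 * i + \<alpha> 0) div 2 div 2 ^ m"
      by (simp add: Suc div_mult2_eq)
    also have "(2 * i + \<alpha> 0) div 2 = i" using 0 by auto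
    finally show ?thesis using i Suc that by simp
  qed
  then show ?case by blast
qed simp

lemma dns_dense: "type_le_1 X \<Longrightarrow> x \<in> pts X \<Longrightarrow> \<exists>i. \<forall>n<t. enc (dns X i) n = enc x n"
proof (induction X arbitrary: x rule: type_le_1.induct)
  case 1
  then show ?case by (auto simp: pts_Omega)
next
  case 2
  then show ?case by (intro exI[of _ "lcode (enc x) t"]) simp
next
  case 3
  then show ?case by (auto simp: pts_Cantor binary_code)
next
  case (4 X Y)
  then obtain a b where [simp]: "x = Pr a b" and *: "a \<in> pts X" "b \<in> pts Y"
    by (auto simp: prod_space_def)
  from 4 * obtain i j where "\<forall>n<t. enc (dns X i) n = enc a n" "\<forall>n<t. enc (dns Y j) n = enc b n"
    by blast
  then show ?case by (intro exI[of _ "npair i j"]) simp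
qed

text \<open>The image of \<open>enc\<close> is closed in Baire space. This yields completeness: the
  coordinates of a Cauchy sequence stabilize, and their limit has to be the image of a
  point.\<close>

lemma enc_closed:
  "type_le_1 X \<Longrightarrow> \<forall>t. \<exists>x\<in>pts X. \<forall>n<t. enc x n = \<alpha> n \<Longrightarrow> \<exists>x\<in>pts X. enc x = \<alpha>"
proof (induction X arbitrary: \<alpha> rule: type_le_1.induct)
  case 1
  have "\<alpha> 0 = \<alpha> n" for n
    using 1[rule_format, of "Suc n"] by (auto simp: pts_Omega)
  then have "enc (Nat (\<alpha> 0)) = \<alpha>" by (intro ext) simp
  then show ?case by (meson pts_simps(1))
next
  case 2
  show ?case by (rule bexI[of _ "Seq \<alpha>"]) auto
next
  case 3
  have "\<alpha> n \<le> 1" for n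
  proof -
    obtain \<beta> where "\<forall>n. \<beta> n \<le> 1" "\<forall>m<Suc n. \<beta> m = \<alpha> m"
      using 3[rule_format, of "Suc n"] unfolding pts_Cantor by fastforce
    then show ?thesis by (metis lessI)
  qed
  then show ?case by (intro bexI[of _ "Seq \<alpha>"]) auto
next
  case (4 X Y)
  have "\<exists>x\<in>pts X. \<forall>n<t. enc x n = nfst (\<alpha> n)" "\<exists>y\<in>pts Y. \<forall>n<t. enc y n = nsnd (\<alpha> n)" for t
  proof -
    obtain a b where "a \<in> pts X" "b \<in> pts Y" "\<forall>n<t. npair (enc a n) (enc b n) = \<alpha> n"
      using 4(5)[rule_format, of t] unfolding pts_prod by auto
    then show "\<exists>x\<in>pts X. \<forall>n<t. enc x n = nfst (\<alpha> n)" "\<exists>y\<in>pts Y. \<forall>n<t. enc y n = nsnd (\<alpha> n)"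
      by (metis npair_simps(1), metis npair_simps(2))
  qed
  with 4(3)[of "\<lambda>n. nfst (\<alpha> n)"] 4(4)[of "\<lambda>n. nsnd (\<alpha> n)"] obtain a b where
    "a \<in> pts X" "enc a = (\<lambda>n. nfst (\<alpha> n))" "b \<in> pts Y" "enc b = (\<lambda>n. nsnd (\<alpha> n))" by blast
  then show ?case by (intro bexI[of _ "Pr a b"]) auto
qed

lemma recursive_seq_dns [rec_intros]:
  assumes "type_le_1 X" "recursive_seq f" "recursive_seq g"
  shows "recursive_seq (\<lambda>z. enc (dns X (f z)) (g z))"
  using assms
proof (induction X arbitrary: f g rule: type_le_1.induct)
  case (4 X Y)
  have "recursive_seq (\<lambda>z. enc (dns X (nfst (f z))) (g z))" "recursive_seq (\<lambda>z. enc (dns Y (nsnd (f z))) (g z))"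
    using 4 by (auto intro!: 4(3,4) rec_intros)
  then show ?case by (auto intro!: rec_intros)
qed (auto intro!: rec_intros)

text \<open>Deciding whether two dense points have distance at most 0 requires comparing all
  coordinates; eventual constancy, with a bound computed from the index, reduces this to finitely
  many.\<close>

lemma enc_dns_eventually_const: "type_le_1 X \<Longrightarrow> i \<le> n \<Longrightarrow> enc (dns X i) n = enc (dns X i) i"
proof (induction X arbitrary: i n rule: type_le_1.induct)
  case 2
  then show ?case using llen_le[of i] by (simp add: lnth_ge)
next
  case 3
  have "i < 2 ^ i" "i < 2 ^ n" using 3 less_exp le_less_trans by blast+
  then show ?case by simp
next
  case (4 X Y)
  have "enc (dns X (nfst i)) n = enc (dns X (nfst i)) i" "enc (dns Y (nsnd i)) n = enc (dns Y (nsnd i)) i"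
    using 4 npair_ge(3,4)[of i] by (metis le_trans)+
  then show ?case by simp
qed simp

text \<open>The criterion of \<open>sdist_less\<close> for the triple coded by \<open>s\<close>,
  with \<open>d\<close> listing the centres. For positive \<open>m\<close>, the inequality
  \<open>(n + 1) * m \<le> k + 1\<close> forces \<open>n \<le> k\<close>, so a bounded quantifier
  suffices and the relation is decidable in \<open>d\<close> and \<alpha>.\<close>

definition in_ball :: "(nat \<Rightarrow> nat \<Rightarrow> nat) \<Rightarrow> (nat \<Rightarrow> nat) \<Rightarrow> nat \<Rightarrow> bool" where
  "in_ball d \<alpha> s \<longleftrightarrow> 0 < nfst (nsnd s) \<and>
     (\<forall>n\<le>nsnd (nsnd s). (n + 1) * nfst (nsnd s) \<le> nsnd (nsnd s) + 1 \<longrightarrow> d (nfst s) n = \<alpha> n)"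

abbreviation den :: "pspace \<Rightarrow> nat \<Rightarrow> nat \<Rightarrow> nat" where "den X i \<equiv> enc (dns X i)"

lemma in_ball_0 [simp]: "\<not> in_ball d x 0"
  by (simp add: in_ball_def)

lemma nbhd_iff:
  assumes "type_le_1 X" shows "x \<in> nbhd X s \<longleftrightarrow> x \<in> pts X \<and> in_ball (den X) (enc x) s"
proof -
  have *: "(n + 1) * m \<le> k + 1 \<Longrightarrow> 0 < m \<Longrightarrow> n \<le> k" for n m k :: nat
    by (cases m) auto
  have "x \<in> nbhd X s \<longleftrightarrow> x \<in> pts X \<and> dst X (dns X (nfst s)) x < real (nfst (nsnd s)) / (real (nsnd (nsnd s)) + 1)"
    by (simp add: nbhd_def nfst_def nsnd_def split: prod.split)
  also have "\<dots> \<longleftrightarrow> x \<in> pts X \<and> in_ball (den X) (enc x) s"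
    using * by (auto simp: enc_dst[OF assms dns_in_pts[OF assms]] sdist_less in_ball_def)
  finally show ?thesis .
qed

lemma Metric_space_type_le_1:
  assumes "type_le_1 X" shows "Metric_space (pts X) (dst X)"
proof -
  have nn: "0 \<le> dst X x y" and cm: "dst X x y = dst X y x" for x y
    using assms
  proof (induction X arbitrary: x y rule: type_le_1.induct)
    case 1
    { case 1 then show ?case by (simp add: Omega_def)
    next case 2 then show ?case by (auto simp: Omega_def) }
  next
    case 2
    have *: "seq_dist x y = (case x of Seq \<alpha> \<Rightarrow> (case y of Seq \<beta> \<Rightarrow> sdist \<alpha> \<beta> | _ \<Rightarrow> 0) | _ \<Rightarrow> 0)" for x y
      by (cases x; cases y) (auto simp: sdist_def)
    { case 1 then show ?case by (auto simp: Baire_def * sdist_nonneg split: point.split)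
    next case 2 then show ?case by (auto simp: Baire_def * sdist_commute split: point.split) }
  next
    case 3
    have *: "seq_dist x y = (case x of Seq \<alpha> \<Rightarrow> (case y of Seq \<beta> \<Rightarrow> sdist \<alpha> \<beta> | _ \<Rightarrow> 0) | _ \<Rightarrow> 0)" for x y
      by (cases x; cases y) (auto simp: sdist_def)
    { case 1 then show ?case by (auto simp: Cantor_def * sdist_nonneg split: point.split)
    next case 2 then show ?case by (auto simp: Cantor_def * sdist_commute split: point.split) }
  next
    case (4 X Y)
    { case 1 show ?case using 4(3,5) by (cases x; cases y) (auto simp: prod_space_def le_max_iff_disj)
    next case 2 show ?case using 4(4,6) by (cases x; cases y) (auto simp: prod_space_def) }
  qed
  show ?thesis
  proof
    fix x y z
    show "0 \<le> dst X x y" "dst X x y = dst X y x" using nn cm by auto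
    assume x: "x \<in> pts X" and y: "y \<in> pts X"
    then show "dst X x y = 0 \<longleftrightarrow> x = y"
      using enc_inj[OF assms] by (auto simp: enc_dst[OF assms] sdist_eq_0)
    assume z: "z \<in> pts X"
    show "dst X x z \<le> dst X x y + dst X y z"
      using x y z sdist_ultra[of "enc x" "enc z" "enc y"] sdist_nonneg[of "enc x" "enc y"] sdist_nonneg[of "enc y" "enc z"]
      by (auto simp: enc_dst[OF assms] max_def split: if_splits)
  qed
qed

lemma openin_top_of:
  assumes "type_le_1 X"
  shows "openin (top_of X) U \<longleftrightarrow> U \<subseteq> pts X \<and> (\<forall>x\<in>U. \<exists>t. \<forall>y\<in>pts X. (\<forall>n<t. enc y n = enc x n) \<longrightarrow> y \<in> U)"
proof -
  interpret Metric_space "pts X" "dst X" by (rule Metric_space_type_le_1[OF assms])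
  have "(\<exists>r>0. mball x r \<subseteq> U) \<longleftrightarrow> (\<exists>t. \<forall>y\<in>pts X. (\<forall>n<t. enc y n = enc x n) \<longrightarrow> y \<in> U)" if x: "x \<in> pts X" for x
  proof
    assume "\<exists>r>0. mball x r \<subseteq> U"
    then obtain r where r: "r > 0" "mball x r \<subseteq> U" by blast
    from r(1) obtain k where k: "1 / (real k + 1) < r" by (metis add.commute nat_approx_posE of_nat_Suc)
    have "y \<in> U" if "y \<in> pts X" "\<forall>n<Suc k. enc y n = enc x n" for y
    proof -
      have "sdist (enc x) (enc y) < 1 / (real k + 1)" using that(2) by (simp add: sdist_less_1)
      with that(1) x k have "y \<in> mball x r" by (simp add: enc_dst[OF assms])
      with r show ?thesis by blast
    qed
    then show "\<exists>t. \<forall>y\<in>pts X. (\<forall>n<t. enc y n = enc x n) \<longrightarrow> y \<in> U" by blast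
  next
    assume "\<exists>t. \<forall>y\<in>pts X. (\<forall>n<t. enc y n = enc x n) \<longrightarrow> y \<in> U"
    then obtain t where t: "\<forall>y\<in>pts X. (\<forall>n<t. enc y n = enc x n) \<longrightarrow> y \<in> U" ..
    have "mball x (1 / (real t + 1)) \<subseteq> U"
      using t x by (auto simp: enc_dst[OF assms] sdist_less_1)
    then show "\<exists>r>0. mball x r \<subseteq> U" by (intro exI[of _ "1 / (real t + 1)"]) auto
  qed
  then show ?thesis unfolding top_of_def openin_mtopology by blast
qed

lemma topspace_top_of [simp]: "type_le_1 X \<Longrightarrow> topspace (top_of X) = pts X"
  unfolding top_of_def by (simp add: Metric_space.topspace_mtopology Metric_space_type_le_1)

lemma mcomplete_type_le_1:
  assumes "type_le_1 X" shows "Metric_space.mcomplete (pts X) (dst X)"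
proof -
  interpret Metric_space "pts X" "dst X" by (rule Metric_space_type_le_1[OF assms])
  show ?thesis unfolding mcomplete_def
  proof (intro allI impI)
    fix \<sigma> assume "MCauchy \<sigma>"
    then have \<sigma>: "\<sigma> n \<in> pts X" "\<epsilon> > 0 \<Longrightarrow> \<exists>N. \<forall>n n'. N \<le> n \<longrightarrow> N \<le> n' \<longrightarrow> dst X (\<sigma> n) (\<sigma> n') < \<epsilon>" for \<epsilon> n
      by (auto simp: MCauchy_def)
    have "\<exists>N. \<forall>n n'. N \<le> n \<longrightarrow> N \<le> n' \<longrightarrow> (\<forall>i\<le>k. enc (\<sigma> n) i = enc (\<sigma> n') i)" for k
      using \<sigma>(2)[of "1 / (real k + 1)"] by (auto simp: \<sigma>(1) enc_dst[OF assms] sdist_less_1)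
    then obtain N where N: "\<And>k n n' i. N k \<le> n \<Longrightarrow> N k \<le> n' \<Longrightarrow> i \<le> k \<Longrightarrow> enc (\<sigma> n) i = enc (\<sigma> n') i"
      by metis
    define \<alpha> where "\<alpha> i = enc (\<sigma> (N i)) i" for i
    have \<alpha>: "enc (\<sigma> n) i = \<alpha> i" if "N k \<le> n" "i \<le> k" for n k i
    proof -
      have "enc (\<sigma> n) i = enc (\<sigma> (max (N k) (N i))) i" using that by (intro N[of k]) auto
      also have "\<dots> = \<alpha> i" unfolding \<alpha>_def by (intro N[of i]) auto
      finally show ?thesis .
    qed
    have "\<exists>x\<in>pts X. \<forall>n<t. enc x n = \<alpha> n" for t
      using \<alpha>[of t "N t"] \<sigma>(1) by (intro bexI[of _ "\<sigma> (N t)"]) auto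
    with enc_closed[OF assms] obtain x where x: "x \<in> pts X" "enc x = \<alpha>" by blast
    have "\<exists>N. \<forall>n\<ge>N. \<sigma> n \<in> pts X \<and> dst X (\<sigma> n) x < \<epsilon>" if "\<epsilon> > 0" for \<epsilon>
    proof -
      from that obtain k where k: "1 / (real k + 1) < \<epsilon>" by (metis add.commute nat_approx_posE of_nat_Suc)
      have "dst X (\<sigma> n) x < \<epsilon>" if "N k \<le> n" for n
      proof -
        have "sdist (enc (\<sigma> n)) (enc x) < 1 / (real k + 1)"
          using \<alpha>[OF that] x(2) by (simp add: sdist_less_1)
        with k x \<sigma>(1) show ?thesis by (simp add: enc_dst[OF assms])
      qed
      with \<sigma>(1) show ?thesis by blast
    qed
    with x(1) show "\<exists>x. limitin mtopology \<sigma> x sequentially"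
      by (auto simp: limit_metric_sequentially)
  qed
qed

lemma recursive_rel_4:
  assumes "recursive_pred (\<lambda>z. P (nfst (nfst z)) (nsnd (nfst z)) (nfst (nsnd z)) (nsnd (nsnd z)))"
  shows "recursive_rel 4 (\<lambda>xs. P (xs ! 0) (xs ! 1) (xs ! 2) (xs ! 3))"
  using recfn_comp1[OF assms[unfolded recursive_pred_def recursive_seq_def],
      of 4 "\<lambda>xs. npair (npair (xs ! 0) (xs ! 1)) (npair (xs ! 2) (xs ! 3))"]
  by (simp add: recursive_rel_def recfn_npair recfn_proj)

lemma rec_presented_type_le_1:
  assumes "type_le_1 X" shows "rec_presented X"
proof -
  interpret Metric_space "pts X" "dst X" by (rule Metric_space_type_le_1[OF assms])
  have "top_of X closure_of range (dns X) = pts X"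
  proof (intro equalityI subsetI)
    fix x assume x: "x \<in> pts X"
    have "\<exists>y\<in>range (dns X). y \<in> mball x r" if "r > 0" for r
    proof -
      from that obtain k where k: "1 / (real k + 1) < r" by (metis add.commute nat_approx_posE of_nat_Suc)
      from dns_dense[OF assms x, of "Suc k"] obtain i where "\<forall>n<Suc k. den X i n = enc x n" ..
      then have "sdist (enc x) (den X i) < 1 / (real k + 1)" by (simp add: sdist_less_1)
      with k x dns_in_pts[OF assms] have "dns X i \<in> mball x r" by (simp add: enc_dst[OF assms])
      then show ?thesis by blast
    qed
    with x show "x \<in> top_of X closure_of range (dns X)"
      unfolding top_of_def metric_closure_of by blast
  next
    fix x assume "x \<in> top_of X closure_of range (dns X)"
    then show "x \<in> pts X" unfolding top_of_def metric_closure_of by blast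
  qed
  \<comment> \<open>For \<open>m > 0\<close> only coordinates below \<open>k\<close> count. For
    \<open>m = 0\<close> all of them count, but both points are constant from coordinate
    \<open>i + j\<close> on. The bound covers both cases.\<close>
  moreover have "dst X (dns X i) (dns X j) \<le> real m / (real k + 1)
      \<longleftrightarrow> (\<forall>n\<le>i+j+k. (n + 1) * m < k + 1 \<longrightarrow> den X i n = den X j n)" for i j m k
  proof -
    have "den X i n = den X j n" if *: "\<forall>n\<le>i+j+k. (n + 1) * m < k + 1 \<longrightarrow> den X i n = den X j n"
      and n: "(n + 1) * m < k + 1" for n
    proof (cases "n \<le> i + j + k")
      case False
      have "m = 0"
      proof (rule ccontr)
        assume "m \<noteq> 0"
        then have "n + 1 \<le> (n + 1) * m" by (cases m) auto
        with n False show False by linarith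
      qed
      with * have "den X i (i + j) = den X j (i + j)" by simp
      with False show ?thesis
        using enc_dns_eventually_const[OF assms, of i n] enc_dns_eventually_const[OF assms, of i "i + j"]
          enc_dns_eventually_const[OF assms, of j n] enc_dns_eventually_const[OF assms, of j "i + j"]
        by auto
    qed (use that in auto)
    then show ?thesis by (auto simp: enc_dst[OF assms] dns_in_pts[OF assms] sdist_le)
  qed
  moreover have "dst X (dns X i) (dns X j) < real m / (real k + 1)
      \<longleftrightarrow> 0 < m \<and> (\<forall>n\<le>k. (n + 1) * m \<le> k + 1 \<longrightarrow> den X i n = den X j n)" for i j m k
  proof -
    have *: "(n + 1) * m \<le> k + 1 \<Longrightarrow> 0 < m \<Longrightarrow> n \<le> k" for n m k :: nat
      by (cases m) auto
    then show ?thesis by (auto simp: enc_dst[OF assms] dns_in_pts[OF assms] sdist_less)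
  qed
  moreover have "recursive_pred (\<lambda>z. \<forall>n\<le>nfst (nfst z) + nsnd (nfst z) + nsnd (nsnd z).
      (n + 1) * nfst (nsnd z) < nsnd (nsnd z) + 1 \<longrightarrow> den X (nfst (nfst z)) n = den X (nsnd (nfst z)) n)"
    by (intro rec_intros assms)
  note recursive_rel_4[OF this]
  moreover have "recursive_pred (\<lambda>z. 0 < nfst (nsnd z) \<and> (\<forall>n\<le>nsnd (nsnd z).
      (n + 1) * nfst (nsnd z) \<le> nsnd (nsnd z) + 1 \<longrightarrow> den X (nfst (nfst z)) n = den X (nsnd (nfst z)) n))"
    by (intro rec_intros assms)
  note recursive_rel_4[OF this]
  ultimately show ?thesis
    unfolding rec_presented_def
    using Metric_space_axioms mcomplete_type_le_1[OF assms] dns_in_pts[OF assms] by auto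
qed

section \<open>Semirecursive relations with an oracle\<close>

definition lprefix :: "nat \<Rightarrow> (nat \<Rightarrow> nat) \<Rightarrow> bool" where
  "lprefix c \<alpha> \<longleftrightarrow> (\<forall>i<llen c. lnth c i = \<alpha> i)"

lemma lprefix_lcode [simp]: "lprefix (lcode \<alpha> k) \<alpha>"
  by (simp add: lprefix_def)

lemma lprefix_0 [simp]: "lprefix 0 \<alpha>"
  by (simp add: lprefix_def llen_def)

text \<open>The witness of a semirecursive relation consists of a finite part of the oracle, on which the
  computation depends, and of further numbers. \<open>SRT t\<close> says that the total functional \<open>t\<close> has a
  semirecursive graph, that is, that it is recursive.\<close>

definition SR :: "((nat \<Rightarrow> nat) \<Rightarrow> nat \<Rightarrow> bool) \<Rightarrow> bool" where
  "SR Q \<longleftrightarrow> (\<exists>D. recursive_pred D \<and> (\<forall>\<alpha> n. Q \<alpha> n \<longleftrightarrow> (\<exists>w. lprefix (nfst w) \<alpha> \<and> D (npair w n))))"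

definition SRT :: "((nat \<Rightarrow> nat) \<Rightarrow> nat \<Rightarrow> nat) \<Rightarrow> bool" where
  "SRT t \<longleftrightarrow> SR (\<lambda>\<alpha> z. t \<alpha> (nfst z) = nsnd z)"

named_theorems sr_intros

lemma SR_E:
  assumes "SR Q"
  obtains D where "recursive_pred D" "\<And>\<alpha> n. Q \<alpha> n \<longleftrightarrow> (\<exists>w. lprefix (nfst w) \<alpha> \<and> D (npair w n))"
  using assms unfolding SR_def by blast

lemma SR_recursive_pred [sr_intros]: "recursive_pred P \<Longrightarrow> SR (\<lambda>\<alpha> n. P n)"
  unfolding SR_def
proof (intro exI conjI allI)
  assume "recursive_pred P"
  then show "recursive_pred (\<lambda>z. P (nsnd z))"
    by (rule recursive_pred_comp) (intro rec_intros)
  show "P n \<longleftrightarrow> (\<exists>w. lprefix (nfst w) \<alpha> \<and> P (nsnd (npair w n)))" for \<alpha> n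
    by (auto intro: exI[of _ 0])
qed

lemma SR_comp_recursive_seq:
  assumes "SR Q" "recursive_seq f" shows "SR (\<lambda>\<alpha> n. Q \<alpha> (f n))"
proof -
  obtain D where D: "recursive_pred D" "\<And>\<alpha> n. Q \<alpha> n \<longleftrightarrow> (\<exists>w. lprefix (nfst w) \<alpha> \<and> D (npair w n))"
    using assms(1) by (rule SR_E) blast
  have "recursive_pred (\<lambda>z. D (npair (nfst z) (f (nsnd z))))"
    by (rule recursive_pred_comp[OF D(1)]) (intro rec_intros recursive_seq_comp[OF assms(2)])
  with D(2) show ?thesis unfolding SR_def
    by (intro exI[of _ "\<lambda>z. D (npair (nfst z) (f (nsnd z)))"]) simp
qed

lemma SR_oracle: "SR (\<lambda>\<alpha> z. \<alpha> (nfst z) = nsnd z)"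
  unfolding SR_def
proof (intro exI conjI allI)
  let ?D = "\<lambda>z. nfst (nsnd z) < llen (nfst (nfst z)) \<and> lnth (nfst (nfst z)) (nfst (nsnd z)) = nsnd (nsnd z)"
  show "recursive_pred ?D" by (intro rec_intros)
  show "\<alpha> (nfst z) = nsnd z \<longleftrightarrow> (\<exists>w. lprefix (nfst w) \<alpha> \<and> ?D (npair w z))" for \<alpha> z
  proof
    assume "\<alpha> (nfst z) = nsnd z"
    then show "\<exists>w. lprefix (nfst w) \<alpha> \<and> ?D (npair w z)"
      by (intro exI[of _ "npair (lcode \<alpha> (Suc (nfst z))) 0"]) simp
  qed (auto simp: lprefix_def)
qed

text \<open>Witnesses of several relations use different finite parts of the oracle. A joint witness
  stores one longer part, and that it extends the others is a decidable relation between codes,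
  which does not mention the oracle.\<close>

definition lsub :: "nat \<Rightarrow> nat \<Rightarrow> bool" where
  "lsub c d \<longleftrightarrow> llen c \<le> llen d \<and> (\<forall>i<llen c. lnth c i = lnth d i)"

lemma recursive_pred_lsub [rec_intros]:
  assumes "recursive_seq f" "recursive_seq g" shows "recursive_pred (\<lambda>z. lsub (f z) (g z))"
  unfolding lsub_def
  by (intro rec_intros assms recursive_seq_comp[OF assms(1)] recursive_seq_comp[OF assms(2)])

lemma lprefix_lsub: "lprefix d \<alpha> \<Longrightarrow> lsub c d \<Longrightarrow> lprefix c \<alpha>"
  by (auto simp: lprefix_def lsub_def)

lemma lsub_lcode: "lprefix c \<alpha> \<Longrightarrow> llen c \<le> k \<Longrightarrow> lsub c (lcode \<alpha> k)"
  by (auto simp: lprefix_def lsub_def)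

lemma SR_conj [sr_intros]:
  assumes "SR Q" "SR R" shows "SR (\<lambda>\<alpha> n. Q \<alpha> n \<and> R \<alpha> n)"
proof -
  obtain D where D: "recursive_pred D" "\<And>\<alpha> n. Q \<alpha> n \<longleftrightarrow> (\<exists>w. lprefix (nfst w) \<alpha> \<and> D (npair w n))"
    using assms(1) by (rule SR_E) blast
  obtain E where E: "recursive_pred E" "\<And>\<alpha> n. R \<alpha> n \<longleftrightarrow> (\<exists>w. lprefix (nfst w) \<alpha> \<and> E (npair w n))"
    using assms(2) by (rule SR_E) blast
  let ?D = "\<lambda>z. (lsub (nfst (nfst (nsnd (nfst z)))) (nfst (nfst z)) \<and> D (npair (nfst (nsnd (nfst z))) (nsnd z))) \<and>
    (lsub (nfst (nsnd (nsnd (nfst z)))) (nfst (nfst z)) \<and> E (npair (nsnd (nsnd (nfst z))) (nsnd z)))"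
  have "recursive_pred ?D"
    by (intro rec_intros recursive_pred_comp[OF D(1)] recursive_pred_comp[OF E(1)])
  moreover have "Q \<alpha> n \<and> R \<alpha> n \<longleftrightarrow> (\<exists>w. lprefix (nfst w) \<alpha> \<and> ?D (npair w n))" for \<alpha> n
  proof
    assume "Q \<alpha> n \<and> R \<alpha> n"
    then obtain u v where u: "lprefix (nfst u) \<alpha>" "D (npair u n)" and v: "lprefix (nfst v) \<alpha>" "E (npair v n)"
      using D(2) E(2) by blast
    let ?c = "lcode \<alpha> (max (llen (nfst u)) (llen (nfst v)))"
    show "\<exists>w. lprefix (nfst w) \<alpha> \<and> ?D (npair w n)"
      using u v by (intro exI[of _ "npair ?c (npair u v)"]) (simp add: lsub_lcode)
  next
    assume "\<exists>w. lprefix (nfst w) \<alpha> \<and> ?D (npair w n)"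
    then obtain w where w: "lprefix (nfst w) \<alpha>" "?D (npair w n)" by blast
    then have "lprefix (nfst (nfst (nsnd w))) \<alpha>" "D (npair (nfst (nsnd w)) n)"
      "lprefix (nfst (nsnd (nsnd w))) \<alpha>" "E (npair (nsnd (nsnd w)) n)"
      by (auto intro: lprefix_lsub)
    then show "Q \<alpha> n \<and> R \<alpha> n" using D(2) E(2) by blast
  qed
  ultimately show ?thesis unfolding SR_def by blast
qed

lemma SR_disj [sr_intros]:
  assumes "SR Q" "SR R" shows "SR (\<lambda>\<alpha> n. Q \<alpha> n \<or> R \<alpha> n)"
proof -
  obtain D where D: "recursive_pred D" "\<And>\<alpha> n. Q \<alpha> n \<longleftrightarrow> (\<exists>w. lprefix (nfst w) \<alpha> \<and> D (npair w n))"
    using assms(1) by (rule SR_E) blast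
  obtain E where E: "recursive_pred E" "\<And>\<alpha> n. R \<alpha> n \<longleftrightarrow> (\<exists>w. lprefix (nfst w) \<alpha> \<and> E (npair w n))"
    using assms(2) by (rule SR_E) blast
  have "recursive_pred (\<lambda>z. D z \<or> E z)" by (intro rec_intros D(1) E(1))
  with D(2) E(2) show ?thesis unfolding SR_def by (intro exI[of _ "\<lambda>z. D z \<or> E z"]) blast
qed

lemma SR_ex [sr_intros]:
  assumes "SR (\<lambda>\<alpha> z. Q \<alpha> (nfst z) (nsnd z))" shows "SR (\<lambda>\<alpha> n. \<exists>m. Q \<alpha> n m)"
proof -
  obtain D where D: "recursive_pred D"
    "\<And>\<alpha> z. Q \<alpha> (nfst z) (nsnd z) \<longleftrightarrow> (\<exists>w. lprefix (nfst w) \<alpha> \<and> D (npair w z))"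
    using assms by (rule SR_E) blast
  let ?D = "\<lambda>z. nfst (nfst (nsnd (nfst z))) = nfst (nfst z) \<and>
    D (npair (nfst (nsnd (nfst z))) (npair (nsnd z) (nsnd (nsnd (nfst z)))))"
  have "recursive_pred ?D"
    by (intro rec_intros recursive_pred_comp[OF D(1)])
  moreover have "(\<exists>m. Q \<alpha> n m) \<longleftrightarrow> (\<exists>w. lprefix (nfst w) \<alpha> \<and> ?D (npair w n))" for \<alpha> n
  proof
    assume "\<exists>m. Q \<alpha> n m"
    then obtain m w where "lprefix (nfst w) \<alpha>" "D (npair w (npair n m))"
      using D(2)[of _ "npair n _"] by auto
    then show "\<exists>w. lprefix (nfst w) \<alpha> \<and> ?D (npair w n)"
      by (intro exI[of _ "npair (nfst w) (npair w m)"]) simp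
  next
    assume "\<exists>w. lprefix (nfst w) \<alpha> \<and> ?D (npair w n)"
    then obtain w where "lprefix (nfst w) \<alpha>" "?D (npair w n)" by blast
    then have "Q \<alpha> n (nsnd (nsnd w))" using D(2)[of \<alpha> "npair n (nsnd (nsnd w))"] by auto
    then show "\<exists>m. Q \<alpha> n m" ..
  qed
  ultimately show ?thesis unfolding SR_def by blast
qed

text \<open>The finitely many witnesses are collected in one coded list, next to a part of the
  oracle long enough for all of them.\<close>

lemma SR_ball_recursive:
  assumes "SR (\<lambda>\<alpha> z. Q \<alpha> (nfst z) (nsnd z))" "recursive_seq b" shows "SR (\<lambda>\<alpha> n. \<forall>m<b n. Q \<alpha> n m)"
proof -
  obtain D where D: "recursive_pred D"
    "\<And>\<alpha> z. Q \<alpha> (nfst z) (nsnd z) \<longleftrightarrow> (\<exists>w. lprefix (nfst w) \<alpha> \<and> D (npair w z))"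
    using assms(1) by (rule SR_E) blast
  let ?D = "\<lambda>z. \<forall>m<b (nsnd z). lsub (nfst (lnth (nsnd (nfst z)) m)) (nfst (nfst z)) \<and>
    D (npair (lnth (nsnd (nfst z)) m) (npair (nsnd z) m))"
  have "recursive_pred ?D"
    by (intro rec_intros recursive_pred_comp[OF D(1)] recursive_seq_comp[OF assms(2)])
  moreover have "(\<forall>m<b n. Q \<alpha> n m) \<longleftrightarrow> (\<exists>w. lprefix (nfst w) \<alpha> \<and> ?D (npair w n))" for \<alpha> n
  proof
    assume "\<forall>m<b n. Q \<alpha> n m"
    then have "\<forall>m<b n. \<exists>w. lprefix (nfst w) \<alpha> \<and> D (npair w (npair n m))"
      using D(2)[of \<alpha> "npair n _"] by auto
    from finite_choice_lcode[OF this] obtain l where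
      l: "\<forall>m<b n. lprefix (nfst (lnth l m)) \<alpha> \<and> D (npair (lnth l m) (npair n m))" ..
    obtain k where k: "\<forall>m<b n. llen (nfst (lnth l m)) \<le> k"
      using finite_nat_set_iff_bounded_le[of "(\<lambda>m. llen (nfst (lnth l m))) ` {..<b n}"] by auto
    then show "\<exists>w. lprefix (nfst w) \<alpha> \<and> ?D (npair w n)"
      using l by (intro exI[of _ "npair (lcode \<alpha> k) l"]) (simp add: lsub_lcode)
  next
    assume "\<exists>w. lprefix (nfst w) \<alpha> \<and> ?D (npair w n)"
    then obtain w where w: "lprefix (nfst w) \<alpha>" "?D (npair w n)" by blast
    show "\<forall>m<b n. Q \<alpha> n m"
    proof (intro allI impI)
      fix m assume "m < b n"
      with w have "lprefix (nfst (lnth (nsnd w) m)) \<alpha>" "D (npair (lnth (nsnd w) m) (npair n m))"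
        by (auto intro: lprefix_lsub)
      then show "Q \<alpha> n m" using D(2)[of \<alpha> "npair n m"] by auto
    qed
  qed
  ultimately show ?thesis unfolding SR_def by blast
qed

lemma SRT_recursive_seq [sr_intros]:
  assumes "recursive_seq f" shows "SRT (\<lambda>\<alpha> n. f n)"
  unfolding SRT_def by (intro sr_intros rec_intros recursive_seq_comp[OF assms])

lemma SR_comp:
  assumes "SR Q" "SRT t" shows "SR (\<lambda>\<alpha> n. Q \<alpha> (t \<alpha> n))"
proof -
  have "SR (\<lambda>\<alpha> n. \<exists>m. t \<alpha> n = m \<and> Q \<alpha> m)"
    by (intro sr_intros assms(2)[unfolded SRT_def] SR_comp_recursive_seq[OF assms(1)] rec_intros)
  then show ?thesis by simp
qed

lemma SRT_comp:
  assumes "SRT u" "SRT t" shows "SRT (\<lambda>\<alpha> n. u \<alpha> (t \<alpha> n))"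
proof -
  have t: "SR (\<lambda>\<alpha> z. t \<alpha> (nfst (nfst z)) = nsnd z)"
    using SR_comp_recursive_seq[OF assms(2)[unfolded SRT_def], of "\<lambda>z. npair (nfst (nfst z)) (nsnd z)"]
    by (simp add: rec_intros)
  have u: "SR (\<lambda>\<alpha> z. u \<alpha> (nsnd z) = nsnd (nfst z))"
    using SR_comp_recursive_seq[OF assms(1)[unfolded SRT_def], of "\<lambda>z. npair (nsnd z) (nsnd (nfst z))"]
    by (simp add: rec_intros)
  have "SR (\<lambda>\<alpha> z. \<exists>m. t \<alpha> (nfst z) = m \<and> u \<alpha> m = nsnd z)"
    by (intro sr_intros t u)
  then show ?thesis unfolding SRT_def by simp
qed

lemma SRT_oracle [sr_intros]: "SRT t \<Longrightarrow> SRT (\<lambda>\<alpha> n. \<alpha> (t \<alpha> n))"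
  by (rule SRT_comp) (simp_all add: SRT_def SR_oracle)

lemma SRT_comp1:
  assumes "recursive_seq h" "SRT t" shows "SRT (\<lambda>\<alpha> n. h (t \<alpha> n))"
  using SRT_comp[OF SRT_recursive_seq[OF assms(1)] assms(2)] .

lemma SRT_npair [sr_intros]:
  assumes "SRT t" "SRT u" shows "SRT (\<lambda>\<alpha> n. npair (t \<alpha> n) (u \<alpha> n))"
proof -
  have "SR (\<lambda>\<alpha> z. t \<alpha> (nfst z) = nfst (nsnd z))" "SR (\<lambda>\<alpha> z. u \<alpha> (nfst z) = nsnd (nsnd z))"
    using SR_comp_recursive_seq[OF assms(1)[unfolded SRT_def], of "\<lambda>z. npair (nfst z) (nfst (nsnd z))"]
      SR_comp_recursive_seq[OF assms(2)[unfolded SRT_def], of "\<lambda>z. npair (nfst z) (nsnd (nsnd z))"]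
    by (simp_all add: rec_intros)
  then have "SR (\<lambda>\<alpha> z. t \<alpha> (nfst z) = nfst (nsnd z) \<and> u \<alpha> (nfst z) = nsnd (nsnd z))" by (rule SR_conj)
  moreover have "npair a b = z \<longleftrightarrow> a = nfst z \<and> b = nsnd z" for a b z
    by (metis npair_simps(1-3))
  ultimately show ?thesis unfolding SRT_def by simp
qed

lemma SRT_comp2:
  assumes "recursive_seq (\<lambda>z. h (nfst z) (nsnd z))" "SRT t" "SRT u" shows "SRT (\<lambda>\<alpha> n. h (t \<alpha> n) (u \<alpha> n))"
  using SRT_comp1[OF assms(1) SRT_npair[OF assms(2,3)]] by simp

lemma SRT_arith [sr_intros]:
  assumes "SRT t"
  shows "SRT (\<lambda>\<alpha> n. Suc (t \<alpha> n))" "SRT (\<lambda>\<alpha> n. nfst (t \<alpha> n))" "SRT (\<lambda>\<alpha> n. nsnd (t \<alpha> n))"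
    "SRT (\<lambda>\<alpha> n. llen (t \<alpha> n))"
    "SRT u \<Longrightarrow> SRT (\<lambda>\<alpha> n. t \<alpha> n + u \<alpha> n)" "SRT u \<Longrightarrow> SRT (\<lambda>\<alpha> n. t \<alpha> n - u \<alpha> n)"
    "SRT u \<Longrightarrow> SRT (\<lambda>\<alpha> n. t \<alpha> n * u \<alpha> n)" "SRT u \<Longrightarrow> SRT (\<lambda>\<alpha> n. lnth (t \<alpha> n) (u \<alpha> n))"
    "type_le_1 X \<Longrightarrow> SRT u \<Longrightarrow> SRT (\<lambda>\<alpha> n. den X (t \<alpha> n) (u \<alpha> n))"
  using assms
  by (auto intro!: SRT_comp1[of _ t] SRT_comp2[of _ t u] rec_intros)

lemma SR_pred2:
  assumes "recursive_pred (\<lambda>z. P (nfst z) (nsnd z))" "SRT t" "SRT u" shows "SR (\<lambda>\<alpha> n. P (t \<alpha> n) (u \<alpha> n))"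
  using SR_comp[OF SR_recursive_pred[OF assms(1)] SRT_npair[OF assms(2,3)]] by simp

lemma SR_arith [sr_intros]:
  assumes "SRT t" "SRT u"
  shows "SR (\<lambda>\<alpha> n. t \<alpha> n = u \<alpha> n)" "SR (\<lambda>\<alpha> n. t \<alpha> n \<noteq> u \<alpha> n)" "SR (\<lambda>\<alpha> n. t \<alpha> n \<le> u \<alpha> n)"
    "SR (\<lambda>\<alpha> n. t \<alpha> n < u \<alpha> n)" "SR (\<lambda>\<alpha> n. \<not> t \<alpha> n \<le> u \<alpha> n)" "SR (\<lambda>\<alpha> n. \<not> t \<alpha> n < u \<alpha> n)"
  by (rule SR_pred2[OF _ assms]; intro rec_intros)+

lemma SR_ball [sr_intros]:
  assumes "SR (\<lambda>\<alpha> z. Q \<alpha> (nfst z) (nsnd z))" "SRT b" shows "SR (\<lambda>\<alpha> n. \<forall>m<b \<alpha> n. Q \<alpha> n m)"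
proof -
  have 1: "SR (\<lambda>\<alpha> z. Q \<alpha> (nfst (nfst z)) (nsnd z))"
    using SR_comp_recursive_seq[OF assms(1), of "\<lambda>z. npair (nfst (nfst z)) (nsnd z)"] by (simp add: rec_intros)
  have "SR (\<lambda>\<alpha> n. \<exists>k. b \<alpha> n = k \<and> (\<forall>m<k. Q \<alpha> n m))"
    by (intro sr_intros assms(2)[unfolded SRT_def] SR_ball_recursive 1 rec_intros)
  then show ?thesis by simp
qed

lemma SR_ball_le [sr_intros]:
  assumes "SR (\<lambda>\<alpha> z. Q \<alpha> (nfst z) (nsnd z))" "SRT b" shows "SR (\<lambda>\<alpha> n. \<forall>m\<le>b \<alpha> n. Q \<alpha> n m)"
  using SR_ball[of Q "\<lambda>\<alpha> n. Suc (b \<alpha> n)"] assms by (simp add: sr_intros less_Suc_eq_le)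

lemma SR_bex [sr_intros]:
  assumes "SR (\<lambda>\<alpha> z. Q \<alpha> (nfst z) (nsnd z))" "SRT b" shows "SR (\<lambda>\<alpha> n. \<exists>m<b \<alpha> n. Q \<alpha> n m)"
  by (intro sr_intros assms SRT_comp[OF assms(2)] rec_intros)

lemma SR_bex_le [sr_intros]:
  assumes "SR (\<lambda>\<alpha> z. Q \<alpha> (nfst z) (nsnd z))" "SRT b" shows "SR (\<lambda>\<alpha> n. \<exists>m\<le>b \<alpha> n. Q \<alpha> n m)"
  by (intro sr_intros assms SRT_comp[OF assms(2)] rec_intros)

lemma SR_imp [sr_intros]:
  assumes "SR (\<lambda>\<alpha> n. \<not> P \<alpha> n)" "SR Q" shows "SR (\<lambda>\<alpha> n. P \<alpha> n \<longrightarrow> Q \<alpha> n)"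
  unfolding imp_conv_disj using assms by (rule SR_disj)

lemma SRT_if [sr_intros]:
  assumes "SR P" "SR (\<lambda>\<alpha> n. \<not> P \<alpha> n)" "SRT t" "SRT u" shows "SRT (\<lambda>\<alpha> n. if P \<alpha> n then t \<alpha> n else u \<alpha> n)"
proof -
  have "SR (\<lambda>\<alpha> z. P \<alpha> (nfst z) \<and> t \<alpha> (nfst z) = nsnd z \<or> \<not> P \<alpha> (nfst z) \<and> u \<alpha> (nfst z) = nsnd z)"
    by (intro sr_intros SR_comp[OF assms(1)] SR_comp[OF assms(2)] assms(3,4)[unfolded SRT_def] rec_intros)
  then show ?thesis unfolding SRT_def by (rule back_subst[of SR]) auto
qed

lemma SRT_case_nat [sr_intros]:
  assumes "SRT t" "SRT u" "SRT (\<lambda>\<alpha> z. v \<alpha> (nfst z) (nsnd z))"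
  shows "SRT (\<lambda>\<alpha> n. case t \<alpha> n of 0 \<Rightarrow> u \<alpha> n | Suc m \<Rightarrow> v \<alpha> n m)"
proof -
  have v: "SRT (\<lambda>\<alpha> n. v \<alpha> n (t \<alpha> n - 1))"
    using SRT_comp[OF assms(3), of "\<lambda>\<alpha> n. npair n (t \<alpha> n - 1)"] assms(1) by (simp add: sr_intros rec_intros)
  have "SRT (\<lambda>\<alpha> n. if t \<alpha> n = 0 then u \<alpha> n else v \<alpha> n (t \<alpha> n - 1))"
    by (intro sr_intros assms v rec_intros)
  then show ?thesis by (rule back_subst[of SRT]) (auto split: nat.split intro!: ext)
qed

text \<open>A witness inspects only a finite part of its oracle. Comparing this part with
  \<open>\<Phi> \<alpha> n\<close> is a bounded conjunction of equations, each semirecursive in the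
  old oracle.\<close>

lemma SR_subst:
  assumes "SR Q" "SRT (\<lambda>\<alpha> z. \<Phi> \<alpha> (nfst z) (nsnd z))" "SRT t"
  shows "SR (\<lambda>\<alpha> n. Q (\<Phi> \<alpha> n) (t \<alpha> n))"
proof -
  obtain D where D: "recursive_pred D" "\<And>\<alpha> n. Q \<alpha> n \<longleftrightarrow> (\<exists>w. lprefix (nfst w) \<alpha> \<and> D (npair w n))"
    using assms(1) by (rule SR_E) blast
  have *: "SRT (\<lambda>\<alpha> z. \<Phi> \<alpha> (nfst (nfst z)) (nsnd z))"
    using SRT_comp[OF assms(2), of "\<lambda>\<alpha> z. npair (nfst (nfst z)) (nsnd z)"] by (simp add: sr_intros rec_intros)
  have "SR (\<lambda>\<alpha> n. \<exists>w. lprefix (nfst w) (\<Phi> \<alpha> n) \<and> D (npair w (t \<alpha> n)))"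
    unfolding lprefix_def
    by (intro sr_intros SR_comp[OF SR_recursive_pred[OF D(1)]] * SRT_comp[OF assms(3)] rec_intros)
  with D(2) show ?thesis by simp
qed

lemma SRT_subst:
  assumes "SRT u" "SRT (\<lambda>\<alpha> z. \<Phi> \<alpha> (nfst z) (nsnd z))" "SRT t"
  shows "SRT (\<lambda>\<alpha> n. u (\<Phi> \<alpha> n) (t \<alpha> n))"
proof -
  have *: "SRT (\<lambda>\<alpha> z. \<Phi> \<alpha> (nfst (nfst z)) (nsnd z))"
    using SRT_comp[OF assms(2), of "\<lambda>\<alpha> z. npair (nfst (nfst z)) (nsnd z)"] by (simp add: sr_intros rec_intros)
  have "SRT (\<lambda>\<alpha> z. npair (t \<alpha> (nfst z)) (nsnd z))"
    by (intro sr_intros SRT_comp[OF assms(3)] rec_intros)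
  from SR_subst[OF assms(1)[unfolded SRT_def] * this] show ?thesis unfolding SRT_def by simp
qed

lemma SR_subst_oracle:
  assumes "SR (\<lambda>\<alpha> n. Q \<alpha>)" "SRT (\<lambda>\<alpha> z. \<Phi> \<alpha> (nfst z) (nsnd z))"
  shows "SR (\<lambda>\<alpha> n. Q (\<Phi> \<alpha> n))"
  by (rule SR_subst[OF assms(1,2), of "\<lambda>\<alpha> n. 0"]) (intro sr_intros rec_intros)

lemma SRT_comp_pair:
  assumes "SRT (\<lambda>\<alpha> z. g \<alpha> (nfst z) (nsnd z))" "SRT r" "SRT t"
  shows "SRT (\<lambda>\<alpha> z. g \<alpha> (r \<alpha> z) (t \<alpha> z))"
  using SRT_comp[OF assms(1) SRT_npair[OF assms(2,3)]] by simp

lemma SR_comp_pair: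
  assumes "SR (\<lambda>\<alpha> z. Q \<alpha> (nfst z) (nsnd z))" "SRT r" "SRT t"
  shows "SR (\<lambda>\<alpha> z. Q \<alpha> (r \<alpha> z) (t \<alpha> z))"
  using SR_comp[OF assms(1) SRT_npair[OF assms(2,3)]] by simp

lemma SR_Collect [sr_intros]: "SR (\<lambda>\<alpha> z. P \<alpha> z (t \<alpha> z)) \<Longrightarrow> SR (\<lambda>\<alpha> z. t \<alpha> z \<in> {s. P \<alpha> z s})"
  by simp

lemma SRT_subst_pair:
  assumes "SRT (\<lambda>\<alpha> z. H \<alpha> (nfst z) (nsnd z))" "SRT (\<lambda>\<alpha> z. \<Phi> \<alpha> (nfst z) (nsnd z))" "SRT r" "SRT t"
  shows "SRT (\<lambda>\<alpha> n. H (\<Phi> \<alpha> n) (r \<alpha> n) (t \<alpha> n))"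
  using SRT_subst[OF assms(1,2) SRT_npair[OF assms(3,4)]] by simp

section \<open>Finite use of the oracle, enumerations and effectively open sets\<close>

lemma SR_continuous:
  assumes "SR Q" "Q \<alpha> n" shows "\<exists>t. \<forall>\<beta>. (\<forall>i<t. \<beta> i = \<alpha> i) \<longrightarrow> Q \<beta> n"
proof -
  obtain D where D: "recursive_pred D" "\<And>\<alpha> n. Q \<alpha> n \<longleftrightarrow> (\<exists>w. lprefix (nfst w) \<alpha> \<and> D (npair w n))"
    using assms(1) by (rule SR_E) blast
  with assms(2) obtain w where w: "lprefix (nfst w) \<alpha>" "D (npair w n)" by blast
  show ?thesis
  proof (intro exI allI impI)
    fix \<beta> assume "\<forall>i<llen (nfst w). \<beta> i = \<alpha> i"
    with w(1) have "lprefix (nfst w) \<beta>" by (simp add: lprefix_def)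
    with w(2) D(2) show "Q \<beta> n" by blast
  qed
qed

text \<open>Balls are clopen, as only finitely many coordinates are compared. The second half is
  what makes \<open>nopiece\<close> semirecursive at the codes of open sets.\<close>

lemma SR_in_ball [sr_intros]:
  assumes "SRT (\<lambda>\<alpha> z. d \<alpha> (nfst (nfst z)) (nsnd (nfst z)) (nsnd z))"
    "SRT (\<lambda>\<alpha> z. x \<alpha> (nfst z) (nsnd z))" "SRT s"
  shows "SR (\<lambda>\<alpha> n. in_ball (d \<alpha> n) (x \<alpha> n) (s \<alpha> n))" "SR (\<lambda>\<alpha> n. \<not> in_ball (d \<alpha> n) (x \<alpha> n) (s \<alpha> n))"
proof -
  have 1: "SRT (\<lambda>\<alpha> z. d \<alpha> (nfst z) (nfst (s \<alpha> (nfst z))) (nsnd z))"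
    using SRT_comp[OF assms(1), of "\<lambda>\<alpha> z. npair (npair (nfst z) (nfst (s \<alpha> (nfst z)))) (nsnd z)"] 
    by (simp add: sr_intros rec_intros SRT_comp[OF assms(3)])
  show "SR (\<lambda>\<alpha> n. in_ball (d \<alpha> n) (x \<alpha> n) (s \<alpha> n))"
    unfolding in_ball_def
    by (intro sr_intros 1 assms(2,3) SRT_comp[OF assms(3)] rec_intros)
  have "SR (\<lambda>\<alpha> n. nfst (nsnd (s \<alpha> n)) = 0 \<or> (\<exists>k\<le>nsnd (nsnd (s \<alpha> n)).
     (k + 1) * nfst (nsnd (s \<alpha> n)) \<le> nsnd (nsnd (s \<alpha> n)) + 1 \<and> d \<alpha> n (nfst (s \<alpha> n)) k \<noteq> x \<alpha> n k))"
    by (intro sr_intros 1 assms(2,3) SRT_comp[OF assms(3)] rec_intros)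
  then show "SR (\<lambda>\<alpha> n. \<not> in_ball (d \<alpha> n) (x \<alpha> n) (s \<alpha> n))"
    by (rule back_subst[of SR]) (auto simp: in_ball_def fun_eq_iff)
qed

text \<open>An index guesses a witness together with an element; a wrong guess returns 0, which
  keeps the enumeration total. This default is harmless in the applications: 0 codes the empty ball,
  and as a code in the sense of \<open>union_set\<close> it denotes the whole space, whose
  complement is empty.\<close>

lemma SR_enumerate:
  assumes "SR (\<lambda>\<alpha> z. R \<alpha> (nfst z) (nsnd z))"
  obtains H where "SRT (\<lambda>\<alpha> z. H \<alpha> (nfst z) (nsnd z))"
    "\<And>\<alpha> n i. H \<alpha> n i = 0 \<or> R \<alpha> n (H \<alpha> n i)" "\<And>\<alpha> n c. R \<alpha> n c \<Longrightarrow> \<exists>i. H \<alpha> n i = c"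
proof -
  obtain D where D: "recursive_pred D"
    "\<And>\<alpha> z. R \<alpha> (nfst z) (nsnd z) \<longleftrightarrow> (\<exists>w. lprefix (nfst w) \<alpha> \<and> D (npair w z))"
    using assms by (rule SR_E) blast
  define H where "H \<alpha> n i = (if lprefix (nfst (nfst i)) \<alpha> \<and> D (npair (nfst i) (npair n (nsnd i))) then nsnd i else 0)"
    for \<alpha> n i
  show ?thesis
  proof
    have "SR (\<lambda>\<alpha> n. lprefix (nfst (nfst (nsnd n))) \<alpha>)" "SR (\<lambda>\<alpha> n. \<not> lprefix (nfst (nfst (nsnd n))) \<alpha>)"
      unfolding lprefix_def not_all not_imp by (intro sr_intros rec_intros)+
    then show "SRT (\<lambda>\<alpha> z. H \<alpha> (nfst z) (nsnd z))"
      unfolding H_def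
      by (intro sr_intros rec_intros recursive_pred_comp[OF D(1)]; simp only: de_Morgan_conj)
        (intro sr_intros rec_intros recursive_pred_comp[OF D(1)])
    show "H \<alpha> n i = 0 \<or> R \<alpha> n (H \<alpha> n i)" for \<alpha> n i
      using D(2)[of \<alpha> "npair n (nsnd i)"] by (auto simp: H_def)
    show "\<exists>i. H \<alpha> n i = c" if "R \<alpha> n c" for \<alpha> n c
    proof -
      from that D(2)[of \<alpha> "npair n c"] obtain w where "lprefix (nfst w) \<alpha>" "D (npair w (npair n c))" by auto
      then show ?thesis by (intro exI[of _ "npair w c"]) (simp add: H_def)
    qed
  qed
qed

definition fpair :: "(nat \<Rightarrow> nat) \<Rightarrow> (nat \<Rightarrow> nat) \<Rightarrow> nat \<Rightarrow> nat" where
  "fpair \<alpha> \<beta> = (\<lambda>i. npair (\<alpha> i) (\<beta> i))"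

lemma fpair_simps [simp]: "nfst (fpair \<alpha> \<beta> i) = \<alpha> i" "nsnd (fpair \<alpha> \<beta> i) = \<beta> i"
  by (simp_all add: fpair_def)

lemma enc_Pr: "enc (Pr x y) = fpair (enc x) (enc y)"
  by (simp add: fpair_def)

declare enc.simps(3) [simp del]
declare enc_Pr [simp]

text \<open>\<open>R\<close> selects balls of radius \<open>1 / (k + 1)\<close>, which fix the
  coordinates 0 to \<open>k\<close>. If a witness reads at most \<open>k + 1\<close> values of its
  oracle, then it works for the centre iff it works for every point of the ball, so \<open>R\<close>
  needs only \<beta> and the centre to recognize a good ball.\<close>

lemma SR_open:
  assumes "type_le_1 X" "SR Q"
  obtains R where "SR (\<lambda>\<beta> z. R \<beta> (nfst z) (nsnd z))"
    "\<And>\<beta> n x. x \<in> pts X \<Longrightarrow> Q (fpair \<beta> (enc x)) n \<longleftrightarrow> (\<exists>a. R \<beta> n a \<and> x \<in> nbhd X a)"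
proof -
  obtain D where D: "recursive_pred D" "\<And>\<alpha> n. Q \<alpha> n \<longleftrightarrow> (\<exists>w. lprefix (nfst w) \<alpha> \<and> D (npair w n))"
    using assms(2) by (rule SR_E) blast
  define R where "R \<beta> n a \<longleftrightarrow> nfst (nsnd a) = 1 \<and> (\<exists>w. D (npair w n) \<and> llen (nfst w) \<le> Suc (nsnd (nsnd a)) \<and>
    lprefix (nfst w) (fpair \<beta> (den X (nfst a))))" for \<beta> n a
  have in_ball: "in_ball (den X) \<alpha> a \<longleftrightarrow> (\<forall>j\<le>nsnd (nsnd a). den X (nfst a) j = \<alpha> j)" if "nfst (nsnd a) = 1" for \<alpha> a
    using that by (auto simp: in_ball_def)
  show ?thesis
  proof
    show "SR (\<lambda>\<beta> z. R \<beta> (nfst z) (nsnd z))"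
      unfolding R_def lprefix_def fpair_def
      by (intro sr_intros SR_comp[OF SR_recursive_pred[OF D(1)]] rec_intros assms)
    fix \<beta> n x assume x: "x \<in> pts X"
    show "Q (fpair \<beta> (enc x)) n \<longleftrightarrow> (\<exists>a. R \<beta> n a \<and> x \<in> nbhd X a)"
    proof
      assume "Q (fpair \<beta> (enc x)) n"
      then obtain w where w: "lprefix (nfst w) (fpair \<beta> (enc x))" "D (npair w n)" using D(2) by blast
      from dns_dense[OF assms(1) x, of "Suc (llen (nfst w))"] obtain i where
        i: "\<forall>j<Suc (llen (nfst w)). den X i j = enc x j" ..
      have "R \<beta> n (npair i (npair 1 (llen (nfst w))))"
        using w i by (auto simp: R_def lprefix_def fpair_def)
      moreover have "x \<in> nbhd X (npair i (npair 1 (llen (nfst w))))"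
        using x i by (simp add: nbhd_iff[OF assms(1)] in_ball less_Suc_eq_le)
      ultimately show "\<exists>a. R \<beta> n a \<and> x \<in> nbhd X a" by blast
    next
      assume "\<exists>a. R \<beta> n a \<and> x \<in> nbhd X a"
      then obtain a w where "nfst (nsnd a) = 1" "D (npair w n)" "llen (nfst w) \<le> Suc (nsnd (nsnd a))"
        "lprefix (nfst w) (fpair \<beta> (den X (nfst a)))" "\<forall>j\<le>nsnd (nsnd a). den X (nfst a) j = enc x j"
        using in_ball by (auto simp: R_def nbhd_iff[OF assms(1)])
      then have "lprefix (nfst w) (fpair \<beta> (enc x))" by (auto simp: lprefix_def fpair_def)
      with \<open>D (npair w n)\<close> show "Q (fpair \<beta> (enc x)) n" using D(2) by blast
    qed
  qed
qed

lemma SR_open_enumerate: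
  assumes "type_le_1 X" "SR Q"
  obtains H where "SRT (\<lambda>\<beta> z. H \<beta> (nfst z) (nsnd z))"
    "\<And>\<beta> n. (\<Union>i. nbhd X (H \<beta> n i)) = {x \<in> pts X. Q (fpair \<beta> (enc x)) n}"
proof -
  obtain R where R: "SR (\<lambda>\<beta> z. R \<beta> (nfst z) (nsnd z))"
    "\<And>\<beta> n x. x \<in> pts X \<Longrightarrow> Q (fpair \<beta> (enc x)) n \<longleftrightarrow> (\<exists>a. R \<beta> n a \<and> x \<in> nbhd X a)"
    using SR_open[OF assms] by blast
  obtain H where H: "SRT (\<lambda>\<beta> z. H \<beta> (nfst z) (nsnd z))"
    "\<And>\<beta> n i. H \<beta> n i = 0 \<or> R \<beta> n (H \<beta> n i)" "\<And>\<beta> n c. R \<beta> n c \<Longrightarrow> \<exists>i. H \<beta> n i = c"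
    using SR_enumerate[OF R(1)] by blast
  have 0: "nbhd X 0 = {}" by (intro nbhd_0 Metric_space_type_le_1 assms)
  have mem: "x \<in> (\<Union>i. nbhd X (H \<beta> n i)) \<longleftrightarrow> (\<exists>a. R \<beta> n a \<and> x \<in> nbhd X a)" for \<beta> n x
  proof
    assume "x \<in> (\<Union>i. nbhd X (H \<beta> n i))"
    then obtain i where i: "x \<in> nbhd X (H \<beta> n i)" by blast
    with 0 H(2)[of \<beta> n i] have "R \<beta> n (H \<beta> n i)" by auto
    with i show "\<exists>a. R \<beta> n a \<and> x \<in> nbhd X a" by blast
  next
    assume "\<exists>a. R \<beta> n a \<and> x \<in> nbhd X a"
    then obtain a where a: "R \<beta> n a" "x \<in> nbhd X a" by blast
    from H(3)[OF a(1)] obtain i where "H \<beta> n i = a" ..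
    with a(2) show "x \<in> (\<Union>i. nbhd X (H \<beta> n i))" by blast
  qed
  have "(\<Union>i. nbhd X (H \<beta> n i)) = {x \<in> pts X. Q (fpair \<beta> (enc x)) n}" for \<beta> n
  proof (rule set_eqI)
    fix x
    show "x \<in> (\<Union>i. nbhd X (H \<beta> n i)) \<longleftrightarrow> x \<in> {x \<in> pts X. Q (fpair \<beta> (enc x)) n}"
      unfolding mem using R(2)[of x \<beta> n] by (auto simp: nbhd_iff[OF assms(1)])
  qed
  with H(1) that show ?thesis by blast
qed

text \<open>Unbounded search over pairs of a witness and a value, with the zero sequence as oracle.
  This leads from semirecursive graphs back to minimalization in \<open>recfn\<close>.\<close>

lemma recursive_seq_SRT_const:
  assumes "SRT (\<lambda>\<alpha> n. f n)" shows "recursive_seq f"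
proof -
  obtain D where D: "recursive_pred D" "\<And>\<alpha> z. f (nfst z) = nsnd z \<longleftrightarrow> (\<exists>w. lprefix (nfst w) \<alpha> \<and> D (npair w z))"
    using assms[unfolded SRT_def] by (rule SR_E) blast
  define g where "g z w = (1::nat) - of_bool (lprefix (nfst (nfst w)) (\<lambda>_. 0) \<and> D (npair (nfst w) (npair z (nsnd w))))" for z w
  have g0: "g z w = 0 \<longleftrightarrow> lprefix (nfst (nfst w)) (\<lambda>_. 0) \<and> D (npair (nfst w) (npair z (nsnd w)))" for z w
    by (simp add: g_def)
  have ex: "\<exists>w. g z w = 0" for z
  proof -
    obtain w where "lprefix (nfst w) (\<lambda>_. 0)" "D (npair w (npair z (f z)))"
      using D(2)[of "npair z (f z)" "\<lambda>_. 0"] by auto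
    then show ?thesis unfolding g0 by (intro exI[of _ "npair w (f z)"]) simp
  qed
  have "recursive_pred (\<lambda>w. lprefix (nfst (nfst (nsnd w))) (\<lambda>_. 0) \<and> D (npair (nfst (nsnd w)) (npair (nfst w) (nsnd (nsnd w)))))"
    unfolding lprefix_def by (intro rec_intros recursive_pred_comp[OF D(1)])
  then have "recursive_seq (\<lambda>w. g (nfst w) (nsnd w))"
    unfolding g_def by (intro rec_intros) (simp add: recursive_pred_def)
  from recursive_seq_Least[OF this ex] have "recursive_seq (\<lambda>z. nsnd (LEAST w. g z w = 0))"
    by (rule rec_intros)
  moreover have "nsnd (LEAST w. g z w = 0) = f z" for z
  proof -
    have "g z (LEAST w. g z w = 0) = 0" using ex by (rule LeastI_ex)
    then have "f (nfst (npair z (nsnd (LEAST w. g z w = 0)))) = nsnd (npair z (nsnd (LEAST w. g z w = 0)))"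
      unfolding D(2)[of _ "\<lambda>_. 0"] g0[of z "LEAST w. g z w = 0"] by blast
    then show ?thesis by simp
  qed
  ultimately show ?thesis by simp
qed

lemma Sigma01_I:
  assumes "type_le_1 X" "SR Q" shows "Sigma01 X {x \<in> pts X. Q (enc x) n}"
proof -
  have "SR (\<lambda>\<alpha> n. Q (\<lambda>i. nsnd (\<alpha> i)) n)"
    by (intro SR_subst[OF assms(2)] sr_intros rec_intros)
  then obtain H where H: "SRT (\<lambda>\<beta> z. H \<beta> (nfst z) (nsnd z))"
    "\<And>\<beta> n. (\<Union>i. nbhd X (H \<beta> n i)) = {x \<in> pts X. Q (\<lambda>i. nsnd (fpair \<beta> (enc x) i)) n}"
    using SR_open_enumerate[OF assms(1)] by blast
  have "SRT (\<lambda>\<alpha> i. H (\<lambda>_. 0) n i)"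
    using SRT_subst[OF H(1), of "\<lambda>\<alpha> i j. 0" "\<lambda>\<alpha> i. npair n i"] by (simp add: sr_intros rec_intros)
  then have "recursive_seq (H (\<lambda>_. 0) n)" by (rule recursive_seq_SRT_const)
  with H(2)[of "\<lambda>_. 0" n] show ?thesis unfolding Sigma01_def by fastforce
qed

lemma Sigma01_E:
  assumes "type_le_1 X" "Sigma01 X P"
  obtains Q where "SR (\<lambda>\<alpha> n. Q \<alpha>)" "\<And>x. x \<in> P \<longleftrightarrow> x \<in> pts X \<and> Q (enc x)"
proof -
  obtain \<epsilon> where \<epsilon>: "recursive_seq \<epsilon>" "P = (\<Union>i. nbhd X (\<epsilon> i))" using assms(2) unfolding Sigma01_def by blast
  show ?thesis
  proof
    show "SR (\<lambda>\<alpha> n. \<exists>i. in_ball (den X) \<alpha> (\<epsilon> i))"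
      by (intro sr_intros rec_intros assms(1) recursive_seq_comp[OF \<epsilon>(1)])
    show "x \<in> P \<longleftrightarrow> x \<in> pts X \<and> (\<exists>i. in_ball (den X) (enc x) (\<epsilon> i))" for x
      by (auto simp: \<epsilon>(2) nbhd_iff[OF assms(1)])
  qed
qed

section \<open>Topology and Borel classes\<close>

lemma continuous_map_top_of:
  assumes X: "type_le_1 X" and Y: "type_le_1 Y" and S: "S \<subseteq> pts X" "\<And>x. x \<in> S \<Longrightarrow> f x \<in> pts Y"
    and f: "\<And>x t. x \<in> S \<Longrightarrow> \<exists>t'. \<forall>y\<in>S. (\<forall>n<t'. enc y n = enc x n) \<longrightarrow> (\<forall>n<t. enc (f y) n = enc (f x) n)"
  shows "continuous_map (subtopology (top_of X) S) (top_of Y) f"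
proof -
  have top: "topspace (subtopology (top_of X) S) = S" using S(1) X by auto
  have "openin (subtopology (top_of X) S) {x \<in> S. f x \<in> U}" if U: "openin (top_of Y) U" for U
  proof (subst openin_subopen, intro ballI)
    fix x assume x: "x \<in> {x \<in> S. f x \<in> U}"
    then obtain t where t: "\<forall>y\<in>pts Y. (\<forall>n<t. enc y n = enc (f x) n) \<longrightarrow> y \<in> U"
      using U unfolding openin_top_of[OF Y] by blast
    from f[of x t] x obtain t' where
      t': "\<forall>y\<in>S. (\<forall>n<t'. enc y n = enc x n) \<longrightarrow> (\<forall>n<t. enc (f y) n = enc (f x) n)" by auto
    let ?V = "{y \<in> pts X. \<forall>n<t'. enc y n = enc x n}"
    have "openin (top_of X) ?V" unfolding openin_top_of[OF X] by (auto intro!: exI[of _ t'])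
    then have "openin (subtopology (top_of X) S) (S \<inter> ?V)" by (rule openin_subtopology_Int2)
    moreover have "x \<in> S \<inter> ?V" using x S(1) by auto
    moreover have "S \<inter> ?V \<subseteq> {x \<in> S. f x \<in> U}" using t t' S(2) by blast
    ultimately show "\<exists>V. openin (subtopology (top_of X) S) V \<and> x \<in> V \<and> V \<subseteq> {x \<in> S. f x \<in> U}" by blast
  qed
  then show ?thesis unfolding continuous_map_def top using S(2) Y by auto
qed

lemma nbhd_base:
  assumes X: "type_le_1 X" and U: "openin (top_of X) U" "x \<in> U"
  shows "\<exists>k. x \<in> nbhd X k \<and> nbhd X k \<subseteq> U"
proof -
  obtain t where t: "\<forall>y\<in>pts X. (\<forall>n<t. enc y n = enc x n) \<longrightarrow> y \<in> U" and x: "x \<in> pts X"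
    using U unfolding openin_top_of[OF X] by blast
  obtain i where i: "\<forall>n<Suc t. den X i n = enc x n" using dns_dense[OF X x] by blast
  have ball: "y \<in> nbhd X (npair i (npair 1 t)) \<longleftrightarrow> y \<in> pts X \<and> (\<forall>n\<le>t. den X i n = enc y n)" for y
    by (auto simp: nbhd_iff[OF X] in_ball_def)
  show ?thesis
  proof (intro exI conjI subsetI)
    show "x \<in> nbhd X (npair i (npair 1 t))" unfolding ball using x i by simp
    fix y assume "y \<in> nbhd X (npair i (npair 1 t))"
    then have "y \<in> pts X" "\<forall>n<t. enc y n = enc x n" unfolding ball using i by simp_all
    with t show "y \<in> U" by blast
  qed
qed

section \<open>Countable ordinals and the passage to the predecessor\<close>

declare fin_ord.simps [simp del]

lemma osuc_le_iff: "osuc \<xi> \<le> \<eta> \<longleftrightarrow> \<xi> < \<eta>"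
proof
  show "osuc \<xi> \<le> \<eta> \<Longrightarrow> \<xi> < \<eta>" using osuc_greater[of \<xi>] by order
  show "\<xi> < \<eta> \<Longrightarrow> osuc \<xi> \<le> \<eta>" unfolding osuc_def by (rule Least_le)
qed

lemma less_osuc_iff: "\<eta> < osuc \<xi> \<longleftrightarrow> \<eta> \<le> \<xi>"
  using osuc_le_iff[of \<xi> \<eta>] by (auto simp: not_le[symmetric])

lemma fin_ord_Suc: "fin_ord 2 = osuc (fin_ord 1)" "fin_ord 3 = osuc (fin_ord 2)"
  by (simp_all add: numeral_2_eq_2 numeral_3_eq_3 fin_ord.simps)

lemma fin_ord_less: "fin_ord 1 < fin_ord 2" "fin_ord 2 < fin_ord 3"
  by (simp_all add: fin_ord_Suc osuc_greater)

lemma opred_osuc: "opred (osuc \<xi>) = \<xi>"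
proof -
  have "\<eta> = \<xi>" if "osuc \<xi> = osuc \<eta>" for \<eta>
    using that less_osuc_iff by (metis order_antisym order_refl)
  then show ?thesis unfolding opred_def by (auto intro!: the_equality)
qed

text \<open>One of the two strict inequalities absorbs the passage to the predecessor. They come
  from the two steps between the root and a node at distance 2.\<close>

lemma ominus_less:
  assumes "fin_ord 1 \<le> \<zeta>" "\<zeta> < \<eta>" "\<eta> < \<xi>" shows "\<zeta> < ominus \<xi>"
proof (cases "fin_ord 3 \<le> \<xi> \<and> (\<exists>\<iota>. \<xi> = osuc \<iota>)")
  case True
  then obtain \<iota> where "\<xi> = osuc \<iota>" by blast
  with assms True show ?thesis by (simp add: ominus_def opred_osuc less_osuc_iff)
next
  case False
  with assms show ?thesis by (auto simp: ominus_def opred_def)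
qed

lemma ominus_ge_2: "fin_ord 2 \<le> \<xi> \<Longrightarrow> fin_ord 2 \<le> ominus \<xi>"
proof (cases "fin_ord 3 \<le> \<xi> \<and> (\<exists>\<iota>. \<xi> = osuc \<iota>)")
  case True
  then obtain \<iota> where "\<xi> = osuc \<iota>" by blast
  with True show ?thesis by (simp add: ominus_def opred_osuc fin_ord_Suc(2) osuc_le_iff less_osuc_iff)
next
  case False
  then show "fin_ord 2 \<le> \<xi> \<Longrightarrow> ?thesis" by (auto simp: ominus_def opred_def)
qed

lemma ominus_1: "ominus (fin_ord 1) = fin_ord 1"
  using fin_ord_less by (auto simp: ominus_def)

lemma Sigma0_1_iff: "Sigma0 T (fin_ord 1) U \<longleftrightarrow> openin T U"
  by (subst Sigma0.simps) (use fin_ord_1_not_ge_2 in blast)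

lemma Sigma0_iff:
  assumes "fin_ord 2 \<le> \<xi>"
  shows "Sigma0 T \<xi> U \<longleftrightarrow> (\<exists>A. U = (\<Union>n. topspace T - A n) \<and>
    (\<forall>n::nat. \<exists>\<eta>\<ge>fin_ord 1. \<eta> < \<xi> \<and> Sigma0 T \<eta> (A n)))"
proof -
  have "\<xi> \<noteq> fin_ord 1" using assms fin_ord_1_not_ge_2 by blast
  with assms show ?thesis by (subst Sigma0.simps) auto
qed

section \<open>Preimages, unions and measurability in the Borel hierarchy\<close>

lemma Sigma0_vimage:
  assumes f: "continuous_map T T' f" and "Sigma0 T' \<xi> A"
  shows "Sigma0 T \<xi> {x \<in> topspace T. f x \<in> A}"
  using assms(2)
proof (induction rule: Sigma0.induct)
  case (Sigma0_open U)
  then show ?case using f by (intro Sigma0.Sigma0_open openin_continuous_map_preimage[OF f])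
next
  case (Sigma0_Union \<xi> A)
  have "{x \<in> topspace T. f x \<in> (\<Union>n. topspace T' - A n)} = (\<Union>n. topspace T - {x \<in> topspace T. f x \<in> A n})"
    using f by (auto simp: continuous_map_def Pi_iff)
  moreover have "Sigma0 T \<xi> (\<Union>n. topspace T - {x \<in> topspace T. f x \<in> A n})"
    using Sigma0_Union by (intro Sigma0.Sigma0_Union) auto
  ultimately show ?case by simp
qed

lemma Sigma0_countable_Union:
  assumes "\<And>n::nat. Sigma0 T \<xi> (A n)" shows "Sigma0 T \<xi> (\<Union>n. A n)"
proof (cases "fin_ord 2 \<le> \<xi>")
  case False
  have "\<xi> = fin_ord 1 \<and> openin T (A n)" for n
    using assms[of n] by cases (use False in auto)
  then have "\<xi> = fin_ord 1" "openin T (\<Union>n. A n)" by auto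
  then show ?thesis by (simp only: Sigma0_1_iff)
next
  case True
  have "\<exists>B. A n = (\<Union>m. topspace T - B m) \<and> (\<forall>m::nat. \<exists>\<eta>. fin_ord 1 \<le> \<eta> \<and> \<eta> < \<xi> \<and> Sigma0 T \<eta> (B m))" for n
    using assms[of n] unfolding Sigma0_iff[OF True] .
  then obtain B where B: "\<And>n. A n = (\<Union>m. topspace T - B n m)"
    "\<And>n (m::nat). \<exists>\<eta>. fin_ord 1 \<le> \<eta> \<and> \<eta> < \<xi> \<and> Sigma0 T \<eta> (B n m)" by metis
  have "(\<Union>n. A n) = (\<Union>k. topspace T - B (nfst k) (nsnd k))"
  proof (intro equalityI subsetI)
    fix x assume "x \<in> (\<Union>n. A n)"
    then obtain n m where "x \<in> topspace T - B n m" unfolding B(1) by blast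
    then show "x \<in> (\<Union>k. topspace T - B (nfst k) (nsnd k))"
      by (intro UN_I[of "npair n m"]) simp_all
  qed (use B(1) in blast)
  with Sigma0_Union[OF True, of T "\<lambda>k. B (nfst k) (nsnd k)"] B(2) show ?thesis by simp
qed

text \<open>The maximum of finitely many ordinals below \<eta> is still below \<eta>, even if \<eta>
  is a limit. The lower bound \<iota> is included because ranks of codes start at 1.\<close>

lemma finite_bound_ord:
  fixes \<eta> :: omega1
  assumes "\<forall>i<n::nat. \<exists>\<zeta><\<eta>. P i \<zeta>" "\<iota> < \<eta>"
  shows "\<exists>\<zeta><\<eta>. \<iota> \<le> \<zeta> \<and> (\<forall>i<n. \<exists>\<zeta>'\<le>\<zeta>. P i \<zeta>')"
  using assms(1)
proof (induction n)
  case 0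
  then show ?case using assms(2) by auto
next
  case (Suc n)
  then obtain \<zeta> where \<zeta>: "\<zeta> < \<eta>" "\<iota> \<le> \<zeta>" "\<forall>i<n. \<exists>\<zeta>'\<le>\<zeta>. P i \<zeta>'" by auto
  obtain \<zeta>' where \<zeta>': "\<zeta>' < \<eta>" "P n \<zeta>'" using Suc.prems by auto
  have "\<exists>\<zeta>''\<le>max \<zeta> \<zeta>'. P i \<zeta>''" if "i < Suc n" for i
    using that \<zeta>(3) \<zeta>'(2) by (cases "i = n") (auto simp: le_max_iff_disj less_Suc_eq)
  with \<zeta> \<zeta>' show ?case by (intro exI[of _ "max \<zeta> \<zeta>'"]) (auto simp: le_max_iff_disj)
qed

text \<open>An open set is the union of the balls it contains, and the preimage of the
  \<open>k\<close>-th ball is the preimage of \<open>P\<close> under the continuous map from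
  \<open>x\<close> to \<open>(x, k)\<close>. Balls not contained in \<open>U\<close> are replaced by
  ball 0, which is empty, to get a union over all numbers.\<close>

lemma Sigma0_measurable_onI:
  assumes X: "type_le_1 X" and Y: "type_le_1 Y" and B: "B \<subseteq> pts X" "\<And>x. x \<in> B \<Longrightarrow> g x \<in> pts Y"
    and P: "Sigma0 (top_of (X \<otimes> Omega)) \<zeta> P" "\<And>x k. x \<in> B \<Longrightarrow> g x \<in> nbhd Y k \<longleftrightarrow> Pr x (Nat k) \<in> P"
  shows "Sigma0_measurable_on (top_of X) (top_of Y) \<zeta> B g"
  unfolding Sigma0_measurable_on_def
proof (intro conjI allI impI)
  show "g ` B \<subseteq> topspace (top_of Y)" using B(2) Y by auto
  fix U assume U: "openin (top_of Y) U"
  define A where "A k = {x \<in> B. Pr x (Nat (if nbhd Y k \<subseteq> U then k else 0)) \<in> P}" for k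
  have XO: "type_le_1 (X \<otimes> Omega)" using X by (intro type_le_1.intros)
  have "topspace (subtopology (top_of X) B) = B" using B(1) X by auto
  moreover have "continuous_map (subtopology (top_of X) B) (top_of (X \<otimes> Omega)) (\<lambda>x. Pr x (Nat k))" for k
    by (rule continuous_map_top_of[OF X XO B(1)]) (use B(1) in \<open>auto simp: fpair_def\<close>)
  ultimately have "Sigma0 (subtopology (top_of X) B) \<zeta> (A k)" for k
    using Sigma0_vimage[OF _ P(1)] unfolding A_def by metis
  then have "Sigma0 (subtopology (top_of X) B) \<zeta> (\<Union>k. A k)" by (rule Sigma0_countable_Union)
  moreover have "(\<Union>k. A k) = {x \<in> B. g x \<in> U}"
  proof (intro equalityI subsetI)
    fix x assume "x \<in> (\<Union>k. A k)"
    then obtain k where k: "x \<in> A k" by blast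
    then have "x \<in> B" "g x \<in> nbhd Y (if nbhd Y k \<subseteq> U then k else 0)" unfolding A_def using P(2) by auto
    moreover have "nbhd Y 0 = {}" by (intro nbhd_0 Metric_space_type_le_1 Y)
    ultimately show "x \<in> {x \<in> B. g x \<in> U}" by (auto split: if_splits)
  next
    fix x assume x: "x \<in> {x \<in> B. g x \<in> U}"
    then obtain k where "g x \<in> nbhd Y k" "nbhd Y k \<subseteq> U" using nbhd_base[OF Y U] by blast
    with x P(2) have "x \<in> A k" by (simp add: A_def)
    then show "x \<in> (\<Union>k. A k)" by blast
  qed
  ultimately show "Sigma0 (subtopology (top_of X) B) \<zeta> {x \<in> B. g x \<in> U}" by simp
qed

lemma Sigma0_measurable_on_1:
  assumes "Sigma0_measurable_on T T' (fin_ord 1) B g" "B \<subseteq> topspace T"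
  shows "continuous_map (subtopology T B) T' g"
  using assms unfolding Sigma0_measurable_on_def Sigma0_1_iff continuous_map_def
  by (auto simp: Int_absorb1)

section \<open>The recursion theorem and iterated subcodes\<close>

lemma Seq_in_nbhd_Cantor:
  "Seq x \<in> nbhd Cantor k \<longleftrightarrow> (\<forall>n. x n \<le> 1) \<and> in_ball (den Cantor) x k"
  by (simp add: nbhd_iff type_le_1.intros)

abbreviation CO :: pspace where "CO \<equiv> Cantor \<otimes> Omega"

lemma type_le_1_CO: "type_le_1 CO"
  by (intro type_le_1.intros)

lemma shift_case_nat [simp]: "shift (case_nat a f) = f"
  by (simp add: shift_def fun_eq_iff)

lemma nbhd_Baire_cylinder:
  "Seq \<delta> \<in> nbhd Baire (npair c (npair 1 n)) \<longleftrightarrow> (\<forall>j\<le>n. lnth c j = \<delta> j)"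
  by (auto simp: nbhd_iff[OF type_le_1.intros(2)] in_ball_def)

text \<open>A ball of radius \<open>1 / (n + 1)\<close> fixes the value at \<open>n\<close>. In this
  way a function that is recursive in the sense of neighbourhoods acquires a semirecursive
  graph.\<close>

lemma graph_from_nbhds:
  assumes "\<And>k. Seq \<delta> \<in> nbhd Baire k \<longleftrightarrow> A k"
  shows "\<delta> n = v \<longleftrightarrow> (\<exists>c. lnth c n = v \<and> A (npair c (npair 1 n)))"
  unfolding assms[symmetric] nbhd_Baire_cylinder
  by (auto intro!: exI[of _ "lcode \<delta> (Suc n)"])

lemma nbhds_separate:
  assumes "type_le_1 X" "x \<in> pts X" "y \<in> pts X" "\<And>k. x \<in> nbhd X k \<longleftrightarrow> y \<in> nbhd X k"
  shows "x = y"
proof (rule enc_inj[OF assms(1-3)], rule ext)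
  fix n
  from dns_dense[OF assms(1,2), of "Suc n"] obtain i where i: "\<forall>j<Suc n. den X i j = enc x j" ..
  then have "x \<in> nbhd X (npair i (npair 1 n))"
    using assms(2) by (simp add: nbhd_iff[OF assms(1)] in_ball_def)
  with assms(4) have "y \<in> nbhd X (npair i (npair 1 n))" by blast
  then have "den X i n = enc y n" by (simp add: nbhd_iff[OF assms(1)] in_ball_def)
  with i show "enc x n = enc y n" by simp
qed

lemma pfun_of_eqI:
  assumes "type_le_1 Y" "x \<in> pts X" "y \<in> pts Y"
    "\<And>k. y \<in> nbhd Y k \<longleftrightarrow> Pr (Seq \<gamma>) (Pr x (Nat k)) \<in> G (X \<otimes> Omega)"
  shows "pfun_of G X Y \<gamma> x = Some y"
proof -
  let ?Q = "\<lambda>y. y \<in> pts Y \<and> (\<forall>k. y \<in> nbhd Y k \<longleftrightarrow> Pr (Seq \<gamma>) (Pr x (Nat k)) \<in> G (X \<otimes> Omega))"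
  have y: "?Q y" using assms(3,4) by simp
  have uniq: "y' = y" if "?Q y'" for y'
    by (rule nbhds_separate[OF assms(1) conjunct1[OF that] assms(3)]) (simp only: that assms(4))
  from y uniq have "\<exists>!y. ?Q y" by (rule ex1I)
  moreover from y uniq have "(THE y. ?Q y) = y" by (rule the_equality)
  ultimately show ?thesis unfolding pfun_of_def Let_def using assms(2) by simp
qed

lemma pfun_of_eqD:
  assumes "pfun_of G X Y \<gamma> x = Some y"
  shows "y \<in> pts Y" "y \<in> nbhd Y k \<longleftrightarrow> Pr (Seq \<gamma>) (Pr x (Nat k)) \<in> G (X \<otimes> Omega)"
proof -
  let ?Q = "\<lambda>y. y \<in> pts Y \<and> (\<forall>k. y \<in> nbhd Y k \<longleftrightarrow> Pr (Seq \<gamma>) (Pr x (Nat k)) \<in> G (X \<otimes> Omega))"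
  from assms have "\<exists>!y. ?Q y" "(THE y. ?Q y) = y"
    unfolding pfun_of_def Let_def by (simp_all split: if_splits)
  with theI'[of ?Q] have "?Q y" by simp
  then show "y \<in> pts Y" "y \<in> nbhd Y k \<longleftrightarrow> Pr (Seq \<gamma>) (Pr x (Nat k)) \<in> G (X \<otimes> Omega)" by auto
qed

text \<open>Nodes are coded by natural numbers: 0 is the root, and the \<^term>\<open>j\<close>-th child of the node
  \<^term>\<open>s\<close> is \<^term>\<open>Suc (npair s j)\<close>.\<close>

abbreviation child :: "nat \<Rightarrow> nat \<Rightarrow> nat" where "child s j \<equiv> Suc (npair s j)"
abbreviation parent :: "nat \<Rightarrow> nat" where "parent s \<equiv> nfst (s - 1)"

section \<open>Good parametrizations, substitution of parameters and the recursion theorem\<close>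

locale parametrization =
  fixes G :: "pspace \<Rightarrow> point set"
  assumes good: "good_parametrization G"
begin

lemma SR_G:
  assumes "type_le_1 X"
  obtains Q where "SR (\<lambda>\<alpha> n. Q \<alpha>)" "\<And>\<gamma> x. x \<in> pts X \<Longrightarrow> Pr (Seq \<gamma>) x \<in> G X \<longleftrightarrow> Q (fpair \<gamma> (enc x))"
proof -
  have "Sigma01 (Baire \<otimes> X) (G X)"
    using good rec_presented_type_le_1[OF assms] unfolding good_parametrization_def by blast
  then obtain Q where Q: "SR (\<lambda>\<alpha> n. Q \<alpha>)" "\<And>x. x \<in> G X \<longleftrightarrow> x \<in> pts (Baire \<otimes> X) \<and> Q (enc x)"
    using Sigma01_E type_le_1.intros assms by metis
  from Q(2) have "Pr (Seq \<gamma>) x \<in> G X \<longleftrightarrow> Q (fpair \<gamma> (enc x))" if "x \<in> pts X" for \<gamma> x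
    using that by simp
  with Q(1) that show ?thesis by blast
qed

lemma G_section:
  assumes "type_le_1 X" "SR Q"
  obtains \<epsilon> where "recursive_seq \<epsilon>" "\<And>x. x \<in> pts X \<Longrightarrow> Pr (Seq \<epsilon>) x \<in> G X \<longleftrightarrow> Q (enc x) n"
proof -
  have "\<exists>\<epsilon>. recursive_seq \<epsilon> \<and> {x \<in> pts X. Q (enc x) n} = section_of G X \<epsilon>"
    using good rec_presented_type_le_1[OF assms(1)] Sigma01_I[OF assms, of n]
    unfolding good_parametrization_def by auto
  with that show ?thesis unfolding section_of_def by blast
qed

definition is_smn :: "pspace \<Rightarrow> ((nat \<Rightarrow> nat) \<Rightarrow> (nat \<Rightarrow> nat) \<Rightarrow> nat \<Rightarrow> nat) \<Rightarrow> bool" where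
  "is_smn Y S \<longleftrightarrow> SRT (\<lambda>\<alpha>. S (\<lambda>i. nfst (\<alpha> i)) (\<lambda>i. nsnd (\<alpha> i))) \<and>
    (\<forall>\<gamma> \<beta>. \<forall>y\<in>pts Y. Pr (Seq \<gamma>) (Pr (Seq \<beta>) y) \<in> G (Baire \<otimes> Y) \<longleftrightarrow> Pr (Seq (S \<gamma> \<beta>)) y \<in> G Y)"

lemma ex_smn:
  assumes "type_le_1 Y" shows "\<exists>S. is_smn Y S"
proof -
  have B: "type_le_1 Baire" and BB: "type_le_1 ((Baire \<otimes> Baire) \<otimes> Omega)"
    by (intro type_le_1.intros)+
  note smn = conjunct2[OF good[unfolded good_parametrization_def], THEN spec[of _ Baire], THEN spec[of _ Y],
      THEN mp, OF conjI[OF B rec_presented_type_le_1[OF assms]]]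
  from smn obtain T where "partial_fun (Baire \<otimes> Baire) Baire T \<and> dom T = pts (Baire \<otimes> Baire) \<and>
    recursive_on (Baire \<otimes> Baire) Baire T (dom T) \<and>
    (\<forall>\<gamma>. \<forall>x\<in>pts Baire. \<forall>y\<in>pts Y.
      Pr (Seq \<gamma>) (Pr x y) \<in> G (Baire \<otimes> Y) \<longleftrightarrow> Pr (the (T (Pr (Seq \<gamma>) x))) y \<in> G Y)" ..
  then have T: "partial_fun (Baire \<otimes> Baire) Baire T" "dom T = pts (Baire \<otimes> Baire)"
    "recursive_on (Baire \<otimes> Baire) Baire T (dom T)"
    "\<And>\<gamma> x y. x \<in> pts Baire \<Longrightarrow> y \<in> pts Y \<Longrightarrow>
      Pr (Seq \<gamma>) (Pr x y) \<in> G (Baire \<otimes> Y) \<longleftrightarrow> Pr (the (T (Pr (Seq \<gamma>) x))) y \<in> G Y"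
    by blast+
  define S where "S \<gamma> \<beta> = the_seq (the (T (Pr (Seq \<gamma>) (Seq \<beta>))))" for \<gamma> \<beta>
  have TS: "T (Pr (Seq \<gamma>) (Seq \<beta>)) = Some (Seq (S \<gamma> \<beta>))" for \<gamma> \<beta>
  proof -
    have "Pr (Seq \<gamma>) (Seq \<beta>) \<in> dom T" using T(2) by simp
    then obtain y where y: "T (Pr (Seq \<gamma>) (Seq \<beta>)) = Some y" by blast
    with T(1) have "y \<in> pts Baire" by (auto simp: partial_fun_def ran_def)
    with y show ?thesis by (auto simp: S_def pts_Baire)
  qed
  obtain P where P: "Sigma01 ((Baire \<otimes> Baire) \<otimes> Omega) P" "computes (Baire \<otimes> Baire) Baire P T (dom T)"
    using T(3) unfolding recursive_on_def by blast
  obtain Q where Q: "SR (\<lambda>\<alpha> n. Q \<alpha>)" "\<And>x. x \<in> P \<longleftrightarrow> x \<in> pts ((Baire \<otimes> Baire) \<otimes> Omega) \<and> Q (enc x)"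
    using Sigma01_E[OF BB P(1)] by blast
  have "Seq (S \<gamma> \<beta>) \<in> nbhd Baire k \<longleftrightarrow> Q (fpair (fpair \<gamma> \<beta>) (\<lambda>_. k))" for \<gamma> \<beta> k
  proof -
    have dom: "Pr (Seq \<gamma>) (Seq \<beta>) \<in> dom T" using T(2) by simp
    have "\<forall>x\<in>dom T. \<forall>k. the (T x) \<in> nbhd Baire k \<longleftrightarrow> Pr x (Nat k) \<in> P"
      using P(2) unfolding computes_def by (elim conjE)
    from this[rule_format, OF dom, of k] have "Seq (S \<gamma> \<beta>) \<in> nbhd Baire k \<longleftrightarrow> Pr (Pr (Seq \<gamma>) (Seq \<beta>)) (Nat k) \<in> P"
      by (simp add: TS)
    then show ?thesis unfolding Q(2) by simp
  qed
  note graph = graph_from_nbhds[OF this]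
  have "SR (\<lambda>\<alpha> z. \<exists>c. lnth c (nfst z) = nsnd z \<and>
    Q (fpair (fpair (\<lambda>i. nfst (\<alpha> i)) (\<lambda>i. nsnd (\<alpha> i))) (\<lambda>_. npair c (npair 1 (nfst z)))))"
    unfolding fpair_def by (intro sr_intros rec_intros SR_subst_oracle[OF Q(1)])
  then have "SRT (\<lambda>\<alpha>. S (\<lambda>i. nfst (\<alpha> i)) (\<lambda>i. nsnd (\<alpha> i)))"
    unfolding SRT_def graph .
  moreover have "Pr (Seq \<gamma>) (Pr (Seq \<beta>) y) \<in> G (Baire \<otimes> Y) \<longleftrightarrow> Pr (Seq (S \<gamma> \<beta>)) y \<in> G Y"
    if "y \<in> pts Y" for \<gamma> \<beta> y
    using T(4)[of "Seq \<beta>" y \<gamma>] that TS by simp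
  ultimately show ?thesis unfolding is_smn_def by blast
qed

definition smn :: "(nat \<Rightarrow> nat) \<Rightarrow> (nat \<Rightarrow> nat) \<Rightarrow> nat \<Rightarrow> nat" where
  "smn = (SOME S. is_smn (Omega \<otimes> Omega) S)"

lemma is_smn_smn: "is_smn (Omega \<otimes> Omega) smn"
  unfolding smn_def by (rule someI_ex[OF ex_smn]) (intro type_le_1.intros)

lemma SRT_is_smn:
  assumes "is_smn Y S" "SRT (\<lambda>\<alpha> z. a \<alpha> (nfst z) (nsnd z))" "SRT (\<lambda>\<alpha> z. b \<alpha> (nfst z) (nsnd z))" "SRT t"
  shows "SRT (\<lambda>\<alpha> n. S (a \<alpha> n) (b \<alpha> n) (t \<alpha> n))"
proof -
  have "SRT (\<lambda>\<alpha>. S (\<lambda>i. nfst (\<alpha> i)) (\<lambda>i. nsnd (\<alpha> i)))" using assms(1) unfolding is_smn_def by blast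
  from SRT_subst[OF this, of "\<lambda>\<alpha> n i. npair (a \<alpha> n i) (b \<alpha> n i)" t] show ?thesis
    using assms(2-4) by (simp add: sr_intros)
qed

lemmas SRT_smn [sr_intros] = SRT_is_smn[OF is_smn_smn]

text \<open>Where \<open>{\<gamma>}(i)\<close> is defined, this says that it belongs to the
  \<open>k\<close>-th ball of Baire space; hence \<open>univ (shift \<gamma>)\<close> governs the
  subcodes of \<gamma>.\<close>

definition univ :: "(nat \<Rightarrow> nat) \<Rightarrow> nat \<Rightarrow> nat \<Rightarrow> bool" where
  "univ \<gamma> i k \<longleftrightarrow> Pr (Seq \<gamma>) (Pr (Nat i) (Nat k)) \<in> G (Omega \<otimes> Omega)"

lemma SR_univ [sr_intros]:
  assumes "SRT (\<lambda>\<alpha> z. g \<alpha> (nfst z) (nsnd z))" "SRT t" "SRT u"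
  shows "SR (\<lambda>\<alpha> n. univ (g \<alpha> n) (t \<alpha> n) (u \<alpha> n))"
proof -
  have "type_le_1 (Omega \<otimes> Omega)" by (intro type_le_1.intros)
  then obtain Q where Q: "SR (\<lambda>\<alpha> n. Q \<alpha>)"
    "\<And>\<gamma> x. x \<in> pts (Omega \<otimes> Omega) \<Longrightarrow> Pr (Seq \<gamma>) x \<in> G (Omega \<otimes> Omega) \<longleftrightarrow> Q (fpair \<gamma> (enc x))"
    using SR_G by metis
  have "SR (\<lambda>\<alpha> n. Q (fpair (g \<alpha> n) (fpair (\<lambda>_. t \<alpha> n) (\<lambda>_. u \<alpha> n))))"
    unfolding fpair_def
    by (intro sr_intros rec_intros SR_subst_oracle[OF Q(1)] assms SRT_comp[OF assms(2)] SRT_comp[OF assms(3)])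
  with Q(2) show ?thesis unfolding univ_def by simp
qed

text \<open>Kleene's diagonal argument: \<delta> is an index of the relation that applies
  \<open>Q\<close> to the self-substitution of its own first argument, and \<epsilon> is the
  self-substitution \<open>S \<delta> \<delta>\<close>. The sequence \<beta> stays free, so
  \<open>smn \<epsilon> \<beta>\<close> is an index, recursive in \<beta>, of a relation that may
  refer to \<epsilon> and \<beta>.\<close>

theorem recursion_theorem:
  assumes "SR Q"
  obtains \<epsilon> where "recursive_seq \<epsilon>" "\<And>\<beta> i k. univ (smn \<epsilon> \<beta>) i k \<longleftrightarrow> Q (fpair \<epsilon> \<beta>) (npair i k)"
proof -
  define Y where "Y = Baire \<otimes> (Omega \<otimes> Omega)"
  have Y: "type_le_1 Y" "type_le_1 (Baire \<otimes> Y)" unfolding Y_def by (intro type_le_1.intros)+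
  obtain S where S: "is_smn Y S" using ex_smn[OF Y(1)] by blast
  \<comment> \<open>Here \<omega> encodes an index, the parameter \<beta> and the numbers
    \<open>i\<close> and \<open>k\<close>, in this order. The numbers are constant sequences, so
    they are read at 0.\<close>
  define Q' where "Q' \<omega> = Q (fpair (S (\<lambda>i. nfst (\<omega> i)) (\<lambda>i. nfst (\<omega> i))) (\<lambda>i. nfst (nsnd (\<omega> i))))
     (npair (nfst (nsnd (nsnd (\<omega> 0)))) (nsnd (nsnd (nsnd (\<omega> 0)))))" for \<omega>
  have "SR (\<lambda>\<alpha> n. Q' \<alpha>)"
    unfolding Q'_def fpair_def by (intro sr_intros rec_intros SR_subst[OF assms] SRT_is_smn[OF S])
  then obtain \<delta> where \<delta>: "recursive_seq \<delta>"
    "\<And>x. x \<in> pts (Baire \<otimes> Y) \<Longrightarrow> Pr (Seq \<delta>) x \<in> G (Baire \<otimes> Y) \<longleftrightarrow> Q' (enc x)"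
    using G_section[OF Y(2)] by metis
  define \<epsilon> where "\<epsilon> = S \<delta> \<delta>"
  have "recursive_seq \<epsilon>"
    unfolding \<epsilon>_def
    by (rule recursive_seq_SRT_const) (intro sr_intros rec_intros SRT_is_smn[OF S] recursive_seq_comp[OF \<delta>(1)])
  moreover have "univ (smn \<epsilon> \<beta>) i k \<longleftrightarrow> Q (fpair \<epsilon> \<beta>) (npair i k)" for \<beta> i k
  proof -
    let ?y = "Pr (Seq \<beta>) (Pr (Nat i) (Nat k))"
    have y: "?y \<in> pts Y" by (simp add: Y_def)
    have "univ (smn \<epsilon> \<beta>) i k \<longleftrightarrow> Pr (Seq \<epsilon>) ?y \<in> G Y"
      using is_smn_smn unfolding is_smn_def univ_def Y_def by simp
    also have "\<dots> \<longleftrightarrow> Pr (Seq \<delta>) (Pr (Seq \<delta>) ?y) \<in> G (Baire \<otimes> Y)"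
      using S y unfolding is_smn_def \<epsilon>_def by blast
    also have "\<dots> \<longleftrightarrow> Q' (enc (Pr (Seq \<delta>) ?y))"
      using \<delta>(2) y by simp
    also have "\<dots> \<longleftrightarrow> Q (fpair \<epsilon> \<beta>) (npair i k)"
      by (simp add: Q'_def \<epsilon>_def)
    finally show ?thesis .
  qed
  ultimately show ?thesis using that by blast
qed

section \<open>Subcodes and the labelled tree of a Borel code\<close>

lemma subcode_eqI:
  assumes "\<And>k. Seq \<delta> \<in> nbhd Baire k \<longleftrightarrow> univ (shift \<gamma>) i k"
  shows "subcode G \<gamma> i = Some (Seq \<delta>)"
  using assms unfolding univ_def by (intro pfun_of_eqI type_le_1.intros) simp_all

lemma subcode_eqD:
  assumes "subcode G \<gamma> i = Some (Seq \<delta>)"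
  shows "Seq \<delta> \<in> nbhd Baire k \<longleftrightarrow> univ (shift \<gamma>) i k"
  using pfun_of_eqD(2)[OF assms] unfolding univ_def .

text \<open>A code of an open set gets the code \<^term>\<open>\<lambda>_. 0\<close> of the empty set as each of its subcodes, so
  that all nodes of the tree of iterated subcodes are labelled.\<close>

definition sub :: "(nat \<Rightarrow> nat) \<Rightarrow> nat \<Rightarrow> nat \<Rightarrow> nat" where
  "sub \<gamma> i = (if \<gamma> 0 = 0 then (\<lambda>_. 0) else the_seq (the (subcode G \<gamma> i)))"

lemma BC_ge_1: "BC G \<xi> \<gamma> \<Longrightarrow> fin_ord 1 \<le> \<xi>"
proof (induction rule: BC.induct)
  case (BC_step \<xi> \<gamma>)
  then show ?case using osuc_greater[of "fin_ord 1"] by (simp add: numeral_2_eq_2 fin_ord.simps)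
qed simp

lemma BC_nodeD:
  assumes "BC G \<xi> \<gamma>" "\<gamma> 0 \<noteq> 0"
  shows "fin_ord 2 \<le> \<xi>" "\<gamma> 0 = 1" "subcode G \<gamma> i = Some (Seq (sub \<gamma> i))" "\<exists>\<eta><\<xi>. BC G \<eta> (sub \<gamma> i)"
proof -
  from assms(1) have "fin_ord 2 \<le> \<xi> \<and> \<gamma> 0 = 1 \<and> subcode G \<gamma> i = Some (Seq (sub \<gamma> i)) \<and>
    (\<exists>\<eta><\<xi>. BC G \<eta> (sub \<gamma> i))"
  proof cases
    case BC_1
    with assms(2) show ?thesis by simp
  next
    case BC_step
    obtain \<delta> \<eta> where \<delta>: "subcode G \<gamma> i = Some (Seq \<delta>)" "\<eta> < \<xi>" "BC G \<eta> \<delta>"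
      using BC_step(3) by blast
    then have "sub \<gamma> i = \<delta>" using assms(2) by (simp add: sub_def)
    with \<delta> BC_step show ?thesis by auto
  qed
  then show "fin_ord 2 \<le> \<xi>" "\<gamma> 0 = 1" "subcode G \<gamma> i = Some (Seq (sub \<gamma> i))" "\<exists>\<eta><\<xi>. BC G \<eta> (sub \<gamma> i)"
    by blast+
qed

text \<open>The inequality is not strict because of the codes of open sets: such a code of rank 1
  receives the code of the empty set, again of rank 1, as its subcodes.\<close>

lemma BC_sub: "BC G \<xi> \<gamma> \<Longrightarrow> \<exists>\<eta>\<le>\<xi>. BC G \<eta> (sub \<gamma> i)"
proof (cases "\<gamma> 0 = 0")
  case True
  assume "BC G \<xi> \<gamma>"
  with True show ?thesis
    using BC_ge_1 by (auto simp: sub_def intro!: exI[of _ "fin_ord 1"] BC.BC_1)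
next
  case False
  assume "BC G \<xi> \<gamma>"
  with False show ?thesis using BC_nodeD(4) less_imp_le by blast
qed

lemma rho_leaf: "\<gamma> 0 = 0 \<Longrightarrow> rho G X \<gamma> = (\<Union>i. nbhd X (\<gamma> (Suc i)))"
  by (simp add: rho.simps[of G X \<gamma>] shift_def)

lemma rho_node:
  assumes "BC G \<xi> \<gamma>" "\<gamma> 0 \<noteq> 0" shows "rho G X \<gamma> = (\<Union>i. pts X - rho G X (sub \<gamma> i))"
  using assms by (subst rho.simps) (auto simp: sub_def)

lemma rho_subset: "type_le_1 X \<Longrightarrow> BC G \<xi> \<gamma> \<Longrightarrow> rho G X \<gamma> \<subseteq> pts X"
  by (cases "\<gamma> 0 = 0") (auto simp: rho_leaf rho_node nbhd_iff)

lemma openin_nbhd: "type_le_1 X \<Longrightarrow> openin (top_of X) (nbhd X k)"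
  unfolding openin_top_of
  by (auto simp: nbhd_iff in_ball_def intro!: exI[of _ "Suc (nsnd (nsnd k))"])

lemma Sigma0_rho: "type_le_1 X \<Longrightarrow> BC G \<xi> \<gamma> \<Longrightarrow> Sigma0 (top_of X) \<xi> (rho G X \<gamma>)"
proof (induction \<xi> arbitrary: \<gamma> rule: less_induct)
  case (less \<xi>)
  from less.prems(2) show ?case
  proof cases
    case BC_1
    have "openin (top_of X) (rho G X \<gamma>)"
      unfolding rho_leaf[of \<gamma>, OF BC_1(2)] using less.prems(1) by (auto intro: openin_nbhd)
    then show ?thesis unfolding BC_1(1) by (rule Sigma0_open)
  next
    case BC_step
    then have 0: "\<gamma> 0 \<noteq> 0" by simp
    have "\<forall>n. \<exists>\<eta>. fin_ord 1 \<le> \<eta> \<and> \<eta> < \<xi> \<and> Sigma0 (top_of X) \<eta> (rho G X (sub \<gamma> n))"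
      using BC_nodeD(4)[OF less.prems(2) 0] BC_ge_1 less.IH[OF _ less.prems(1)] by blast
    from Sigma0_Union[OF BC_step(1) this] show ?thesis
      using rho_node[OF less.prems(2) 0] less.prems(1) by simp
  qed
qed

function node :: "(nat \<Rightarrow> nat) \<Rightarrow> nat \<Rightarrow> nat \<Rightarrow> nat" where
  "node \<gamma> 0 = \<gamma>"
| "node \<gamma> (Suc c) = sub (node \<gamma> (nfst c)) (nsnd c)"
  by pat_completeness auto
termination
  by (relation "Wellfounded.measure snd") (auto simp: npair_ge less_Suc_eq_le)

lemma node_child [simp]: "node \<gamma> (child s j) = sub (node \<gamma> s) j"
  by simp

declare node.simps(2) [simp del]

lemma BC_node: "BC G \<xi> \<gamma> \<Longrightarrow> \<exists>\<eta>\<le>\<xi>. BC G \<eta> (node \<gamma> s)"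
proof (induction \<gamma> s rule: node.induct)
  case (2 \<gamma> c)
  then obtain \<eta> where "\<eta> \<le> \<xi>" "BC G \<eta> (node \<gamma> (nfst c))" by blast
  with BC_sub[OF this(2), of "nsnd c"] show ?case by (metis node.simps(2) order_trans)
qed auto

definition sub_graph :: "(nat \<Rightarrow> nat) \<Rightarrow> nat \<Rightarrow> bool" where
  "sub_graph \<gamma> z \<longleftrightarrow> (\<exists>c. lnth c (nfst (nsnd z)) = nsnd (nsnd z) \<and>
     univ (shift \<gamma>) (nfst z) (npair c (npair 1 (nfst (nsnd z)))))"

lemma SR_sub_graph: "SR sub_graph"
  unfolding sub_graph_def[abs_def] shift_def by (intro sr_intros rec_intros)

lemma sub_graph:
  assumes "BC G \<xi> \<gamma>" "\<gamma> 0 \<noteq> 0" shows "sub_graph \<gamma> (npair i (npair n v)) \<longleftrightarrow> sub \<gamma> i n = v"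
proof -
  have "Seq (sub \<gamma> i) \<in> nbhd Baire k \<longleftrightarrow> univ (shift \<gamma>) i k" for k
    by (rule subcode_eqD[OF BC_nodeD(3)[OF assms]])
  from graph_from_nbhds[OF this] show ?thesis by (simp add: sub_graph_def)
qed

text \<open>The label of a child is computed by \<open>sub_graph\<close> with the label of its
  parent as oracle, and that label is given by the relation under construction. The recursion
  theorem provides this self-reference. Values of the parent's label are requested only on the
  finite part that a witness of \<open>sub_graph\<close> uses.\<close>

lemma ex_node_graph:
  "\<exists>N. SR (\<lambda>\<alpha> z. N \<alpha> (nfst z) (nfst (nsnd z)) (nsnd (nsnd z))) \<and>
    (\<forall>\<xi> \<gamma>. BC G \<xi> \<gamma> \<longrightarrow> (\<forall>s n v. N \<gamma> s n v \<longleftrightarrow> node \<gamma> s n = v))"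
proof -
  obtain D where D: "recursive_pred D" "\<And>\<alpha> n. sub_graph \<alpha> n \<longleftrightarrow> (\<exists>w. lprefix (nfst w) \<alpha> \<and> D (npair w n))"
    using SR_sub_graph by (rule SR_E) blast
  \<comment> \<open>The relation on triples whose index is \<open>smn \<epsilon> \<gamma>\<close>;
    the triple is the first number argument of \<open>univ\<close>, the second one is kept at
    0.\<close>
  define V where "V \<epsilon> \<gamma> s n v = univ (smn \<epsilon> \<gamma>) (npair s (npair n v)) 0" for \<epsilon> \<gamma> s n v
  \<comment> \<open>The root carries \<gamma> itself; below a code of an open set all labels are
    zero; otherwise a witness is run on the parent's label. As \<open>V\<close> is merely
    semirecursive, that the parent's label is nonzero at 0 is expressed by exhibiting a positive
    value.\<close>
  define Q where "Q \<epsilon> \<gamma> s n v \<longleftrightarrow> s = 0 \<and> \<gamma> n = v \<or> s \<noteq> 0 \<and> (V \<epsilon> \<gamma> (parent s) 0 0 \<and> v = 0 \<or>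
      (\<exists>a. V \<epsilon> \<gamma> (parent s) 0 (Suc a)) \<and>
      (\<exists>w. (\<forall>j<llen (nfst w). V \<epsilon> \<gamma> (parent s) j (lnth (nfst w) j)) \<and>
        D (npair w (npair (nsnd (s - 1)) (npair n v)))))" for \<epsilon> \<gamma> s n v
  have "SR (\<lambda>\<omega> m. Q (\<lambda>i. nfst (\<omega> i)) (\<lambda>i. nsnd (\<omega> i)) (nfst (nfst m)) (nfst (nsnd (nfst m))) (nsnd (nsnd (nfst m))))"
    unfolding Q_def V_def
    by (intro sr_intros rec_intros recursive_pred_comp[OF D(1)])
  from recursion_theorem[OF this] obtain \<epsilon> where \<epsilon>: "recursive_seq \<epsilon>"
    "\<And>\<beta> i k. univ (smn \<epsilon> \<beta>) i k \<longleftrightarrow> Q \<epsilon> \<beta> (nfst i) (nfst (nsnd i)) (nsnd (nsnd i))"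
    by (simp only: fpair_simps npair_simps) blast
  define N where "N \<gamma> s n v = V \<epsilon> \<gamma> s n v" for \<gamma> s n v
  have N: "N \<gamma> s n v \<longleftrightarrow> Q \<epsilon> \<gamma> s n v" for \<gamma> s n v
    unfolding N_def V_def \<epsilon>(2) by (simp add: V_def)
  have "SR (\<lambda>\<alpha> z. N \<alpha> (nfst z) (nfst (nsnd z)) (nsnd (nsnd z)))"
    unfolding N_def V_def by (intro sr_intros rec_intros recursive_seq_comp[OF \<epsilon>(1)])
  moreover have "N \<gamma> s n v \<longleftrightarrow> node \<gamma> s n = v" if "BC G \<xi> \<gamma>" for \<xi> \<gamma> s n v
    using that
  proof (induction \<gamma> s arbitrary: n v rule: node.induct)
    case (1 \<gamma>)
    then show ?case by (simp add: N Q_def)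
  next
    case (2 \<gamma> c)
    let ?\<delta> = "node \<gamma> (nfst c)"
    have IH: "V \<epsilon> \<gamma> (nfst c) n v \<longleftrightarrow> ?\<delta> n = v" for n v using 2 by (simp add: N_def)
    from BC_node[OF 2(2)] obtain \<eta> where \<eta>: "BC G \<eta> ?\<delta>" by blast
    have step: "N \<gamma> (Suc c) n v \<longleftrightarrow> ?\<delta> 0 = 0 \<and> v = 0 \<or>
      ?\<delta> 0 \<noteq> 0 \<and> (\<exists>w. lprefix (nfst w) ?\<delta> \<and> D (npair w (npair (nsnd c) (npair n v))))"
      unfolding N Q_def by (auto simp: IH lprefix_def gr0_conv_Suc eq_commute[of "lnth _ _" "node _ _ _"])
    show ?case
    proof (cases "?\<delta> 0 = 0")
      case True
      with step show ?thesis by (auto simp: node.simps(2) sub_def)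
    next
      case False
      with step show ?thesis
        by (simp add: node.simps(2) sub_graph[OF \<eta> False, symmetric] D(2))
    qed
  qed
  ultimately show ?thesis by blast
qed

end

section \<open>Witnesses for membership in the sets coded by the nodes\<close>

text \<open>For a set \<^term>\<open>Z\<close> of nodes at which a point \<^term>\<open>x\<close> is known not to belong to the coded
  set, \<^term>\<open>piece N x Z s j\<close> says that \<^term>\<open>x\<close> belongs to the \<^term>\<open>j\<close>-th of the sets whose union is
  coded by the node \<^term>\<open>s\<close>; dually for \<^term>\<open>nopiece\<close>. The relation \<^term>\<open>N\<close> is the graph of the
  labelling of the nodes.\<close>

definition piece :: "(nat \<Rightarrow> nat \<Rightarrow> nat \<Rightarrow> bool) \<Rightarrow> (nat \<Rightarrow> nat) \<Rightarrow> nat set \<Rightarrow> nat \<Rightarrow> nat \<Rightarrow> bool" where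
  "piece N x Z s j \<longleftrightarrow> (\<exists>a. N s 0 0 \<and> N s (Suc j) a \<and> in_ball (den Cantor) x a) \<or> N s 0 1 \<and> child s j \<in> Z"

definition nopiece :: "(nat \<Rightarrow> nat \<Rightarrow> nat \<Rightarrow> bool) \<Rightarrow> (nat \<Rightarrow> nat) \<Rightarrow> nat set \<Rightarrow> nat \<Rightarrow> nat \<Rightarrow> bool" where
  "nopiece N x Z s j \<longleftrightarrow> (\<exists>a. N s 0 0 \<and> N s (Suc j) a \<and> \<not> in_ball (den Cantor) x a) \<or> N s 0 1 \<and> child s j \<in> Z"

lemma piece_mono: "piece N x Z s j \<Longrightarrow> Z \<subseteq> Z' \<Longrightarrow> piece N x Z' s j"
  and nopiece_mono: "nopiece N x Z s j \<Longrightarrow> Z \<subseteq> Z' \<Longrightarrow> nopiece N x Z' s j"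
  by (auto simp: piece_def nopiece_def)

text \<open>The constraint at \<open>s\<close> says that \<open>e s\<close> is 0 if there is no
  piece and otherwise \<open>j + 1\<close> for the first piece \<open>j\<close>. Its violation is
  stated without negating \<open>piece\<close> or \<open>nopiece\<close>, so it is semirecursive and
  the valid pairs form a closed set.\<close>

definition invalid :: "(nat \<Rightarrow> nat \<Rightarrow> nat \<Rightarrow> bool) \<Rightarrow> (nat \<Rightarrow> nat) \<Rightarrow> (nat \<Rightarrow> nat) \<Rightarrow> nat \<Rightarrow> bool" where
  "invalid N x e s \<longleftrightarrow> e s = 0 \<and> (\<exists>j. piece N x {s. e s = 0} s j) \<or>
    (\<exists>j. e s = Suc j \<and> (nopiece N x {s. e s \<noteq> 0} s j \<or> (\<exists>i<j. piece N x {s. e s = 0} s i)))"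

text \<open>Gives the witnesses when \<open>x\<close> is outside the set at the root. The value 0
  occurs at the root, below codes of open sets, where all labels are empty, and at nodes of
  \<open>Z\<close>; at a child of any other root it is impossible. A positive value takes its piece
  from \<open>Z\<close>, and each earlier piece is refuted by membership at a child, itself
  certified by a piece from \<open>Z\<close>.\<close>

definition wit_val :: "(nat \<Rightarrow> nat \<Rightarrow> nat \<Rightarrow> bool) \<Rightarrow> (nat \<Rightarrow> nat) \<Rightarrow> nat set \<Rightarrow> nat \<Rightarrow> nat \<Rightarrow> bool" where
  "wit_val N x Z s v \<longleftrightarrow> v = 0 \<and> (s = 0 \<or> N (parent s) 0 0 \<or> parent s \<noteq> 0 \<and> s \<in> Z) \<or>
    s \<noteq> 0 \<and> (\<exists>j. v = Suc j \<and> piece N x Z s j \<and> (\<forall>i<j. nopiece N x {c. \<exists>k. piece N x Z c k} s i))"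

text \<open>This is \<open>in_ball\<close> for the point that pairs \<open>x\<close> with its
  witnesses, with each witness value replaced by the relation \<open>wit_val\<close>. Unfolded like
  this it is monotone in \<open>Z\<close>.\<close>

definition inverse_nbhd :: "(nat \<Rightarrow> nat \<Rightarrow> nat \<Rightarrow> bool) \<Rightarrow> (nat \<Rightarrow> nat) \<Rightarrow> nat set \<Rightarrow> nat \<Rightarrow> bool" where
  "inverse_nbhd N x Z k \<longleftrightarrow> 0 < nfst (nsnd k) \<and>
    (\<forall>n\<le>nsnd (nsnd k). (n + 1) * nfst (nsnd k) \<le> nsnd (nsnd k) + 1 \<longrightarrow>
      nfst (lnth (nfst k) n) = x n \<and> wit_val N x Z n (nsnd (lnth (nfst k) n)))"

lemma wit_val_mono:
  assumes "wit_val N x Z s v" "Z \<subseteq> Z'" shows "wit_val N x Z' s v"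
proof -
  have "{c. \<exists>k. piece N x Z c k} \<subseteq> {c. \<exists>k. piece N x Z' c k}"
    using piece_mono[OF _ assms(2)] by blast
  with assms show ?thesis
    unfolding wit_val_def using piece_mono[OF _ assms(2)] nopiece_mono by blast
qed

lemma inverse_nbhd_mono: "inverse_nbhd N x Z k \<Longrightarrow> Z \<subseteq> Z' \<Longrightarrow> inverse_nbhd N x Z' k"
  unfolding inverse_nbhd_def using wit_val_mono by blast

context parametrization
begin

definition label_graph :: "(nat \<Rightarrow> nat) \<Rightarrow> nat \<Rightarrow> nat \<Rightarrow> nat \<Rightarrow> bool" where
  "label_graph = (SOME N. SR (\<lambda>\<alpha> z. N \<alpha> (nfst z) (nfst (nsnd z)) (nsnd (nsnd z))) \<and>
    (\<forall>\<xi> \<gamma>. BC G \<xi> \<gamma> \<longrightarrow> (\<forall>s n v. N \<gamma> s n v \<longleftrightarrow> node \<gamma> s n = v)))"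

lemma label_graph: "BC G \<xi> \<gamma> \<Longrightarrow> label_graph \<gamma> = (\<lambda>s n v. node \<gamma> s n = v)"
  and SR_label_graph_raw: "SR (\<lambda>\<alpha> z. label_graph \<alpha> (nfst z) (nfst (nsnd z)) (nsnd (nsnd z)))"
  using someI_ex[OF ex_node_graph] unfolding label_graph_def[symmetric] by (auto simp: fun_eq_iff)

lemma SR_label_graph [sr_intros]:
  assumes "SRT (\<lambda>\<alpha> z. g \<alpha> (nfst z) (nsnd z))" "SRT t" "SRT u" "SRT v"
  shows "SR (\<lambda>\<alpha> n. label_graph (g \<alpha> n) (t \<alpha> n) (u \<alpha> n) (v \<alpha> n))"
  using SR_subst[OF SR_label_graph_raw, of g "\<lambda>\<alpha> n. npair (t \<alpha> n) (npair (u \<alpha> n) (v \<alpha> n))"] assms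
  by (simp add: sr_intros)

lemma SR_piece [sr_intros]:
  assumes "SRT (\<lambda>\<alpha> z. g \<alpha> (nfst z) (nsnd z))" "SRT (\<lambda>\<alpha> z. x \<alpha> (nfst z) (nsnd z))"
    "SR (\<lambda>\<alpha> z. nsnd z \<in> Z \<alpha> (nfst z))" "SRT t" "SRT u"
  shows "SR (\<lambda>\<alpha> n. piece (label_graph (g \<alpha> n)) (x \<alpha> n) (Z \<alpha> n) (t \<alpha> n) (u \<alpha> n))"
    "SR (\<lambda>\<alpha> n. nopiece (label_graph (g \<alpha> n)) (x \<alpha> n) (Z \<alpha> n) (t \<alpha> n) (u \<alpha> n))"
  unfolding piece_def nopiece_def
  by (intro sr_intros rec_intros assms type_le_1.intros SRT_comp_pair[OF assms(1)] SRT_comp_pair[OF assms(2)]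
      SR_comp_pair[OF assms(3)] SRT_comp[OF assms(4)] SRT_comp[OF assms(5)])+

lemma SR_wit_val:
  assumes "SRT (\<lambda>\<alpha> z. g \<alpha> (nfst z) (nsnd z))" "SRT (\<lambda>\<alpha> z. x \<alpha> (nfst z) (nsnd z))"
    "SR (\<lambda>\<alpha> z. nsnd z \<in> Z \<alpha> (nfst z))" "SRT t" "SRT u"
  shows "SR (\<lambda>\<alpha> n. wit_val (label_graph (g \<alpha> n)) (x \<alpha> n) (Z \<alpha> n) (t \<alpha> n) (u \<alpha> n))"
proof -
  note intros = sr_intros rec_intros assms type_le_1.intros SRT_comp_pair[OF assms(1)] SRT_comp_pair[OF assms(2)]
      SR_comp_pair[OF assms(3)] SRT_comp[OF assms(4)] SRT_comp[OF assms(5)]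
  have "SR (\<lambda>\<alpha> z. nsnd z \<in> {c. \<exists>k. piece (label_graph (g \<alpha> (nfst z))) (x \<alpha> (nfst z)) (Z \<alpha> (nfst z)) c k})"
    unfolding mem_Collect_eq by (intro intros)
  note W = SR_comp_pair[OF this]
  show ?thesis
    unfolding wit_val_def by (intro W intros)
qed

abbreviation labels :: "(nat \<Rightarrow> nat) \<Rightarrow> nat \<Rightarrow> nat \<Rightarrow> nat \<Rightarrow> bool" where
  "labels \<gamma> \<equiv> (\<lambda>s n v. node \<gamma> s n = v)"

definition in_node :: "(nat \<Rightarrow> nat) \<Rightarrow> (nat \<Rightarrow> nat) \<Rightarrow> nat \<Rightarrow> bool" where
  "in_node \<gamma> x s \<longleftrightarrow> Seq x \<in> rho G Cantor (node \<gamma> s)"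

definition in_piece :: "(nat \<Rightarrow> nat) \<Rightarrow> (nat \<Rightarrow> nat) \<Rightarrow> nat \<Rightarrow> nat \<Rightarrow> bool" where
  "in_piece \<gamma> x s j \<longleftrightarrow> (if node \<gamma> s 0 = 0 then in_ball (den Cantor) x (node \<gamma> s (Suc j))
     else \<not> in_node \<gamma> x (child s j))"

definition wit :: "(nat \<Rightarrow> nat) \<Rightarrow> (nat \<Rightarrow> nat) \<Rightarrow> nat \<Rightarrow> nat" where
  "wit \<gamma> x s = (if \<exists>j. in_piece \<gamma> x s j then Suc (LEAST j. in_piece \<gamma> x s j) else 0)"

lemma node_0_cases:
  assumes "BC G \<xi> \<gamma>" obtains "node \<gamma> s 0 = 0" | "node \<gamma> s 0 = 1"
  using BC_node[OF assms, of s] BC_nodeD(2) by (metis BC_1_iff)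

lemma piece_labels:
  assumes "BC G \<xi> \<gamma>" "node \<gamma> s 0 \<noteq> 0 \<Longrightarrow> child s j \<in> Z \<longleftrightarrow> \<not> in_node \<gamma> x (child s j)"
  shows "piece (labels \<gamma>) x Z s j \<longleftrightarrow> in_piece \<gamma> x s j"
  by (rule node_0_cases[OF assms(1), of s]) (use assms(2) in \<open>auto simp: piece_def in_piece_def\<close>)

lemma nopiece_labels:
  assumes "BC G \<xi> \<gamma>" "node \<gamma> s 0 \<noteq> 0 \<Longrightarrow> child s j \<in> Z \<longleftrightarrow> in_node \<gamma> x (child s j)"
  shows "nopiece (labels \<gamma>) x Z s j \<longleftrightarrow> \<not> in_piece \<gamma> x s j"
  by (rule node_0_cases[OF assms(1), of s]) (use assms(2) in \<open>auto simp: nopiece_def in_piece_def\<close>)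

lemma in_node_iff:
  assumes "BC G \<xi> \<gamma>" "\<forall>n. x n \<le> 1" shows "in_node \<gamma> x s \<longleftrightarrow> (\<exists>j. in_piece \<gamma> x s j)"
proof (cases "node \<gamma> s 0 = 0")
  case True
  then show ?thesis
    using assms(2) by (auto simp: in_node_def in_piece_def rho_leaf[of "node \<gamma> s", OF True] Seq_in_nbhd_Cantor)
next
  case False
  obtain \<eta> where "BC G \<eta> (node \<gamma> s)" using BC_node[OF assms(1)] by blast
  from rho_node[OF this False] show ?thesis
    using assms(2) False by (auto simp: in_node_def in_piece_def)
qed

lemma wit_eq_0:
  assumes "BC G \<xi> \<gamma>" "\<forall>n. x n \<le> 1" shows "wit \<gamma> x s = 0 \<longleftrightarrow> \<not> in_node \<gamma> x s"
  using in_node_iff[OF assms] by (simp add: wit_def)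

lemma wit_eq_Suc: "wit \<gamma> x s = Suc j \<longleftrightarrow> in_piece \<gamma> x s j \<and> (\<forall>i<j. \<not> in_piece \<gamma> x s i)"
proof
  assume *: "wit \<gamma> x s = Suc j"
  then have ex: "\<exists>j. in_piece \<gamma> x s j" and j: "j = (LEAST j. in_piece \<gamma> x s j)"
    by (auto simp: wit_def split: if_splits)
  show "in_piece \<gamma> x s j \<and> (\<forall>i<j. \<not> in_piece \<gamma> x s i)"
    unfolding j using LeastI_ex[OF ex] not_less_Least by blast
next
  assume *: "in_piece \<gamma> x s j \<and> (\<forall>i<j. \<not> in_piece \<gamma> x s i)"
  then have "(LEAST j. in_piece \<gamma> x s j) = j"
    by (intro Least_equality) (auto simp: not_less[symmetric])
  with * show "wit \<gamma> x s = Suc j" by (auto simp: wit_def)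
qed

lemma wit_0: "wit \<gamma> x s = 0 \<longleftrightarrow> (\<forall>j. \<not> in_piece \<gamma> x s j)"
  by (simp add: wit_def)

text \<open>At a single node only the vanishing of \<open>e\<close> at the children enters, not the
  value of \<open>e\<close> there. So the hypothesis can ask for correct zeros alone.\<close>

lemma invalid_iff:
  assumes "BC G \<xi> \<gamma>" "node \<gamma> s 0 \<noteq> 0 \<Longrightarrow> \<forall>j. e (child s j) = 0 \<longleftrightarrow> \<not> in_node \<gamma> x (child s j)"
  shows "invalid (labels \<gamma>) x e s \<longleftrightarrow> e s \<noteq> wit \<gamma> x s"
proof -
  have p: "piece (labels \<gamma>) x {s. e s = 0} s j \<longleftrightarrow> in_piece \<gamma> x s j" for j
    using assms(2) by (intro piece_labels[OF assms(1)]) simp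
  have n: "nopiece (labels \<gamma>) x {s. e s \<noteq> 0} s j \<longleftrightarrow> \<not> in_piece \<gamma> x s j" for j
    by (rule nopiece_labels[OF assms(1)]) (metis assms(2) mem_Collect_eq)
  show ?thesis
  proof (cases "e s")
    case 0
    then show ?thesis using wit_0[of \<gamma> x s] by (auto simp: invalid_def p n)
  next
    case (Suc j)
    then have "invalid (labels \<gamma>) x e s \<longleftrightarrow> \<not> (in_piece \<gamma> x s j \<and> (\<forall>i<j. \<not> in_piece \<gamma> x s i))"
      unfolding invalid_def p n by auto
    with Suc show ?thesis unfolding wit_eq_Suc[symmetric] by auto
  qed
qed

lemma valid_iff:
  assumes "BC G \<xi> \<gamma>" "\<forall>n. x n \<le> 1"
  shows "(\<forall>s. \<not> invalid (labels \<gamma>) x e s) \<longleftrightarrow> e = wit \<gamma> x"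
proof
  assume valid: "\<forall>s. \<not> invalid (labels \<gamma>) x e s"
  \<comment> \<open>The induction is on the rank of the label, not on \<open>s\<close>, because
    children have larger numbers than their parent. At a label of an open set no child is
    consulted.\<close>
  have "BC G \<eta> (node \<gamma> s) \<Longrightarrow> e s = wit \<gamma> x s" for \<eta> s
  proof (induction \<eta> arbitrary: s rule: less_induct)
    case (less \<eta>)
    have "e (child s j) = 0 \<longleftrightarrow> \<not> in_node \<gamma> x (child s j)" if "node \<gamma> s 0 \<noteq> 0" for j
      using BC_nodeD(4)[OF less.prems that, of j] less.IH wit_eq_0[OF assms] by auto
    with invalid_iff[OF assms(1)] valid show ?case by blast
  qed
  then show "e = wit \<gamma> x" using BC_node[OF assms(1)] by blast
next
  assume "e = wit \<gamma> x"
  then show "\<forall>s. \<not> invalid (labels \<gamma>) x e s"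
    using invalid_iff[OF assms(1), of _ e x] wit_eq_0[OF assms] by auto
qed

section \<open>The closed set and its projection\<close>

lemma ex_closed_code:
  "\<exists>K. SRT K \<and> (\<forall>\<xi> \<gamma>. BC G \<xi> \<gamma> \<longrightarrow> K \<gamma> 0 = 0 \<and>
    (\<forall>\<alpha>. Seq \<alpha> \<notin> rho G Baire (K \<gamma>) \<longleftrightarrow>
      (\<exists>x. (\<forall>n. x n \<le> 1) \<and> Seq x \<notin> rho G Cantor \<gamma> \<and> \<alpha> = fpair x (wit \<gamma> x))))"
proof -
  \<comment> \<open>The ways in which \<open>(x, e)\<close> fails to be in the closed set:
    \<open>x\<close> is not binary, \<open>e\<close> claims that \<open>x\<close> is in the coded
    set, or some constraint is violated.\<close>
  define Q where "Q N x e \<longleftrightarrow> (\<exists>i. 1 < x i) \<or> e 0 \<noteq> 0 \<or> (\<exists>s. invalid N x e s)"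
    for N :: "nat \<Rightarrow> nat \<Rightarrow> nat \<Rightarrow> bool" and x e :: "nat \<Rightarrow> nat"
  have "SR (\<lambda>\<omega> n. Q (label_graph (\<lambda>i. nfst (\<omega> i))) (\<lambda>i. nfst (nsnd (\<omega> i))) (\<lambda>i. nsnd (nsnd (\<omega> i))))"
    unfolding Q_def invalid_def by (intro sr_intros rec_intros)
  from SR_open_enumerate[OF type_le_1.intros(2) this] obtain H where
    H: "SRT (\<lambda>\<beta> z. H \<beta> (nfst z) (nsnd z))"
    "\<And>\<gamma> n. (\<Union>i. nbhd Baire (H \<gamma> n i)) = {y \<in> pts Baire. Q (label_graph \<gamma>) (\<lambda>i. nfst (enc y i)) (\<lambda>i. nsnd (enc y i))}"
    by (simp only: fpair_simps) blast
  define K where "K \<gamma> n = (case n of 0 \<Rightarrow> 0 | Suc i \<Rightarrow> H \<gamma> 0 i)" for \<gamma> n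
  have "SRT K" unfolding K_def by (intro sr_intros rec_intros SRT_comp_pair[OF H(1)])
  moreover have "Seq \<alpha> \<notin> rho G Baire (K \<gamma>) \<longleftrightarrow>
      (\<exists>x. (\<forall>n. x n \<le> 1) \<and> Seq x \<notin> rho G Cantor \<gamma> \<and> \<alpha> = fpair x (wit \<gamma> x))" if BC: "BC G \<xi> \<gamma>" for \<xi> \<gamma> \<alpha>
  proof -
    let ?x = "\<lambda>i. nfst (\<alpha> i)" and ?e = "\<lambda>i. nsnd (\<alpha> i)"
    have \<alpha>: "\<alpha> = fpair ?x ?e" by (simp add: fpair_def)
    have "rho G Baire (K \<gamma>) = (\<Union>i. nbhd Baire (H \<gamma> 0 i))"
      by (subst rho_leaf) (auto simp: K_def)
    then have "Seq \<alpha> \<notin> rho G Baire (K \<gamma>) \<longleftrightarrow> \<not> Q (labels \<gamma>) ?x ?e"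
      by (simp add: H(2) label_graph[OF BC])
    also have "\<dots> \<longleftrightarrow> (\<forall>n. ?x n \<le> 1) \<and> ?e 0 = 0 \<and> ?e = wit \<gamma> ?x"
      using valid_iff[OF BC, of ?x ?e] by (auto simp: Q_def not_less)
    also have "\<dots> \<longleftrightarrow> (\<forall>n. ?x n \<le> 1) \<and> Seq ?x \<notin> rho G Cantor \<gamma> \<and> ?e = wit \<gamma> ?x"
      using wit_eq_0[OF BC, of ?x 0] fun_cong[of ?e "wit \<gamma> ?x" 0] by (auto simp: in_node_def)
    also have "\<dots> \<longleftrightarrow> (\<exists>x. (\<forall>n. x n \<le> 1) \<and> Seq x \<notin> rho G Cantor \<gamma> \<and> \<alpha> = fpair x (wit \<gamma> x))"
    proof
      assume *: "(\<forall>n. ?x n \<le> 1) \<and> Seq ?x \<notin> rho G Cantor \<gamma> \<and> ?e = wit \<gamma> ?x"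
      have "\<alpha> = fpair ?x (wit \<gamma> ?x)"
        by (rule trans[OF \<alpha>]) (simp only: *)
      then show "\<exists>x. (\<forall>n. x n \<le> 1) \<and> Seq x \<notin> rho G Cantor \<gamma> \<and> \<alpha> = fpair x (wit \<gamma> x)"
        by (intro exI[of _ ?x] conjI) (use * in blast)+
    qed auto
    finally show ?thesis .
  qed
  ultimately show ?thesis by (intro exI[of _ K]) (auto simp: K_def)
qed

lemma ex_projection_code:
  "\<exists>\<pi>. recursive_seq \<pi> \<and> (\<forall>\<alpha>. (\<forall>n. nfst (\<alpha> n) \<le> 1) \<longrightarrow>
     pfun_of G Baire Cantor \<pi> (Seq \<alpha>) = Some (Seq (\<lambda>n. nfst (\<alpha> n))))"
proof -
  \<comment> \<open>Here \<omega> encodes the pair of a sequence \<alpha> and a number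
    \<open>k\<close>; the first components of \<alpha> form the projected point. Since \<gamma> does
    not occur, one recursive index serves all codes.\<close>
  have "SR (\<lambda>\<omega> n. in_ball (den Cantor) (\<lambda>i. nfst (nfst (\<omega> i))) (nsnd (\<omega> 0)))"
    by (intro sr_intros rec_intros type_le_1.intros)
  moreover have "type_le_1 (Baire \<otimes> Omega)" by (intro type_le_1.intros)
  ultimately obtain \<pi> where \<pi>: "recursive_seq \<pi>" "\<And>x. x \<in> pts (Baire \<otimes> Omega) \<Longrightarrow>
      Pr (Seq \<pi>) x \<in> G (Baire \<otimes> Omega) \<longleftrightarrow> in_ball (den Cantor) (\<lambda>i. nfst (nfst (enc x i))) (nsnd (enc x 0))"
    using G_section by blast
  have "pfun_of G Baire Cantor \<pi> (Seq \<alpha>) = Some (Seq (\<lambda>n. nfst (\<alpha> n)))" if "\<forall>n. nfst (\<alpha> n) \<le> 1" for \<alpha>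
    using that by (intro pfun_of_eqI type_le_1.intros) (simp_all add: \<pi>(2) Seq_in_nbhd_Cantor)
  with \<pi>(1) show ?thesis by blast
qed

text \<open>The condition \<^term>\<open>parent s \<noteq> 0\<close> says that \<open>s\<close> is at distance at least 2 from the root: the
  number 0 is both the parent of the children of the root and, by truncated subtraction, of the root.\<close>

definition zeros :: "(nat \<Rightarrow> nat) \<Rightarrow> (nat \<Rightarrow> nat) \<Rightarrow> nat set" where
  "zeros \<gamma> x = {s. parent s \<noteq> 0 \<and> \<not> in_node \<gamma> x s}"

lemma wit_val_iff:
  assumes "BC G \<xi> \<gamma>" "\<forall>n. x n \<le> 1" "Seq x \<notin> rho G Cantor \<gamma>"
  shows "wit_val (labels \<gamma>) x (zeros \<gamma> x) s v \<longleftrightarrow> wit \<gamma> x s = v"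
proof (cases "s = 0")
  case True
  have "wit \<gamma> x 0 = 0" using assms(3) wit_eq_0[OF assms(1,2)] by (simp add: in_node_def)
  with True show ?thesis by (auto simp: wit_val_def)
next
  case False
  \<comment> \<open>The children of a node other than the root are at distance at least 2 from the
    root, where \<open>zeros\<close> records nonmembership faithfully.\<close>
  have p: "piece (labels \<gamma>) x (zeros \<gamma> x) t j \<longleftrightarrow> in_piece \<gamma> x t j" if "t \<noteq> 0" for t j
    using that by (intro piece_labels[OF assms(1)]) (simp add: zeros_def)
  have n: "nopiece (labels \<gamma>) x {c. \<exists>k. piece (labels \<gamma>) x (zeros \<gamma> x) c k} s j \<longleftrightarrow> \<not> in_piece \<gamma> x s j" for j
    by (intro nopiece_labels[OF assms(1)], unfold mem_Collect_eq in_node_iff[OF assms(1,2)], intro iff_exI p) simp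
  show ?thesis
  proof (cases v)
    case (Suc j)
    then show ?thesis using False wit_eq_Suc[of \<gamma> x s j] by (auto simp: wit_val_def p n)
  next
    case 0
    obtain c where c: "s = Suc c" using False by (cases s) auto
    have "wit \<gamma> x s = 0 \<longleftrightarrow> node \<gamma> (parent s) 0 = 0 \<or> parent s \<noteq> 0 \<and> s \<in> zeros \<gamma> x"
    proof (cases "node \<gamma> (parent s) 0 = 0")
      case True
      then have "node \<gamma> s = (\<lambda>_. 0)" by (simp add: c node.simps(2) sub_def)
      then have "\<not> in_piece \<gamma> x s j" for j by (simp add: in_piece_def)
      with True show ?thesis by (simp add: wit_0)
    next
      case nz: False
      show ?thesis
      proof (cases "parent s = 0")
        case True
        \<comment> \<open>At a child of the root: as \<open>x\<close> is in no piece of the set at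
          the root, it belongs to the set coded at every child, so its witness there is
          positive.\<close>
        have "\<not> in_piece \<gamma> x 0 (nsnd c)"
          using assms(3) in_node_iff[OF assms(1,2), of 0] by (auto simp: in_node_def)
        with True nz c have "in_node \<gamma> x s"
          by (simp add: in_piece_def) (metis npair_simps(3))
        with True nz show ?thesis using wit_eq_0[OF assms(1,2), of s] by simp
      next
        case False
        with nz show ?thesis using wit_eq_0[OF assms(1,2), of s] by (simp add: zeros_def)
      qed
    qed
    with 0 False show ?thesis by (auto simp: wit_val_def)
  qed
qed

lemma inverse_nbhd_iff:
  assumes "BC G \<xi> \<gamma>" "\<forall>n. x n \<le> 1" "Seq x \<notin> rho G Cantor \<gamma>"
  shows "inverse_nbhd (labels \<gamma>) x (zeros \<gamma> x) k \<longleftrightarrow> Seq (fpair x (wit \<gamma> x)) \<in> nbhd Baire k"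
proof -
  have "a = npair b c \<longleftrightarrow> nfst a = b \<and> nsnd a = c" for a b c
    by (metis npair_simps(1-3))
  then show ?thesis
    by (auto simp: inverse_nbhd_def wit_val_iff[OF assms] nbhd_iff[OF type_le_1.intros(2)] in_ball_def fpair_def)
qed

lemma SR_inverse_nbhd [sr_intros]:
  assumes "SRT (\<lambda>\<alpha> z. g \<alpha> (nfst z) (nsnd z))" "SRT (\<lambda>\<alpha> z. x \<alpha> (nfst z) (nsnd z))"
    "SR (\<lambda>\<alpha> z. nsnd z \<in> Z \<alpha> (nfst z))" "SRT t"
  shows "SR (\<lambda>\<alpha> n. inverse_nbhd (label_graph (g \<alpha> n)) (x \<alpha> n) (Z \<alpha> n) (t \<alpha> n))"
proof -
  note SRT_comp_pair[OF assms(1)] SRT_comp_pair[OF assms(2)] SR_comp_pair[OF assms(3)]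
  note intros = this sr_intros rec_intros assms SRT_comp[OF assms(4)] SR_wit_val
  show ?thesis
    unfolding inverse_nbhd_def by (intro intros)
qed

section \<open>Finite sets of nodes and codes of finite unions\<close>

abbreviation lset :: "nat \<Rightarrow> nat set" where "lset u \<equiv> {s. \<exists>i<llen u. lnth u i = s}"

lemma ex_lset: "finite S \<Longrightarrow> \<exists>u. lset u = S"
proof (induction S rule: finite_induct)
  case (insert a S)
  then obtain u where u: "lset u = S" by blast
  have "lset (lcode (\<lambda>i. case i of 0 \<Rightarrow> a | Suc j \<Rightarrow> lnth u j) (Suc (llen u))) = insert a S"
    unfolding u[symmetric] by (auto simp: less_Suc_eq_0_disj intro: exI[of _ "Suc _"])
  then show ?case by blast
qed (auto simp: llen_def intro!: exI[of _ 0])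

text \<open>\<open>Z\<close> is presented to the oracle by an enumeration \<zeta> of the successors
  of its elements, with 0 for no element. Acceptance depends on finitely many values of the oracle,
  so truncating \<zeta> keeps it, and the truncated enumeration lists a finite subset of
  \<open>Z\<close>.\<close>

lemma inverse_nbhd_finite:
  "inverse_nbhd (label_graph \<gamma>) x Z k \<longleftrightarrow> (\<exists>u. lset u \<subseteq> Z \<and> inverse_nbhd (label_graph \<gamma>) x (lset u) k)"
proof
  define Q where "Q = (\<lambda>\<omega>. inverse_nbhd (label_graph (\<lambda>i. nfst (\<omega> i))) (\<lambda>i. nfst (nsnd (\<omega> i)))
    {s. \<exists>i. nsnd (nsnd (\<omega> i)) = Suc s})"
  define \<zeta> where "\<zeta> s = (if s \<in> Z then Suc s else 0)" for s
  have SR: "SR Q" unfolding Q_def by (intro sr_intros rec_intros)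
  assume "inverse_nbhd (label_graph \<gamma>) x Z k"
  moreover have "{s. \<exists>i. \<zeta> i = Suc s} = Z" by (auto simp: \<zeta>_def split: if_splits)
  ultimately have "Q (fpair \<gamma> (fpair x \<zeta>)) k" by (simp add: Q_def)
  from SR_continuous[of Q, OF SR this]
  obtain t where t: "\<forall>\<beta>. (\<forall>i<t. \<beta> i = fpair \<gamma> (fpair x \<zeta>) i) \<longrightarrow> Q \<beta> k" ..
  have "Q (fpair \<gamma> (fpair x (\<lambda>i. if i < t then \<zeta> i else 0))) k"
    by (rule t[rule_format]) (simp add: fpair_def)
  moreover have "{s. \<exists>i. (if i < t then \<zeta> i else 0) = Suc s} = {s \<in> Z. s < t}"
    by (auto simp: \<zeta>_def split: if_splits)
  ultimately have "inverse_nbhd (label_graph \<gamma>) x {s \<in> Z. s < t} k" by (simp add: Q_def)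
  moreover obtain u where "lset u = {s \<in> Z. s < t}" using ex_lset[of "{s \<in> Z. s < t}"] by auto
  ultimately show "\<exists>u. lset u \<subseteq> Z \<and> inverse_nbhd (label_graph \<gamma>) x (lset u) k"
    by (intro exI[of _ u]) auto
qed (use inverse_nbhd_mono in blast)

text \<open>A sequence lies in a ball iff finitely many of its values agree with the centre, so a
  semirecursive graph yields the neighbourhoods that a subcode requires. As \<open>W\<close> has
  access to \<epsilon>, the subcodes may be built from \<epsilon> again, which permits codes of
  unbounded rank.\<close>

lemma ex_sequence_code:
  assumes "SR W"
  shows "\<exists>\<epsilon>. recursive_seq \<epsilon> \<and> (\<forall>\<beta> i \<delta>. (\<forall>n v. W (fpair \<epsilon> \<beta>) (npair i (npair n v)) \<longleftrightarrow> \<delta> n = v) \<longrightarrow>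
    subcode G (case_nat 1 (smn \<epsilon> \<beta>)) i = Some (Seq \<delta>))"
proof -
  define Q where "Q = (\<lambda>\<omega> z. 0 < nfst (nsnd (nsnd z)) \<and>
    (\<forall>n\<le>nsnd (nsnd (nsnd z)). (n + 1) * nfst (nsnd (nsnd z)) \<le> nsnd (nsnd (nsnd z)) + 1 \<longrightarrow>
      W \<omega> (npair (nfst z) (npair n (lnth (nfst (nsnd z)) n)))))"
  have "SR Q" unfolding Q_def by (intro sr_intros rec_intros SR_comp[OF assms])
  then obtain \<epsilon> where \<epsilon>: "recursive_seq \<epsilon>" "\<And>\<beta> i k. univ (smn \<epsilon> \<beta>) i k \<longleftrightarrow> Q (fpair \<epsilon> \<beta>) (npair i k)"
    by (rule recursion_theorem) blast
  have "subcode G (case_nat 1 (smn \<epsilon> \<beta>)) i = Some (Seq \<delta>)"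
    if "\<forall>n v. W (fpair \<epsilon> \<beta>) (npair i (npair n v)) \<longleftrightarrow> \<delta> n = v" for \<beta> i \<delta>
  proof (rule subcode_eqI)
    show "Seq \<delta> \<in> nbhd Baire k \<longleftrightarrow> univ (shift (case_nat 1 (smn \<epsilon> \<beta>))) i k" for k
      by (auto simp: \<epsilon>(2) Q_def that nbhd_iff[OF type_le_1.intros(2)] in_ball_def)
  qed
  with \<epsilon>(1) show ?thesis by blast
qed

text \<open>The complement of a ball, united with the sets coded at finitely many nodes: this is the
  complement of a ball intersected with conditions of nonmembership. Ball 0 is empty, so
  \<open>c = 0\<close> gives the whole space; the ball \<open>whole\<close> leaves only the sets at
  the nodes.\<close>

definition union_set :: "(nat \<Rightarrow> nat) \<Rightarrow> nat \<Rightarrow> point set" where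
  "union_set \<gamma> c = {Pr (Seq x) (Nat k) |x k. (\<forall>n. x n \<le> 1) \<and>
     (Pr (Seq x) (Nat k) \<notin> nbhd CO (nfst c) \<or> (\<exists>s\<in>lset (nsnd c). in_node \<gamma> x s))}"

lemma union_set_iff [simp]: "Pr (Seq x) (Nat k) \<in> union_set \<gamma> c \<longleftrightarrow> (\<forall>n. x n \<le> 1) \<and>
    (Pr (Seq x) (Nat k) \<notin> nbhd CO (nfst c) \<or> (\<exists>s\<in>lset (nsnd c). in_node \<gamma> x s))"
  by (auto simp: union_set_def)

text \<open>The radius 2 exceeds the diameter of every space of type at most 1.\<close>

definition whole :: nat where "whole = npair 0 (npair 2 0)"

lemma in_ball_whole [simp]: "in_ball d x whole"
  by (simp add: in_ball_def whole_def)

text \<open>This is \<open>list_encode [s]\<close>, since the empty list has code 0.\<close>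

definition singleton :: "nat \<Rightarrow> nat" where "singleton s = Suc (npair s 0)"

lemma lset_singleton [simp]: "lset (singleton s) = {s}" "lset 0 = {}" "llen 0 = 0"
  by (auto simp: singleton_def llen_def lnth_def npair_def)

lemma SRT_singleton [sr_intros]: "SRT t \<Longrightarrow> SRT (\<lambda>\<alpha> n. singleton (t \<alpha> n))"
  unfolding singleton_def by (intro sr_intros rec_intros)

text \<open>The part of \<open>union_set\<close> that is open without any recursion on rank: the
  complement of the ball, which is clopen, and the sets at the nodes labelled by codes of open sets.
  Here \<open>y\<close> encodes a point of \<open>CO\<close>.\<close>

definition base_part :: "(nat \<Rightarrow> nat \<Rightarrow> nat \<Rightarrow> bool) \<Rightarrow> (nat \<Rightarrow> nat) \<Rightarrow> nat \<Rightarrow> bool" where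
  "base_part N y c \<longleftrightarrow> \<not> in_ball (den CO) y (nfst c) \<or>
    (\<exists>i<llen (nsnd c). \<exists>a j. N (lnth (nsnd c) i) 0 0 \<and> N (lnth (nsnd c) i) (Suc j) a \<and>
      in_ball (den Cantor) (\<lambda>n. nfst (y n)) a)"

lemma base_part_iff:
  assumes "BC G \<xi> \<gamma>" "\<forall>n. x n \<le> 1"
  shows "base_part (labels \<gamma>) (fpair x (\<lambda>_. k)) c \<longleftrightarrow> Pr (Seq x) (Nat k) \<notin> nbhd CO (nfst c) \<or>
    (\<exists>s\<in>lset (nsnd c). node \<gamma> s 0 = 0 \<and> in_node \<gamma> x s)"
proof -
  have "in_node \<gamma> x s \<longleftrightarrow> (\<exists>j. in_ball (den Cantor) x (node \<gamma> s (Suc j)))" if "node \<gamma> s 0 = 0" for s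
    using in_node_iff[OF assms, of s] that by (simp add: in_piece_def)
  moreover have "base_part (labels \<gamma>) (fpair x (\<lambda>_. k)) c \<longleftrightarrow>
    \<not> in_ball (den CO) (fpair x (\<lambda>_. k)) (nfst c) \<or>
    (\<exists>s\<in>lset (nsnd c). node \<gamma> s 0 = 0 \<and> (\<exists>j. in_ball (den Cantor) x (node \<gamma> s (Suc j))))"
    unfolding base_part_def fpair_simps by blast
  ultimately show ?thesis
    using assms(2) by (simp add: nbhd_iff[OF type_le_1_CO] cong: conj_cong)
qed

text \<open>A finite union of sets coded in \<open>BC\<^sub>1\<close> must again be coded in \<open>BC\<^sub>1\<close>: for \<open>\<xi> = 3\<close> the inverse map
  needs a code in \<open>BC\<^sub>2\<close>, whose subcodes are codes of open sets. Whether all sets of the union are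
  coded in \<open>BC\<^sub>1\<close> can be decided because the union is finite.\<close>

lemma ex_union_codes:
  "\<exists>D. SR (\<lambda>\<alpha> z. D \<alpha> (nfst z) (nfst (nsnd z)) (nsnd (nsnd z))) \<and>
    (\<forall>\<xi> \<gamma>. BC G \<xi> \<gamma> \<longrightarrow> (\<exists>\<delta>. (\<forall>c n v. D \<gamma> c n v \<longleftrightarrow> \<delta> c n = v) \<and>
      (\<forall>\<eta> c. fin_ord 1 \<le> \<eta> \<longrightarrow> (\<forall>i<llen (nsnd c). \<exists>\<eta>'\<le>\<eta>. BC G \<eta>' (node \<gamma> (lnth (nsnd c) i))) \<longrightarrow>
        (\<exists>\<eta>'\<le>\<eta>. BC G \<eta>' (\<delta> c) \<and> rho G CO (\<delta> c) = union_set \<gamma> c))))"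
proof -
  have "SR (\<lambda>\<omega> c. base_part (label_graph (\<lambda>i. nfst (\<omega> i))) (\<lambda>i. nsnd (\<omega> i)) c)"
    unfolding base_part_def by (intro sr_intros rec_intros type_le_1_CO type_le_1.intros)
  from SR_open_enumerate[OF type_le_1_CO this] obtain H where
    H: "SRT (\<lambda>\<beta> z. H \<beta> (nfst z) (nsnd z))"
    "\<And>\<gamma> c. (\<Union>i. nbhd CO (H \<gamma> c i)) =
      {y \<in> pts CO. base_part (label_graph \<gamma>) (enc y) c}"
    by (simp only: fpair_simps) blast
  \<comment> \<open>Lists the sets whose complements make up the union. The code
    \<open>npair (H \<gamma> c i) 0\<close> denotes the complement of a ball in the base part, and
    \<open>npair whole (singleton (child s j))\<close> denotes the set at a child, whose complement
    is a piece of the set at \<open>s\<close>.\<close>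
  define R where "R \<gamma> c d \<longleftrightarrow> (\<exists>i. d = npair (H \<gamma> c i) 0) \<or>
    (\<exists>l<llen (nsnd c). \<exists>j. label_graph \<gamma> (lnth (nsnd c) l) 0 1 \<and>
      d = npair whole (singleton (child (lnth (nsnd c) l) j)))" for \<gamma> c d
  have "SR (\<lambda>\<alpha> z. R \<alpha> (nfst z) (nsnd z))"
    unfolding R_def by (intro sr_intros rec_intros SRT_comp_pair[OF H(1)])
  then obtain K where K: "SRT (\<lambda>\<alpha> z. K \<alpha> (nfst z) (nsnd z))"
    "\<And>\<alpha> n i. K \<alpha> n i = 0 \<or> R \<alpha> n (K \<alpha> n i)" "\<And>\<alpha> n c. R \<alpha> n c \<Longrightarrow> \<exists>i. K \<alpha> n i = c"
    using SR_enumerate by blast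
  \<comment> \<open>If all listed nodes carry codes of open sets, the base part is everything and
    gets a code of an open set. Otherwise the code starts with 1 and has as subcodes the codes of
    the sets listed by \<open>K\<close>, through the index \<epsilon>.\<close>
  define D where "D \<epsilon> \<gamma> c n v \<longleftrightarrow>
    (\<forall>i<llen (nsnd c). label_graph \<gamma> (lnth (nsnd c) i) 0 0) \<and> (case n of 0 \<Rightarrow> 0 | Suc m \<Rightarrow> H \<gamma> c m) = v \<or>
    (\<exists>i<llen (nsnd c). label_graph \<gamma> (lnth (nsnd c) i) 0 1) \<and>
      (case n of 0 \<Rightarrow> 1 | Suc m \<Rightarrow> smn \<epsilon> (fpair \<gamma> (\<lambda>_. c)) m) = v" for \<epsilon> \<gamma> c n v
  note intros = sr_intros rec_intros SRT_subst_pair[OF H(1)] SRT_subst_pair[OF K(1)]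
  have "SR (\<lambda>\<omega> z. D (\<lambda>i. nfst (\<omega> i)) (\<lambda>i. nfst (nsnd (\<omega> i)))
      (K (\<lambda>i. nfst (nsnd (\<omega> i))) (nsnd (nsnd (\<omega> 0))) (nfst z)) (nfst (nsnd z)) (nsnd (nsnd z)))"
    unfolding D_def fpair_def by (intro intros)
  from ex_sequence_code[OF this] obtain \<epsilon> where \<epsilon>: "recursive_seq \<epsilon>" and
    "\<forall>\<beta> i \<delta>. (\<forall>n v. D \<epsilon> (\<lambda>i. nfst (\<beta> i)) (K (\<lambda>i. nfst (\<beta> i)) (nsnd (\<beta> 0)) i) n v \<longleftrightarrow> \<delta> n = v) \<longrightarrow>
      subcode G (case_nat 1 (smn \<epsilon> \<beta>)) i = Some (Seq \<delta>)"
    by (simp only: fpair_simps npair_simps) blast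
  then have subcode_\<epsilon>: "subcode G (case_nat 1 (smn \<epsilon> (fpair \<gamma> (\<lambda>_. c)))) i = Some (Seq \<delta>)"
    if "\<And>n v. D \<epsilon> \<gamma> (K \<gamma> c i) n v \<longleftrightarrow> \<delta> n = v" for \<gamma> c i \<delta>
    using that by simp
  have SR: "SR (\<lambda>\<alpha> z. D \<epsilon> \<alpha> (nfst z) (nfst (nsnd z)) (nsnd (nsnd z)))"
    unfolding D_def fpair_def by (intro intros recursive_seq_comp[OF \<epsilon>])
  have "\<exists>\<delta>. (\<forall>c n v. D \<epsilon> \<gamma> c n v \<longleftrightarrow> \<delta> c n = v) \<and>
      (\<forall>\<eta> c. fin_ord 1 \<le> \<eta> \<longrightarrow> (\<forall>i<llen (nsnd c). \<exists>\<eta>'\<le>\<eta>. BC G \<eta>' (node \<gamma> (lnth (nsnd c) i))) \<longrightarrow>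
        (\<exists>\<eta>'\<le>\<eta>. BC G \<eta>' (\<delta> c) \<and> rho G CO (\<delta> c) = union_set \<gamma> c))"
    if BC: "BC G \<xi> \<gamma>" for \<xi> \<gamma>
  proof -
    define leaf where "leaf c \<longleftrightarrow> (\<forall>s\<in>lset (nsnd c). node \<gamma> s 0 = 0)" for c
    define \<delta> where "\<delta> c = (if leaf c then case_nat 0 (H \<gamma> c) else case_nat 1 (smn \<epsilon> (fpair \<gamma> (\<lambda>_. c))))" for c
    have not_leaf: "\<not> leaf c \<longleftrightarrow> (\<exists>s\<in>lset (nsnd c). node \<gamma> s 0 = 1)" for c
      unfolding leaf_def using node_0_cases[OF BC] by (metis zero_neq_one)
    have D_iff: "D \<epsilon> \<gamma> c n v \<longleftrightarrow> \<delta> c n = v" for c n v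
    proof -
      have "(\<forall>i<llen (nsnd c). node \<gamma> (lnth (nsnd c) i) 0 = 0) \<longleftrightarrow> leaf c"
        "(\<exists>i<llen (nsnd c). node \<gamma> (lnth (nsnd c) i) 0 = 1) \<longleftrightarrow> \<not> leaf c"
        unfolding not_leaf by (auto simp: leaf_def)
      then show ?thesis unfolding D_def label_graph[OF BC] by (auto simp: \<delta>_def)
    qed
    have subcode: "subcode G (\<delta> c) i = Some (Seq (\<delta> (K \<gamma> c i)))" if "\<not> leaf c" for c i
      using subcode_\<epsilon>[OF D_iff] that by (simp add: \<delta>_def)
    have base: "(\<Union>i. nbhd CO (H \<gamma> c i)) = {y \<in> pts CO. base_part (labels \<gamma>) (enc y) c}" for c
      unfolding H(2) label_graph[OF BC] ..
    have pts: "y \<in> pts CO \<longleftrightarrow> (\<exists>x k. y = Pr (Seq x) (Nat k) \<and> (\<forall>n. x n \<le> 1))" for y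
      by (auto simp: pts_prod pts_Cantor pts_Omega)
    have M0: "union_set \<gamma> 0 = pts CO"
      by (auto simp: pts union_set_def nbhd_iff[OF type_le_1_CO])
    have main: "\<exists>\<eta>'\<le>\<eta>. BC G \<eta>' (\<delta> c) \<and> rho G CO (\<delta> c) = union_set \<gamma> c"
      if "fin_ord 1 \<le> \<eta>" "\<forall>s\<in>lset (nsnd c). \<exists>\<eta>'\<le>\<eta>. BC G \<eta>' (node \<gamma> s)" for \<eta> c
      using that
    \<comment> \<open>The subcodes belong to other members of the same family, so the statement is
      proved for all \<open>c\<close> at once, by induction on the rank bound.\<close>
    proof (induction \<eta> arbitrary: c rule: less_induct)
      case (less \<eta>)
      show ?case
      proof (cases "leaf c")
        case True
        then have "\<delta> c 0 = 0" by (simp add: \<delta>_def)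
        then have "BC G (fin_ord 1) (\<delta> c)" by (rule BC.BC_1)
        moreover have "rho G CO (\<delta> c) = (\<Union>i. nbhd CO (H \<gamma> c i))"
          using rho_leaf[of "\<delta> c", OF \<open>\<delta> c 0 = 0\<close>] True by (simp add: \<delta>_def)
        moreover have "(\<Union>i. nbhd CO (H \<gamma> c i)) = union_set \<gamma> c"
          unfolding base
        proof (intro equalityI subsetI)
          fix y assume "y \<in> {y \<in> pts CO. base_part (labels \<gamma>) (enc y) c}"
          then obtain x k where y: "y = Pr (Seq x) (Nat k)" "\<forall>n. x n \<le> 1"
            "base_part (labels \<gamma>) (fpair x (\<lambda>_. k)) c"
            by (auto simp: pts)
          then show "y \<in> union_set \<gamma> c"
            unfolding y(1) union_set_iff using base_part_iff[OF BC y(2)] by blast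
        next
          fix y assume "y \<in> union_set \<gamma> c"
          then obtain x k where y: "y = Pr (Seq x) (Nat k)" "\<forall>n. x n \<le> 1"
            "y \<notin> nbhd CO (nfst c) \<or> (\<exists>s\<in>lset (nsnd c). in_node \<gamma> x s)"
            unfolding union_set_def by blast
          then have "base_part (labels \<gamma>) (fpair x (\<lambda>_. k)) c"
            unfolding y(1) base_part_iff[OF BC y(2)] using True unfolding leaf_def by blast
          with y show "y \<in> {y \<in> pts CO. base_part (labels \<gamma>) (enc y) c}" by simp
        qed
        ultimately show ?thesis using less.prems(1) by auto
      next
        case False
        from False obtain s0 where "s0 \<in> lset (nsnd c)" "node \<gamma> s0 0 \<noteq> 0" unfolding leaf_def by blast
        \<comment> \<open>A listed node that does not carry a code of an open set forces \<eta> to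
          be at least 2. This leaves rank 1 for the complements of balls among the subcodes.\<close>
        then have "fin_ord 2 \<le> \<eta>" using less.prems(2) BC_nodeD(1) by (meson order_trans)
        then have 1: "fin_ord 1 < \<eta>" using fin_ord_less(1) by order
        have R: "R \<gamma> c d \<longleftrightarrow> (\<exists>i. d = npair (H \<gamma> c i) 0) \<or>
          (\<exists>s\<in>lset (nsnd c). \<exists>j. node \<gamma> s 0 = 1 \<and> d = npair whole (singleton (child s j)))" for d
          unfolding R_def label_graph[OF BC] by blast
        have child: "\<exists>\<eta>'<\<eta>. fin_ord 1 \<le> \<eta>' \<and> BC G \<eta>' (\<delta> (K \<gamma> c i)) \<and>
          rho G CO (\<delta> (K \<gamma> c i)) = union_set \<gamma> (K \<gamma> c i)" for i
        proof -
          have "\<exists>\<eta>'<\<eta>. fin_ord 1 \<le> \<eta>' \<and> (\<forall>s\<in>lset (nsnd (K \<gamma> c i)). \<exists>\<eta>''\<le>\<eta>'. BC G \<eta>'' (node \<gamma> s))"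
          proof -
            \<comment> \<open>The first case comprises the default value 0 and the complements of
              balls: no node is listed, so rank 1 will do. In the second case the only node is a
              child, of smaller rank than its parent.\<close>
            consider "nsnd (K \<gamma> c i) = 0" | s j where "s \<in> lset (nsnd c)" "node \<gamma> s 0 = 1"
              "K \<gamma> c i = npair whole (singleton (child s j))"
              using K(2)[of \<gamma> c i] R by fastforce
            then show ?thesis
            proof cases
              case 1
              with \<open>fin_ord 1 < \<eta>\<close> show ?thesis by (intro exI[of _ "fin_ord 1"]) auto
            next
              case 2
              then obtain \<eta>' where "\<eta>' \<le> \<eta>" "BC G \<eta>' (node \<gamma> s)" using less.prems(2) by blast
              with 2(2) BC_nodeD(4)[of \<eta>' "node \<gamma> s" j] obtain \<eta>'' where "\<eta>'' < \<eta>" "BC G \<eta>'' (sub (node \<gamma> s) j)"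
                by (metis less_le_trans zero_neq_one)
              with 2(3) BC_ge_1 show ?thesis by (intro exI[of _ \<eta>'']) auto
            qed
          qed
          then show ?thesis using less.IH BC_ge_1 by (meson le_less_trans)
        qed
        have "\<delta> c 0 = 1" using False by (simp add: \<delta>_def)
        have BC_c: "BC G \<eta> (\<delta> c)"
        proof (rule BC.BC_step)
          show "\<forall>i. \<exists>\<delta>' \<iota>. subcode G (\<delta> c) i = Some (Seq \<delta>') \<and> fin_ord 1 \<le> \<iota> \<and> \<iota> < \<eta> \<and> BC G \<iota> \<delta>'"
            using subcode[OF False] child by blast
        qed fact+
        have "\<delta> c 0 \<noteq> 0" using \<open>\<delta> c 0 = 1\<close> by simp
        have "sub (\<delta> c) i = \<delta> (K \<gamma> c i)" for i
          using subcode[OF False, of i] \<open>\<delta> c 0 \<noteq> 0\<close> by (simp add: sub_def)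
        moreover have "rho G CO (\<delta> (K \<gamma> c i)) = union_set \<gamma> (K \<gamma> c i)" for i
          using child[of i] by blast
        ultimately have "rho G CO (\<delta> c) = (\<Union>i. pts CO - union_set \<gamma> (K \<gamma> c i))"
          by (simp only: rho_node[OF BC_c \<open>\<delta> c 0 \<noteq> 0\<close>])
        also have "\<dots> = union_set \<gamma> c"
        proof (intro equalityI subsetI)
          fix y assume "y \<in> (\<Union>i. pts CO - union_set \<gamma> (K \<gamma> c i))"
          then obtain i where i: "y \<in> pts CO" "y \<notin> union_set \<gamma> (K \<gamma> c i)" by blast
          from i(1) obtain x k where y: "y = Pr (Seq x) (Nat k)" "\<forall>n. x n \<le> 1" unfolding pts by blast
          have "K \<gamma> c i \<noteq> 0" using i M0 by metis
          with K(2)[of \<gamma> c i] have "R \<gamma> c (K \<gamma> c i)" by blast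
          then consider j where "K \<gamma> c i = npair (H \<gamma> c j) 0" |
            s j where "s \<in> lset (nsnd c)" "node \<gamma> s 0 = 1" "K \<gamma> c i = npair whole (singleton (child s j))"
            unfolding R by blast
          then show "y \<in> union_set \<gamma> c"
          proof cases
            case 1
            with i(2) y have "y \<notin> nbhd CO (H \<gamma> c j) \<longrightarrow> False" by simp
            then have "y \<in> (\<Union>j. nbhd CO (H \<gamma> c j))" by blast
            then have "base_part (labels \<gamma>) (fpair x (\<lambda>_. k)) c" unfolding base y(1) by simp
            then show ?thesis unfolding y(1) union_set_iff using base_part_iff[OF BC y(2)] y(2) by blast
          next
            case 2
            with i(2) y have "\<not> in_node \<gamma> x (child s j)" by simp
            with 2(2) have "in_piece \<gamma> x s j" by (simp add: in_piece_def)
            then have "in_node \<gamma> x s" using in_node_iff[OF BC y(2)] by blast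
            with y(2) 2(1) show ?thesis unfolding y(1) union_set_iff by blast
          qed
        next
          fix y assume "y \<in> union_set \<gamma> c"
          then obtain x k where y: "y = Pr (Seq x) (Nat k)" "\<forall>n. x n \<le> 1"
            "y \<notin> nbhd CO (nfst c) \<or> (\<exists>s\<in>lset (nsnd c). in_node \<gamma> x s)"
            unfolding union_set_def by blast
          have "y \<in> pts CO" using y pts by blast
          have "\<exists>d. R \<gamma> c d \<and> y \<notin> union_set \<gamma> d"
          proof (cases "base_part (labels \<gamma>) (enc y) c")
            case True
            with \<open>y \<in> pts CO\<close> have "y \<in> (\<Union>i. nbhd CO (H \<gamma> c i))" unfolding base by blast
            then obtain i where "y \<in> nbhd CO (H \<gamma> c i)" by blast
            with y(1) R show ?thesis by (intro exI[of _ "npair (H \<gamma> c i) 0"]) auto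
          next
            case False
            then have "\<not> base_part (labels \<gamma>) (fpair x (\<lambda>_. k)) c" by (simp add: y(1))
            with y(1,3) base_part_iff[OF BC y(2), of k c] obtain s where
              s: "s \<in> lset (nsnd c)" "in_node \<gamma> x s" "node \<gamma> s 0 \<noteq> 0" by blast
            then obtain j where "in_piece \<gamma> x s j" using in_node_iff[OF BC y(2)] by blast
            with s(3) have "\<not> in_node \<gamma> x (child s j)" by (simp add: in_piece_def)
            moreover have "node \<gamma> s 0 = 1" using node_0_cases[OF BC, of s] s(3) by auto
            ultimately show ?thesis
              using R s(1) y(1,2) by (intro exI[of _ "npair whole (singleton (child s j))"])
                (auto simp: nbhd_iff[OF type_le_1_CO])
          qed
          then obtain i where "y \<notin> union_set \<gamma> (K \<gamma> c i)" using K(3) by blast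
          with \<open>y \<in> pts CO\<close> show "y \<in> (\<Union>i. pts CO - union_set \<gamma> (K \<gamma> c i))" by blast
        qed
        finally show ?thesis using BC_c by blast
      qed
    qed
    have "\<exists>\<eta>'\<le>\<eta>. BC G \<eta>' (\<delta> c) \<and> rho G CO (\<delta> c) = union_set \<gamma> c"
      if "fin_ord 1 \<le> \<eta>" "\<forall>i<llen (nsnd c). \<exists>\<eta>'\<le>\<eta>. BC G \<eta>' (node \<gamma> (lnth (nsnd c) i))" for \<eta> c
      using that by (intro main) auto
    with D_iff show ?thesis by blast
  qed
  with SR show ?thesis by blast
qed

text \<open>Each step down from a label with subcodes lowers the rank, while a step down from a code
  of an open set leads to the zero sequence. The first alternative is kept apart since rank 1 cannot
  be lowered.\<close>

lemma node_depth_2: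
  assumes "BC G \<xi> \<gamma>" "parent s \<noteq> 0" shows "node \<gamma> s = (\<lambda>_. 0) \<or> (\<exists>\<eta><\<xi>. \<exists>\<zeta><\<eta>. BC G \<zeta> (node \<gamma> s))"
proof -
  have sub: "sub \<beta> j = (\<lambda>_. 0) \<or> (\<exists>\<zeta><\<eta>. BC G \<zeta> (sub \<beta> j))" if "BC G \<eta> \<beta>" for \<eta> \<beta> j
    using BC_nodeD(4)[OF that] by (auto simp: sub_def)
  obtain t j where s: "s = child t j" "t \<noteq> 0"
    using assms(2) by (cases s) (auto, metis npair_simps(3))
  then obtain r i where t: "t = child r i" by (cases t) (auto, metis npair_simps(3))
  obtain \<eta> where \<eta>: "\<eta> \<le> \<xi>" "BC G \<eta> (node \<gamma> r)" using BC_node[OF assms(1)] by blast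
  from sub[OF \<eta>(2), of i] show ?thesis
  proof
    assume "sub (node \<gamma> r) i = (\<lambda>_. 0)"
    then show ?thesis by (simp add: s(1) t sub_def)
  next
    assume "\<exists>\<zeta><\<eta>. BC G \<zeta> (sub (node \<gamma> r) i)"
    then obtain \<zeta> where \<zeta>: "\<zeta> < \<xi>" "BC G \<zeta> (node \<gamma> t)"
      using \<eta>(1) by (metis less_le_trans node_child t)
    from sub[OF \<zeta>(2), of j] \<zeta>(1) show ?thesis by (auto simp: s(1))
  qed
qed

section \<open>Codes of the inverse map\<close>

definition inverse_approx :: "(nat \<Rightarrow> nat \<Rightarrow> nat \<Rightarrow> bool) \<Rightarrow> (nat \<Rightarrow> nat) \<Rightarrow> nat \<Rightarrow> nat \<Rightarrow> bool" where
  "inverse_approx N x u k \<longleftrightarrow> (\<forall>i<llen u. parent (lnth u i) \<noteq> 0) \<and> inverse_nbhd N x (lset u) k"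

lemma inverse_approx_iff:
  assumes "BC G \<xi> \<gamma>" "\<forall>n. x n \<le> 1" "Seq x \<notin> rho G Cantor \<gamma>"
  shows "Seq (fpair x (wit \<gamma> x)) \<in> nbhd Baire k \<longleftrightarrow>
    (\<exists>u. inverse_approx (labels \<gamma>) x u k \<and> (\<forall>s\<in>lset u. \<not> in_node \<gamma> x s))"
proof -
  have "lset u \<subseteq> zeros \<gamma> x \<longleftrightarrow> (\<forall>i<llen u. parent (lnth u i) \<noteq> 0) \<and> (\<forall>s\<in>lset u. \<not> in_node \<gamma> x s)" for u
    unfolding zeros_def by blast
  then show ?thesis
    unfolding inverse_nbhd_iff[OF assms, symmetric] inverse_approx_def
    using inverse_nbhd_finite[of \<gamma> x "zeros \<gamma> x" k] unfolding label_graph[OF assms(1)] by auto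
qed

lemma SR_inverse_approx:
  "SR (\<lambda>\<omega> u. inverse_approx (label_graph (\<lambda>i. nfst (\<omega> i))) (\<lambda>i. nfst (nsnd (\<omega> i))) u (nsnd (nsnd (\<omega> 0))))"
  unfolding inverse_approx_def by (intro sr_intros rec_intros)

text \<open>Up to rank 2 all nodes at distance at least 2 from the root are labelled by the zero
  sequence, so nonmembership holds there automatically. What remains of the description of the
  inverse is semirecursive, hence open.\<close>

lemma ex_inverse_open_code:
  "\<exists>K. SRT K \<and> (\<forall>\<xi> \<gamma>. \<xi> \<le> fin_ord 2 \<longrightarrow> BC G \<xi> \<gamma> \<longrightarrow> K \<gamma> 0 = 0 \<and>
    (\<forall>x k. (\<forall>n. x n \<le> 1) \<longrightarrow> Seq x \<notin> rho G Cantor \<gamma> \<longrightarrow>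
      (Pr (Seq x) (Nat k) \<in> rho G CO (K \<gamma>) \<longleftrightarrow> Seq (fpair x (wit \<gamma> x)) \<in> nbhd Baire k)))"
proof -
  have "SR (\<lambda>\<omega> n. \<exists>u. inverse_approx (label_graph (\<lambda>i. nfst (\<omega> i))) (\<lambda>i. nfst (nsnd (\<omega> i))) u (nsnd (nsnd (\<omega> 0))))"
    by (intro SR_ex SR_comp_recursive_seq[OF SR_inverse_approx] rec_intros)
  from SR_open_enumerate[OF type_le_1_CO this] obtain H where
    H: "SRT (\<lambda>\<beta> z. H \<beta> (nfst z) (nsnd z))"
    "\<And>\<gamma> n. (\<Union>i. nbhd CO (H \<gamma> n i)) = {y \<in> pts CO.
      \<exists>u. inverse_approx (label_graph \<gamma>) (\<lambda>i. nfst (enc y i)) u (nsnd (enc y 0))}"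
    by (simp only: fpair_simps) blast
  define K where "K \<gamma> n = (case n of 0 \<Rightarrow> 0 | Suc i \<Rightarrow> H \<gamma> 0 i)" for \<gamma> n
  have "SRT K" unfolding K_def by (intro sr_intros rec_intros SRT_comp_pair[OF H(1)])
  moreover have "Pr (Seq x) (Nat k) \<in> rho G CO (K \<gamma>) \<longleftrightarrow> Seq (fpair x (wit \<gamma> x)) \<in> nbhd Baire k"
    if "\<xi> \<le> fin_ord 2" and BC: "BC G \<xi> \<gamma>" and x: "\<forall>n. x n \<le> 1" "Seq x \<notin> rho G Cantor \<gamma>" for \<xi> \<gamma> x k
  proof -
    have "\<not> in_node \<gamma> x s" if "parent s \<noteq> 0" for s
    proof -
      have False if *: "\<eta> < \<xi>" "\<zeta> < \<eta>" "BC G \<zeta> (node \<gamma> s)" for \<eta> \<zeta>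
      proof -
        \<comment> \<open>Two strict steps down from rank at most 2 would lead below 1, the least
          rank of a code.\<close>
        have "\<eta> < osuc (fin_ord 1)" using *(1) \<open>\<xi> \<le> fin_ord 2\<close> unfolding fin_ord_Suc(1) by order
        then have "\<zeta> < fin_ord 1" using *(2) unfolding less_osuc_iff by order
        with BC_ge_1[OF *(3)] show False by order
      qed
      with node_depth_2[OF BC that] have "node \<gamma> s = (\<lambda>_. 0)" by blast
      then have "\<not> in_piece \<gamma> x s j" for j by (simp add: in_piece_def)
      then show ?thesis using in_node_iff[OF BC x(1)] by blast
    qed
    then have "inverse_approx (labels \<gamma>) x u k \<Longrightarrow> \<forall>s\<in>lset u. \<not> in_node \<gamma> x s" for u
      unfolding inverse_approx_def by blast
    then have "Seq (fpair x (wit \<gamma> x)) \<in> nbhd Baire k \<longleftrightarrow> (\<exists>u. inverse_approx (labels \<gamma>) x u k)"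
      unfolding inverse_approx_iff[OF BC x] by blast
    moreover have "rho G CO (K \<gamma>) = (\<Union>i. nbhd CO (H \<gamma> 0 i))"
      by (subst rho_leaf) (auto simp: K_def)
    ultimately show ?thesis using x(1) by (simp add: H(2) label_graph[OF BC])
  qed
  ultimately show ?thesis by (intro exI[of _ K]) (auto simp: K_def)
qed

text \<open>The inverse lies in the \<open>k\<close>-th ball iff some finite list \<open>u\<close>
  of nodes suffices and \<open>x\<close> is outside the sets at all of them. Splitting the open set
  of pairs accepted with \<open>u\<close> into balls \<open>a\<close>, this becomes a union of
  complements of the sets \<open>union_set \<gamma> (npair a u)\<close>, which have codes of rank
  below \<open>ominus \<xi>\<close>.\<close>

lemma ex_inverse_code:
  "\<exists>K. SRT K \<and> (\<forall>\<xi> \<gamma>. BC G \<xi> \<gamma> \<longrightarrow> BC G (ominus \<xi>) (K \<gamma>) \<and>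
    (\<forall>x k. (\<forall>n. x n \<le> 1) \<longrightarrow> Seq x \<notin> rho G Cantor \<gamma> \<longrightarrow>
      (Pr (Seq x) (Nat k) \<in> rho G CO (K \<gamma>) \<longleftrightarrow> Seq (fpair x (wit \<gamma> x)) \<in> nbhd Baire k)))"
proof -
  obtain K0 where K0: "SRT K0" "\<And>\<xi> \<gamma>. \<xi> \<le> fin_ord 2 \<Longrightarrow> BC G \<xi> \<gamma> \<Longrightarrow> K0 \<gamma> 0 = 0"
    "\<And>\<xi> \<gamma> x k. \<xi> \<le> fin_ord 2 \<Longrightarrow> BC G \<xi> \<gamma> \<Longrightarrow> \<forall>n. x n \<le> 1 \<Longrightarrow> Seq x \<notin> rho G Cantor \<gamma> \<Longrightarrow>
      (Pr (Seq x) (Nat k) \<in> rho G CO (K0 \<gamma>) \<longleftrightarrow> Seq (fpair x (wit \<gamma> x)) \<in> nbhd Baire k)"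
    using ex_inverse_open_code by (elim exE conjE) (rule that, blast+)
  obtain D where D: "SR (\<lambda>\<alpha> z. D \<alpha> (nfst z) (nfst (nsnd z)) (nsnd (nsnd z)))"
    "\<forall>\<xi> \<gamma>. BC G \<xi> \<gamma> \<longrightarrow> (\<exists>\<delta>. (\<forall>c n v. D \<gamma> c n v \<longleftrightarrow> \<delta> c n = v) \<and>
      (\<forall>\<eta> c. fin_ord 1 \<le> \<eta> \<longrightarrow> (\<forall>i<llen (nsnd c). \<exists>\<eta>'\<le>\<eta>. BC G \<eta>' (node \<gamma> (lnth (nsnd c) i))) \<longrightarrow>
        (\<exists>\<eta>'\<le>\<eta>. BC G \<eta>' (\<delta> c) \<and> rho G CO (\<delta> c) = union_set \<gamma> c)))"
    using ex_union_codes by (elim exE conjE) (rule that)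
  obtain R where R: "SR (\<lambda>\<beta> z. R \<beta> (nfst z) (nsnd z))"
    "\<And>\<gamma> u y. y \<in> pts CO \<Longrightarrow>
      inverse_approx (label_graph \<gamma>) (\<lambda>i. nfst (enc y i)) u (nsnd (enc y 0)) \<longleftrightarrow> (\<exists>a. R \<gamma> u a \<and> y \<in> nbhd CO a)"
    using SR_open[OF type_le_1_CO SR_inverse_approx] by (simp only: fpair_simps) blast
  \<comment> \<open>Codes \<open>c = npair a u\<close> for which \<open>a\<close> is a ball accepted
    with the list \<open>u\<close>. The distance condition is repeated explicitly, so that the rank
    bound applies to every such \<open>c\<close> without first producing a point of the
    ball.\<close>
  define S where "S \<gamma> n c \<longleftrightarrow> R \<gamma> (nsnd c) (nfst c) \<and> (\<forall>i<llen (nsnd c). parent (lnth (nsnd c) i) \<noteq> 0)"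
    for \<gamma> and n c :: nat
  have "SR (\<lambda>\<alpha> z. S \<alpha> (nfst z) (nsnd z))"
    unfolding S_def by (intro sr_intros rec_intros SR_comp_pair[OF R(1)])
  then obtain H where H: "SRT (\<lambda>\<alpha> z. H \<alpha> (nfst z) (nsnd z))"
    "\<And>\<alpha> n i. H \<alpha> n i = 0 \<or> S \<alpha> n (H \<alpha> n i)" "\<And>\<alpha> n c. S \<alpha> n c \<Longrightarrow> \<exists>i. H \<alpha> n i = c"
    using SR_enumerate by blast
  have "SR (\<lambda>\<omega> z. D (\<lambda>i. nsnd (\<omega> i)) (H (\<lambda>i. nsnd (\<omega> i)) 0 (nfst z)) (nfst (nsnd z)) (nsnd (nsnd z)))"
    using SR_subst[OF D(1), of "\<lambda>\<omega> n i. nsnd (\<omega> i)"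
        "\<lambda>\<omega> z. npair (H (\<lambda>i. nsnd (\<omega> i)) 0 (nfst z)) (npair (nfst (nsnd z)) (nsnd (nsnd z)))"]
    by (simp add: sr_intros rec_intros SRT_subst_pair[OF H(1)])
  from ex_sequence_code[OF this] obtain \<epsilon> where \<epsilon>: "recursive_seq \<epsilon>"
    "\<forall>\<gamma> i \<delta>. (\<forall>n v. D \<gamma> (H \<gamma> 0 i) n v \<longleftrightarrow> \<delta> n = v) \<longrightarrow>
      subcode G (case_nat 1 (smn \<epsilon> \<gamma>)) i = Some (Seq \<delta>)"
    by (simp only: fpair_simps npair_simps) blast
  define K1 where "K1 \<gamma> = (case_nat 1 (smn \<epsilon> \<gamma>) :: nat \<Rightarrow> nat)" for \<gamma>
  \<comment> \<open>For \<open>\<gamma> 0 = 0\<close> the rank is 1, and the inverse must have a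
    code of an open set, which starts with 0. This distinction is decidable.\<close>
  define K where "K \<gamma> n = (if \<gamma> 0 = 0 then K0 \<gamma> n else K1 \<gamma> n)" for \<gamma> n
  have "SRT K"
    unfolding K_def K1_def by (intro sr_intros rec_intros recursive_seq_comp[OF \<epsilon>(1)] SRT_comp[OF K0(1)])
  moreover have "BC G (ominus \<xi>) (K \<gamma>) \<and> (\<forall>x k. (\<forall>n. x n \<le> 1) \<longrightarrow> Seq x \<notin> rho G Cantor \<gamma> \<longrightarrow>
      (Pr (Seq x) (Nat k) \<in> rho G CO (K \<gamma>) \<longleftrightarrow> Seq (fpair x (wit \<gamma> x)) \<in> nbhd Baire k))"
    if BC: "BC G \<xi> \<gamma>" for \<xi> \<gamma>
  proof (cases "\<gamma> 0 = 0")
    case True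
    then have "K \<gamma> = K0 \<gamma>" by (auto simp: K_def)
    have "\<xi> = fin_ord 1" using BC by cases (use True in auto)
    then have "\<xi> \<le> fin_ord 2" using fin_ord_less by simp
    note K0 = K0(2,3)[OF this BC]
    have "BC G (ominus \<xi>) (K0 \<gamma>)" unfolding \<open>\<xi> = fin_ord 1\<close> ominus_1 BC_1_iff by (rule K0(1))
    with K0(2) show ?thesis unfolding \<open>K \<gamma> = K0 \<gamma>\<close> by blast
  next
    case False
    then have K: "K \<gamma> = K1 \<gamma>" by (auto simp: K_def)
    have 2: "fin_ord 2 \<le> ominus \<xi>" using BC_nodeD(1)[OF BC False] by (rule ominus_ge_2)
    then have 1: "fin_ord 1 < ominus \<xi>" using fin_ord_less(1) by order
    obtain \<delta> where \<delta>: "\<And>c n v. D \<gamma> c n v \<longleftrightarrow> \<delta> c n = v"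
      "\<And>\<eta> c. fin_ord 1 \<le> \<eta> \<Longrightarrow> (\<forall>i<llen (nsnd c). \<exists>\<eta>'\<le>\<eta>. BC G \<eta>' (node \<gamma> (lnth (nsnd c) i))) \<Longrightarrow>
        (\<exists>\<eta>'\<le>\<eta>. BC G \<eta>' (\<delta> c) \<and> rho G CO (\<delta> c) = union_set \<gamma> c)"
      using D(2)[rule_format, OF BC] by blast
    have subcode: "subcode G (K1 \<gamma>) i = Some (Seq (\<delta> (H \<gamma> 0 i)))" for i
      using \<epsilon>(2) \<delta>(1) unfolding K1_def by blast
    have child: "\<exists>\<eta><ominus \<xi>. fin_ord 1 \<le> \<eta> \<and> BC G \<eta> (\<delta> (H \<gamma> 0 i)) \<and>
      rho G CO (\<delta> (H \<gamma> 0 i)) = union_set \<gamma> (H \<gamma> 0 i)" for i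
    proof -
      have "\<exists>\<eta><ominus \<xi>. BC G \<eta> (node \<gamma> (lnth (nsnd (H \<gamma> 0 i)) l))" if "l < llen (nsnd (H \<gamma> 0 i))" for l
      proof -
        have "parent (lnth (nsnd (H \<gamma> 0 i)) l) \<noteq> 0"
          using H(2)[of \<gamma> 0 i] that by (auto simp: S_def)
        from node_depth_2[OF BC this] show ?thesis
        proof
          assume "node \<gamma> (lnth (nsnd (H \<gamma> 0 i)) l) = (\<lambda>_. 0)"
          then show ?thesis using 1 by (auto intro!: exI[of _ "fin_ord 1"] BC.BC_1)
        next
          assume "\<exists>\<eta><\<xi>. \<exists>\<zeta><\<eta>. BC G \<zeta> (node \<gamma> (lnth (nsnd (H \<gamma> 0 i)) l))"
          then show ?thesis using ominus_less BC_ge_1 by blast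
        qed
      qed
      \<comment> \<open>Each node listed in the code has rank below \<open>ominus \<xi>\<close>; as
        the list is finite, one rank below \<open>ominus \<xi>\<close> bounds them all, also at a
        limit.\<close>
      then have "\<exists>\<zeta><ominus \<xi>. fin_ord 1 \<le> \<zeta> \<and>
        (\<forall>l<llen (nsnd (H \<gamma> 0 i)). \<exists>\<zeta>'\<le>\<zeta>. BC G \<zeta>' (node \<gamma> (lnth (nsnd (H \<gamma> 0 i)) l)))"
        using 1 by (intro finite_bound_ord) auto
      then show ?thesis using \<delta>(2) BC_ge_1 by (meson le_less_trans)
    qed
    have 0: "K1 \<gamma> 0 = 1" by (simp add: K1_def)
    have BC_K: "BC G (ominus \<xi>) (K1 \<gamma>)"
    proof (rule BC.BC_step)
      show "\<forall>i. \<exists>\<delta>' \<eta>. subcode G (K1 \<gamma>) i = Some (Seq \<delta>') \<and> fin_ord 1 \<le> \<eta> \<and> \<eta> < ominus \<xi> \<and> BC G \<eta> \<delta>'"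
        using subcode child by blast
    qed fact+
    have "K1 \<gamma> 0 \<noteq> 0" using 0 by simp
    have "sub (K1 \<gamma>) i = \<delta> (H \<gamma> 0 i)" for i
      using subcode[of i] 0 by (simp add: sub_def)
    moreover have "rho G CO (\<delta> (H \<gamma> 0 i)) = union_set \<gamma> (H \<gamma> 0 i)" for i
      using child[of i] by blast
    ultimately have rho: "rho G CO (K1 \<gamma>) = (\<Union>i. pts CO - union_set \<gamma> (H \<gamma> 0 i))"
      by (simp only: rho_node[OF BC_K \<open>K1 \<gamma> 0 \<noteq> 0\<close>])
    have "Pr (Seq x) (Nat k) \<in> rho G CO (K1 \<gamma>) \<longleftrightarrow> Seq (fpair x (wit \<gamma> x)) \<in> nbhd Baire k"
      if x: "\<forall>n. x n \<le> 1" "Seq x \<notin> rho G Cantor \<gamma>" for x k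
    proof -
      let ?y = "Pr (Seq x) (Nat k)"
      have y: "?y \<in> pts CO" using x(1) by simp
      have approx: "inverse_approx (labels \<gamma>) x u k \<longleftrightarrow> (\<exists>a. R \<gamma> u a \<and> ?y \<in> nbhd CO a)" for u
        using R(2)[OF y, of \<gamma> u] unfolding label_graph[OF BC] by simp
      have mem: "?y \<notin> union_set \<gamma> c \<longleftrightarrow> ?y \<in> nbhd CO (nfst c) \<and> (\<forall>s\<in>lset (nsnd c). \<not> in_node \<gamma> x s)" for c
        unfolding union_set_iff using x(1) by blast
      have "?y \<in> rho G CO (K1 \<gamma>) \<longleftrightarrow> (\<exists>i. ?y \<notin> union_set \<gamma> (H \<gamma> 0 i))"
        unfolding rho using y by blast
      also have "\<dots> \<longleftrightarrow> (\<exists>c. S \<gamma> 0 c \<and> ?y \<notin> union_set \<gamma> c)"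
      proof
        assume "\<exists>i. ?y \<notin> union_set \<gamma> (H \<gamma> 0 i)"
        then obtain i where i: "?y \<notin> union_set \<gamma> (H \<gamma> 0 i)" ..
        then have "in_ball (den CO) (enc ?y) (nfst (H \<gamma> 0 i))"
          unfolding mem nbhd_iff[OF type_le_1_CO] by blast
        then have "H \<gamma> 0 i \<noteq> 0" by (intro notI) simp
        with H(2)[of \<gamma> 0 i] i show "\<exists>c. S \<gamma> 0 c \<and> ?y \<notin> union_set \<gamma> c" by blast
      next
        assume "\<exists>c. S \<gamma> 0 c \<and> ?y \<notin> union_set \<gamma> c"
        then show "\<exists>i. ?y \<notin> union_set \<gamma> (H \<gamma> 0 i)" using H(3) by metis
      qed
      also have "\<dots> \<longleftrightarrow> (\<exists>u a. S \<gamma> 0 (npair a u) \<and> ?y \<notin> union_set \<gamma> (npair a u))"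
        by (metis npair_simps(3))
      also have "\<dots> \<longleftrightarrow> (\<exists>u. inverse_approx (labels \<gamma>) x u k \<and> (\<forall>s\<in>lset u. \<not> in_node \<gamma> x s))"
        unfolding mem S_def npair_simps using approx by (auto simp: inverse_approx_def)
      also have "\<dots> \<longleftrightarrow> Seq (fpair x (wit \<gamma> x)) \<in> nbhd Baire k"
        unfolding inverse_approx_iff[OF BC x] ..
      finally show ?thesis .
    qed
    with BC_K show ?thesis unfolding K by blast
  qed
  ultimately show ?thesis by blast
qed

section \<open>The bijection, its inverse and the two functions\<close>

lemma Pi0_compl_rho:
  assumes "type_le_1 X" "BC G \<xi> \<gamma>" shows "Pi0 (top_of X) \<xi> (pts X - rho G X \<gamma>)"
  using Sigma0_rho[OF assms] rho_subset[OF assms] assms(1)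
  by (simp add: Pi0_def double_diff)

text \<open>Common to both halves of the theorem: \<zeta> is 1 in the first half and
  \<open>ominus \<xi>\<close> in the second, and only the code of the inverse map differs.\<close>

lemma bijection_onto_complement:
  assumes \<gamma>: "BC G \<xi> \<gamma>"
    and \<gamma>0: "\<gamma>0 0 = 0" "\<And>\<alpha>. Seq \<alpha> \<notin> rho G Baire \<gamma>0 \<longleftrightarrow>
      (\<exists>x. (\<forall>n. x n \<le> 1) \<and> Seq x \<notin> rho G Cantor \<gamma> \<and> \<alpha> = fpair x (wit \<gamma> x))"
    and \<gamma>1: "\<And>\<alpha>. \<forall>n. nfst (\<alpha> n) \<le> 1 \<Longrightarrow> pfun_of G Baire Cantor \<gamma>1 (Seq \<alpha>) = Some (Seq (\<lambda>n. nfst (\<alpha> n)))"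
    and \<gamma>2: "BC G \<zeta> \<gamma>2" "\<And>x k. \<forall>n. x n \<le> 1 \<Longrightarrow> Seq x \<notin> rho G Cantor \<gamma> \<Longrightarrow>
      Pr (Seq x) (Nat k) \<in> rho G CO \<gamma>2 \<longleftrightarrow> Seq (fpair x (wit \<gamma> x)) \<in> nbhd Baire k"
    and B: "B = pts Cantor - rho G Cantor \<gamma>" and C: "C = pts Baire - rho G Baire \<gamma>0"
    and f: "f = (\<lambda>x. the (pfun_of G Baire Cantor \<gamma>1 x))" and P: "P = rho G CO \<gamma>2"
  shows "Pi0 (top_of Cantor) \<xi> B" "Pi0 (top_of Baire) (fin_ord 1) C" "C \<subseteq> dom (pfun_of G Baire Cantor \<gamma>1)"
    "bij_betw f C B" "continuous_map (subtopology (top_of Baire) C) (subtopology (top_of Cantor) B) f"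
    "Sigma0 (top_of CO) \<zeta> P"
    "\<exists>g. partial_fun Cantor Baire g \<and> B \<subseteq> dom g \<and> computes Cantor Baire P g B \<and>
      Sigma0_measurable_on (top_of Cantor) (top_of Baire) \<zeta> B (\<lambda>y. the (g y)) \<and>
      (\<forall>y\<in>B. g y = Some (inv_into C f y))"
proof -
  note types = type_le_1.intros(2) type_le_1.intros(3)
  have B_iff: "y \<in> B \<longleftrightarrow> (\<exists>x. y = Seq x \<and> (\<forall>n. x n \<le> 1) \<and> Seq x \<notin> rho G Cantor \<gamma>)" for y
    unfolding B pts_Cantor by blast
  have C_iff: "z \<in> C \<longleftrightarrow> (\<exists>x. z = Seq (fpair x (wit \<gamma> x)) \<and> (\<forall>n. x n \<le> 1) \<and> Seq x \<notin> rho G Cantor \<gamma>)" for z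
  proof -
    have "z \<in> C \<longleftrightarrow> (\<exists>\<alpha>. z = Seq \<alpha> \<and> Seq \<alpha> \<notin> rho G Baire \<gamma>0)" unfolding C pts_Baire by blast
    then show ?thesis unfolding \<gamma>0(2) by blast
  qed
  have f_eq: "f (Seq (fpair x e)) = Seq x" "pfun_of G Baire Cantor \<gamma>1 (Seq (fpair x e)) \<noteq> None"
    if "\<forall>n. x n \<le> 1" for x e
    using \<gamma>1[of "fpair x e"] that by (simp_all add: f)
  show "Pi0 (top_of Cantor) \<xi> B" unfolding B by (rule Pi0_compl_rho[OF types(2) \<gamma>])
  show "Pi0 (top_of Baire) (fin_ord 1) C"
    unfolding C by (rule Pi0_compl_rho[OF types(1)]) (use \<gamma>0(1) in \<open>simp only: BC_1_iff\<close>)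
  show dom: "C \<subseteq> dom (pfun_of G Baire Cantor \<gamma>1)"
  proof
    fix z assume "z \<in> C"
    then show "z \<in> dom (pfun_of G Baire Cantor \<gamma>1)" unfolding C_iff using f_eq(2) by blast
  qed
  show bij: "bij_betw f C B"
    unfolding bij_betw_def
  proof
    show "inj_on f C"
    proof (rule inj_onI)
      fix z z' assume "z \<in> C" "z' \<in> C" "f z = f z'"
      then show "z = z'" unfolding C_iff using f_eq(1) by auto
    qed
    show "f ` C = B"
    proof (intro equalityI subsetI)
      fix y assume "y \<in> f ` C"
      then obtain z where "z \<in> C" "y = f z" by blast
      then show "y \<in> B" unfolding C_iff B_iff using f_eq(1) by auto
    next
      fix y assume "y \<in> B"
      then obtain x where x: "y = Seq x" "\<forall>n. x n \<le> 1" "Seq x \<notin> rho G Cantor \<gamma>" unfolding B_iff by blast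
      then have "Seq (fpair x (wit \<gamma> x)) \<in> C" unfolding C_iff by blast
      with f_eq(1)[OF x(2)] x(1) show "y \<in> f ` C" by (metis image_eqI)
    qed
  qed
  have CB: "C \<subseteq> pts Baire" "B \<subseteq> pts Cantor" unfolding B C by blast+
  have inv: "inv_into C f (Seq x) = Seq (fpair x (wit \<gamma> x))" if "\<forall>n. x n \<le> 1" "Seq x \<notin> rho G Cantor \<gamma>" for x
  proof (rule inv_into_f_eq)
    show "inj_on f C" using bij by (rule bij_betw_imp_inj_on)
    show "Seq (fpair x (wit \<gamma> x)) \<in> C" unfolding C_iff using that by blast
    show "f (Seq (fpair x (wit \<gamma> x))) = Seq x" using f_eq(1)[OF that(1)] .
  qed
  have "continuous_map (subtopology (top_of Baire) C) (top_of Cantor) f"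
  proof (rule continuous_map_top_of[OF types CB(1)])
    show "f z \<in> pts Cantor" if "z \<in> C" for z
      using that f_eq(1) unfolding C_iff by auto
    fix z t assume "z \<in> C"
    show "\<exists>t'. \<forall>y\<in>C. (\<forall>n<t'. enc y n = enc z n) \<longrightarrow> (\<forall>n<t. enc (f y) n = enc (f z) n)"
    proof (intro exI ballI impI)
      \<comment> \<open>Since \<open>f\<close> merely drops the second components, \<open>t\<close>
        coordinates of the argument determine \<open>t\<close> coordinates of the value.\<close>
      fix y assume "y \<in> C" and agree: "\<forall>n<t. enc y n = enc z n"
      from \<open>y \<in> C\<close> obtain x where x: "y = Seq (fpair x (wit \<gamma> x))" "\<forall>n. x n \<le> 1" unfolding C_iff by blast
      from \<open>z \<in> C\<close> obtain w where w: "z = Seq (fpair w (wit \<gamma> w))" "\<forall>n. w n \<le> 1" unfolding C_iff by blast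
      from agree show "\<forall>n<t. enc (f y) n = enc (f z) n"
        unfolding x(1) w(1) f_eq(1)[OF x(2)] f_eq(1)[OF w(2)] by (simp add: fpair_def)
    qed
  qed
  moreover have "f ` C \<subseteq> B" using bij by (simp add: bij_betw_def)
  ultimately show "continuous_map (subtopology (top_of Baire) C) (subtopology (top_of Cantor) B) f"
    unfolding continuous_map_in_subtopology using CB(1) types(1) by auto
  show P': "Sigma0 (top_of CO) \<zeta> P" unfolding P by (rule Sigma0_rho[OF type_le_1_CO \<gamma>2(1)])
  define g where "g y = (if y \<in> B then Some (inv_into C f y) else None)" for y
  have g_in: "the (g y) \<in> pts Baire" if "y \<in> B" for y
    using that inv unfolding g_def B_iff by auto
  have comp: "the (g y) \<in> nbhd Baire k \<longleftrightarrow> Pr y (Nat k) \<in> P" if "y \<in> B" for y k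
    using that inv \<gamma>2(2) unfolding g_def P B_iff by auto
  have "dom g = B" by (auto simp: g_def split: if_splits)
  show "\<exists>g. partial_fun Cantor Baire g \<and> B \<subseteq> dom g \<and> computes Cantor Baire P g B \<and>
      Sigma0_measurable_on (top_of Cantor) (top_of Baire) \<zeta> B (\<lambda>y. the (g y)) \<and>
      (\<forall>y\<in>B. g y = Some (inv_into C f y))"
  proof (intro exI conjI)
    have "ran g \<subseteq> pts Baire"
    proof
      fix z assume "z \<in> ran g"
      then obtain y where y: "g y = Some z" by (auto simp: ran_def)
      then have "y \<in> B" using \<open>dom g = B\<close> by blast
      from g_in[OF this] y show "z \<in> pts Baire" by simp
    qed
    with \<open>dom g = B\<close> CB(2) show "partial_fun Cantor Baire g" by (simp add: partial_fun_def)
    show "B \<subseteq> dom g" using \<open>dom g = B\<close> by simp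
    show "computes Cantor Baire P g B"
      unfolding computes_def using \<open>dom g = B\<close> comp rho_subset[OF type_le_1_CO \<gamma>2(1)] by (simp add: P)
    show "Sigma0_measurable_on (top_of Cantor) (top_of Baire) \<zeta> B (\<lambda>y. the (g y))"
      by (rule Sigma0_measurable_onI[OF types(2,1) CB(2) g_in P' comp])
    show "\<forall>y\<in>B. g y = Some (inv_into C f y)" by (simp add: g_def)
  qed
qed

text \<open>Total on Baire space, because the functionals are total; their values are specified at
  Borel codes. The middle component is constant, the projection being the same for all
  codes.\<close>

definition triple ::
  "((nat \<Rightarrow> nat) \<Rightarrow> nat \<Rightarrow> nat) \<Rightarrow> (nat \<Rightarrow> nat) \<Rightarrow> ((nat \<Rightarrow> nat) \<Rightarrow> nat \<Rightarrow> nat) \<Rightarrow> point \<Rightarrow> point option" where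
  "triple K \<pi> L p = (case p of Seq \<gamma> \<Rightarrow> Some (Pr (Seq (K \<gamma>)) (Pr (Seq \<pi>) (Seq (L \<gamma>)))) | _ \<Rightarrow> None)"

lemma triple_Seq [simp]: "triple K \<pi> L (Seq \<gamma>) = Some (Pr (Seq (K \<gamma>)) (Pr (Seq \<pi>) (Seq (L \<gamma>))))"
  by (simp add: triple_def)

lemma dom_triple: "dom (triple K \<pi> L) = pts Baire"
  by (auto simp: triple_def pts_Baire split: point.splits)

lemma partial_fun_triple: "partial_fun Baire (Baire \<otimes> Baire \<otimes> Baire) (triple K \<pi> L)"
proof -
  have "z \<in> pts (Baire \<otimes> Baire \<otimes> Baire)" if "triple K \<pi> L p = Some z" for p z
    using that by (cases p) (auto simp: triple_def)
  then show ?thesis by (auto simp: partial_fun_def dom_triple ran_def)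
qed

lemma recursive_on_triple:
  assumes "SRT K" "recursive_seq \<pi>" "SRT L"
  shows "recursive_on Baire (Baire \<otimes> Baire \<otimes> Baire) (triple K \<pi> L) (dom (triple K \<pi> L))"
proof -
  let ?Y = "Baire \<otimes> Baire \<otimes> Baire"
  have Y: "type_le_1 ?Y" and BO: "type_le_1 (Baire \<otimes> Omega)" by (intro type_le_1.intros)+
  define Q where "Q \<omega> n \<longleftrightarrow> in_ball (den ?Y) (fpair (K (\<lambda>i. nfst (\<omega> i))) (fpair \<pi> (L (\<lambda>i. nfst (\<omega> i))))) (nsnd (\<omega> 0))"
    for \<omega> and n :: nat
  have "SR (\<lambda>\<omega> n. Q \<omega> n)"
    unfolding Q_def fpair_def
    by (intro sr_intros rec_intros Y SRT_subst[OF assms(1)] SRT_subst[OF assms(3)] recursive_seq_comp[OF assms(2)])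
  from Sigma01_I[OF BO this, of 0]
  have "Sigma01 (Baire \<otimes> Omega) {x \<in> pts (Baire \<otimes> Omega). Q (enc x) 0}" .
  moreover have "computes Baire ?Y {x \<in> pts (Baire \<otimes> Omega). Q (enc x) 0} (triple K \<pi> L) (dom (triple K \<pi> L))"
    unfolding computes_def dom_triple by (auto simp: pts_Baire nbhd_iff[OF Y] Q_def)
  ultimately show ?thesis unfolding recursive_on_def by blast
qed

end

theorem theorem4p1:
  fixes G :: "pspace \<Rightarrow> point set"
  assumes "good_parametrization G"
  shows
    "(\<exists>F. partial_fun Baire (Baire \<otimes> Baire \<otimes> Baire) F \<and>
          recursive_on Baire (Baire \<otimes> Baire \<otimes> Baire) F (dom F) \<and>
          (\<forall>\<xi> \<gamma>. fin_ord 1 \<le> \<xi> \<longrightarrow> \<xi> \<le> fin_ord 2 \<longrightarrow> BC G \<xi> \<gamma> \<longrightarrow>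
             (let B = pts Cantor - rho G Cantor \<gamma> in
              Pi0 (top_of Cantor) \<xi> B \<and>
              (\<exists>\<gamma>0 \<gamma>1 \<gamma>2. F (Seq \<gamma>) = Some (Pr (Seq \<gamma>0) (Pr (Seq \<gamma>1) (Seq \<gamma>2))) \<and>
                 BC G (fin_ord 1) \<gamma>0 \<and>
                 (let C = pts Baire - rho G Baire \<gamma>0;
                      f = (\<lambda>x. the (pfun_of G Baire Cantor \<gamma>1 x));
                      P = rho G (Cantor \<otimes> Omega) \<gamma>2
                  in
                  Pi0 (top_of Baire) (fin_ord 1) C \<and>
                  C \<subseteq> dom (pfun_of G Baire Cantor \<gamma>1) \<and>
                  bij_betw f C B \<and>
                  continuous_map (subtopology (top_of Baire) C) (subtopology (top_of Cantor) B) f \<and>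
                  BC G (fin_ord 1) \<gamma>2 \<and>
                  openin (top_of (Cantor \<otimes> Omega)) P \<and>
                  (\<exists>g. partial_fun Cantor Baire g \<and> B \<subseteq> dom g \<and>
                       computes Cantor Baire P g B \<and>
                       continuous_map (subtopology (top_of Cantor) B) (top_of Baire) (\<lambda>y. the (g y)) \<and>
                       (\<forall>y\<in>B. g y = Some (inv_into C f y)))))))) \<and>
     (\<exists>F. partial_fun Baire (Baire \<otimes> Baire \<otimes> Baire) F \<and>
          recursive_on Baire (Baire \<otimes> Baire \<otimes> Baire) F (dom F) \<and>
          (\<forall>\<xi> \<gamma>. fin_ord 1 \<le> \<xi> \<longrightarrow> BC G \<xi> \<gamma> \<longrightarrow>
             (let B = pts Cantor - rho G Cantor \<gamma> in
              Pi0 (top_of Cantor) \<xi> B \<and>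
              (\<exists>\<gamma>0 \<gamma>1 \<gamma>2. F (Seq \<gamma>) = Some (Pr (Seq \<gamma>0) (Pr (Seq \<gamma>1) (Seq \<gamma>2))) \<and>
                 BC G (fin_ord 1) \<gamma>0 \<and>
                 (let C = pts Baire - rho G Baire \<gamma>0;
                      f = (\<lambda>x. the (pfun_of G Baire Cantor \<gamma>1 x));
                      P = rho G (Cantor \<otimes> Omega) \<gamma>2
                  in
                  Pi0 (top_of Baire) (fin_ord 1) C \<and>
                  C \<subseteq> dom (pfun_of G Baire Cantor \<gamma>1) \<and>
                  bij_betw f C B \<and>
                  continuous_map (subtopology (top_of Baire) C) (subtopology (top_of Cantor) B) f \<and>
                  BC G (ominus \<xi>) \<gamma>2 \<and>
                  Sigma0 (top_of (Cantor \<otimes> Omega)) (ominus \<xi>) P \<and>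
                  (\<exists>g. partial_fun Cantor Baire g \<and> B \<subseteq> dom g \<and>
                       computes Cantor Baire P g B \<and>
                       Sigma0_measurable_on (top_of Cantor) (top_of Baire) (ominus \<xi>) B (\<lambda>y. the (g y)) \<and>
                       (\<forall>y\<in>B. g y = Some (inv_into C f y))))))))"
proof -
  interpret parametrization G by unfold_locales (rule assms)
  obtain K where K: "SRT K" "\<And>\<xi> \<gamma>. BC G \<xi> \<gamma> \<Longrightarrow> K \<gamma> 0 = 0"
    "\<And>\<xi> \<gamma> \<alpha>. BC G \<xi> \<gamma> \<Longrightarrow> Seq \<alpha> \<notin> rho G Baire (K \<gamma>) \<longleftrightarrow>
      (\<exists>x. (\<forall>n. x n \<le> 1) \<and> Seq x \<notin> rho G Cantor \<gamma> \<and> \<alpha> = fpair x (wit \<gamma> x))"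
    using ex_closed_code by (elim exE conjE) (rule that, blast+)
  obtain \<pi> where \<pi>: "recursive_seq \<pi>" "\<And>\<alpha>. \<forall>n. nfst (\<alpha> n) \<le> 1 \<Longrightarrow>
      pfun_of G Baire Cantor \<pi> (Seq \<alpha>) = Some (Seq (\<lambda>n. nfst (\<alpha> n)))"
    using ex_projection_code by blast
  obtain L where L: "SRT L" "\<And>\<xi> \<gamma>. \<xi> \<le> fin_ord 2 \<Longrightarrow> BC G \<xi> \<gamma> \<Longrightarrow> L \<gamma> 0 = 0"
    "\<And>\<xi> \<gamma> x k. \<xi> \<le> fin_ord 2 \<Longrightarrow> BC G \<xi> \<gamma> \<Longrightarrow> \<forall>n. x n \<le> 1 \<Longrightarrow> Seq x \<notin> rho G Cantor \<gamma> \<Longrightarrow>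
      (Pr (Seq x) (Nat k) \<in> rho G CO (L \<gamma>) \<longleftrightarrow> Seq (fpair x (wit \<gamma> x)) \<in> nbhd Baire k)"
    using ex_inverse_open_code by (elim exE conjE) (rule that, blast+)
  obtain M where M: "SRT M" "\<And>\<xi> \<gamma>. BC G \<xi> \<gamma> \<Longrightarrow> BC G (ominus \<xi>) (M \<gamma>)"
    "\<And>\<xi> \<gamma> x k. BC G \<xi> \<gamma> \<Longrightarrow> \<forall>n. x n \<le> 1 \<Longrightarrow> Seq x \<notin> rho G Cantor \<gamma> \<Longrightarrow>
      (Pr (Seq x) (Nat k) \<in> rho G CO (M \<gamma>) \<longleftrightarrow> Seq (fpair x (wit \<gamma> x)) \<in> nbhd Baire k)"
    using ex_inverse_code by (elim exE conjE) (rule that, blast+)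
  show ?thesis
    \<comment> \<open>The two functions share the closed set and the projection. The third component
      is the code of an open set, correct up to rank 2, in the first function, and the code of rank
      \<open>ominus \<xi>\<close> in the second.\<close>
    apply (rule conjI[OF exI[of _ "triple K \<pi> L"] exI[of _ "triple K \<pi> M"]]; intro conjI allI impI)
    subgoal by (rule partial_fun_triple)
    subgoal by (rule recursive_on_triple[OF K(1) \<pi>(1) L(1)])
    subgoal premises BC for \<xi> \<gamma>
    proof -
      have L1: "BC G (fin_ord 1) (L \<gamma>)" and K1: "BC G (fin_ord 1) (K \<gamma>)"
        using L(2)[OF BC(2,3)] K(2)[OF BC(3)] by (simp_all only: BC_1_iff)
      note D = bijection_onto_complement[OF BC(3) K(2,3)[OF BC(3)] \<pi>(2) L1 L(3)[OF BC(2,3)] refl refl refl refl]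
      have "pts Cantor - rho G Cantor \<gamma> \<subseteq> topspace (top_of Cantor)"
        by (simp add: type_le_1.intros(3))
      from D(7) Sigma0_measurable_on_1[OF _ this] D(1-6) L1 K1 show ?thesis
        unfolding Let_def Sigma0_1_iff triple_Seq by blast
    qed
    subgoal by (rule partial_fun_triple)
    subgoal by (rule recursive_on_triple[OF K(1) \<pi>(1) M(1)])
    subgoal premises BC for \<xi> \<gamma>
    proof -
      have K1: "BC G (fin_ord 1) (K \<gamma>)"
        using K(2)[OF BC(2)] by (simp only: BC_1_iff)
      from bijection_onto_complement[OF BC(2) K(2,3)[OF BC(2)] \<pi>(2) M(2,3)[OF BC(2)] refl refl refl refl]
        M(2)[OF BC(2)] K1
      show ?thesis unfolding Let_def triple_Seq by blast
    qed
    done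
qed

end
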